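(* Let $\{G_n\}_{n\ge 0}$ be a non-constant surjective chain of finite groups which satisfies Property $( * )$, that is, there exist polynomials $\{f_l\}_{l\ge 1}$ such that $\mathrm{Ind}^l\,\mathrm{Res}^l=f_l(\mathrm{Ind}\,\mathrm{Res})$ for every $l\ge 1$. For $n\ge 1$ let $a_n=\frac{|G_n|}{|G_{n-1}|}$. Then: (1) $\{a_n\}_{n\ge 1}$ is an infinite set. Moreover, there exist two parameters $B\in\mathbb{N}$ (a positive integer) and $C\in\mathbb{Z}$ such that $a_n=B a_{n-1}+C$ for all $n\ge 2$. (2) The two parameters $B$ and $C$ from part (1) completely determine the polynomials $\{f_l\}_{l\ge 1}$: for every $l\ge 1$, $$f_l(X)=\frac{1}{B^{\frac{l(l-1)}{2}}}\,X\,(X-C)\,(X-[1+B]C)\,(X-[1+B+B^2]C)\cdots(X-[1+B+\cdots+B^{l-2}]C),$$ i.e. $f_l(X)=B^{-l(l-1)/2}\prod_{j=0}^{l-1}\Bigl(X-C\sum_{i=0}^{j-1}B^i\Bigr)$, where the empty sum is $0$.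
   Context: All groups are finite. For a finite group $G$, $R(G)$ denotes the $\mathbb{C}$-vector space whose basis is the set of (isomorphism classes of) irreducible complex representations of $G$; representations are regarded as vectors in $R(G)$. For a chain of groups $G_0\le G_1\le G_2\le\cdots$, $\mathrm{Res}:R(G_n)\to R(G_{n-1})$ and $\mathrm{Ind}:R(G_{n-1})\to R(G_n)$ are the linear maps given by restriction and induction of representations; $\mathrm{Res}^l:R(G_n)\to R(G_{n-l})$ and $\mathrm{Ind}^l:R(G_{n-l})\to R(G_n)$ are the $l$-step restriction and induction. A chain $\{G_n\}_{n\ge0}$ is a surjective chain if $G_{n-1}\le G_n$ and $\mathrm{Res}:R(G_n)\to R(G_{n-1})$ is a surjective linear map for all $n\ge 1$. A chain is constant if there is a group $G$ with $G_n=G$ for all $n$; non-constant means not constant. Property $( * )$: for every integer $l\ge1$ there exists a polynomial $f_l$ with rational coefficients such that $\mathrm{Ind}^l\mathrm{Res}^l=f_l(\mathrm{Ind}\,\mathrm{Res})$, meaning that for every $n\ge l$ the two linear operators $\mathrm{Ind}^l\mathrm{Res}^l$ and $f_l(\mathrm{Ind}\,\mathrm{Res})$ on $R(G_n)$ are equal (products of operators are compositions, and the constant term of $f_l$ multiplies the identity operator). The polynomial $f_l$ is independent of $n$. *)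

theory Defs
  imports
    "HOL-Algebra.Coset"
    "HOL-Computational_Algebra.Polynomial"
    "Jordan_Normal_Form.VS_Connect"
begin

(* A representation on C^d is a homomorphism into GL_d(C); its values outside the carrier of the
   group are irrelevant, so restricting to a subgroup leaves the function itself unchanged. *)
type_synonym 'a rep = "'a \<Rightarrow> complex mat"

abbreviation GL :: "nat \<Rightarrow> complex mat monoid" where
  "GL d \<equiv> units_of (ring_mat TYPE(complex) d ())"

definition rep_dim :: "'a monoid \<Rightarrow> 'a rep \<Rightarrow> nat" where
  "rep_dim G \<rho> = dim_row (\<rho> \<one>\<^bsub>G\<^esub>)"

definition representation :: "'a monoid \<Rightarrow> 'a rep \<Rightarrow> bool" where
  "representation G \<rho> \<longleftrightarrow> \<rho> \<in> hom G (GL (rep_dim G \<rho>))"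

definition rep_iso :: "'a monoid \<Rightarrow> 'a rep \<Rightarrow> 'a rep \<Rightarrow> bool" where
  "rep_iso G \<rho> \<sigma> \<longleftrightarrow>
     rep_dim G \<rho> = rep_dim G \<sigma> \<and>
     (\<exists>P \<in> carrier_mat (rep_dim G \<rho>) (rep_dim G \<rho>). invertible_mat P \<and>
        (\<forall>g \<in> carrier G. P * \<rho> g = \<sigma> g * P))"

definition invariant_subspace :: "'a monoid \<Rightarrow> 'a rep \<Rightarrow> complex vec set \<Rightarrow> bool" where
  "invariant_subspace G \<rho> W \<longleftrightarrow>
     VectorSpace.subspace class_ring W (module_vec TYPE(complex) (rep_dim G \<rho>)) \<and>
     (\<forall>g \<in> carrier G. \<forall>w \<in> W. \<rho> g *\<^sub>v w \<in> W)"

definition irreducible_rep :: "'a monoid \<Rightarrow> 'a rep \<Rightarrow> bool" where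
  "irreducible_rep G \<rho> \<longleftrightarrow>
     representation G \<rho> \<and> rep_dim G \<rho> > 0 \<and>
     (\<forall>W. invariant_subspace G \<rho> W \<longrightarrow>
        W = {0\<^sub>v (rep_dim G \<rho>)} \<or> W = carrier_vec (rep_dim G \<rho>))"

definition rep_class :: "'a monoid \<Rightarrow> 'a rep \<Rightarrow> 'a rep set" where
  "rep_class G \<rho> = {\<sigma>. representation G \<sigma> \<and> rep_iso G \<rho> \<sigma>}"

definition Irr :: "'a monoid \<Rightarrow> 'a rep set set" where
  "Irr G = rep_class G ` {\<rho>. irreducible_rep G \<rho>}"

(* The complex vector space with basis Irr G, as finitely supported coefficient functions. *)
definition rep_space :: "'a monoid \<Rightarrow> ('a rep set \<Rightarrow> complex) set" where
  "rep_space G = {v. finite {X. v X \<noteq> 0} \<and> {X. v X \<noteq> 0} \<subseteq> Irr G}"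

definition direct_sum_rep :: "'a rep list \<Rightarrow> 'a rep" where
  "direct_sum_rep \<sigma>s = (\<lambda>g. diag_block_mat (map (\<lambda>\<sigma>. \<sigma> g) \<sigma>s))"

(* A representation as a vector of rep_space G: decompose it into irreducibles and count the
   classes. For a finite group a decomposition exists and the multiplicities do not depend on it. *)
definition rep_vector :: "'a monoid \<Rightarrow> 'a rep \<Rightarrow> ('a rep set \<Rightarrow> complex)" where
  "rep_vector G \<rho> =
     (THE v. \<exists>\<sigma>s. (\<forall>\<sigma> \<in> set \<sigma>s. irreducible_rep G \<sigma>) \<and>
                  rep_iso G \<rho> (direct_sum_rep \<sigma>s) \<and>
                  v = (\<lambda>X. of_nat (count_list (map (rep_class G) \<sigma>s) X)))"

definition left_transversal :: "'a monoid \<Rightarrow> 'a monoid \<Rightarrow> 'a list \<Rightarrow> bool" where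
  "left_transversal H K ts \<longleftrightarrow>
     set ts \<subseteq> carrier K \<and>
     (\<forall>x \<in> carrier K. \<exists>!i. i < length ts \<and> inv\<^bsub>K\<^esub> (ts ! i) \<otimes>\<^bsub>K\<^esub> x \<in> carrier H)"

(* The induced representation of C[K] tensored over C[H] with the space of \<rho>, in the basis
   t_i \<otimes> e_k: its (i, j) block at g is \<rho> (t_i^-1 g t_j) if that element lies in H, and zero
   otherwise. Another choice of transversal gives an isomorphic representation. *)
definition induced_rep :: "'a monoid \<Rightarrow> 'a monoid \<Rightarrow> 'a rep \<Rightarrow> 'a rep" where
  "induced_rep H K \<rho> =
     (let ts = (SOME ts. left_transversal H K ts);
          d = rep_dim H \<rho>
      in (\<lambda>g. mat (length ts * d) (length ts * d)
            (\<lambda>(r, c). let h = inv\<^bsub>K\<^esub> (ts ! (r div d)) \<otimes>\<^bsub>K\<^esub> g \<otimes>\<^bsub>K\<^esub> (ts ! (c div d))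
                      in if h \<in> carrier H then \<rho> h $$ (r mod d, c mod d) else 0)))"

definition linear_extension ::
  "('b \<Rightarrow> 'c \<Rightarrow> complex) \<Rightarrow> ('b \<Rightarrow> complex) \<Rightarrow> ('c \<Rightarrow> complex)" where
  "linear_extension F v = (\<lambda>Y. \<Sum>X | v X \<noteq> 0. v X * F X Y)"

definition Res :: "'a monoid \<Rightarrow> 'a monoid \<Rightarrow> ('a rep set \<Rightarrow> complex) \<Rightarrow> ('a rep set \<Rightarrow> complex)" where
  "Res H K = linear_extension (\<lambda>X. rep_vector H (SOME \<rho>. \<rho> \<in> X))"

definition Ind :: "'a monoid \<Rightarrow> 'a monoid \<Rightarrow> ('a rep set \<Rightarrow> complex) \<Rightarrow> ('a rep set \<Rightarrow> complex)" where
  "Ind H K = linear_extension (\<lambda>X. rep_vector K (induced_rep H K (SOME \<rho>. \<rho> \<in> X)))"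

(* The l-fold restriction from G n down to G (n - l) and the l-fold induction back up to G n;
   both are meaningful for l \<le> n only. *)
primrec Res_pow ::
  "(nat \<Rightarrow> 'a monoid) \<Rightarrow> nat \<Rightarrow> nat \<Rightarrow> ('a rep set \<Rightarrow> complex) \<Rightarrow> ('a rep set \<Rightarrow> complex)" where
  "Res_pow G n 0 = id"
| "Res_pow G n (Suc l) = Res (G (n - Suc l)) (G (n - l)) \<circ> Res_pow G n l"

primrec Ind_pow ::
  "(nat \<Rightarrow> 'a monoid) \<Rightarrow> nat \<Rightarrow> nat \<Rightarrow> ('a rep set \<Rightarrow> complex) \<Rightarrow> ('a rep set \<Rightarrow> complex)" where
  "Ind_pow G n 0 = id"
| "Ind_pow G n (Suc l) = Ind_pow G n l \<circ> Ind (G (n - Suc l)) (G (n - l))"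

definition poly_operator ::
  "rat poly \<Rightarrow> (('b \<Rightarrow> complex) \<Rightarrow> ('b \<Rightarrow> complex)) \<Rightarrow> ('b \<Rightarrow> complex) \<Rightarrow> ('b \<Rightarrow> complex)" where
  "poly_operator p T v = (\<lambda>X. \<Sum>i\<le>degree p. of_rat (coeff p i) * (T ^^ i) v X)"

(* The inclusion being a homomorphism says that each group is a subgroup of the next one; the
   multiplications need not agree outside the carriers. *)
definition group_chain :: "(nat \<Rightarrow> 'a monoid) \<Rightarrow> bool" where
  "group_chain G \<longleftrightarrow>
     (\<forall>n. group (G n) \<and> finite (carrier (G n))) \<and>
     (\<forall>n\<ge>1. (\<lambda>x. x) \<in> hom (G (n - 1)) (G n))"

definition surjective_chain :: "(nat \<Rightarrow> 'a monoid) \<Rightarrow> bool" where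
  "surjective_chain G \<longleftrightarrow>
     group_chain G \<and> (\<forall>n\<ge>1. Res (G (n - 1)) (G n) ` rep_space (G n) = rep_space (G (n - 1)))"

(* Equality of groups means equal carriers and equal multiplication on them. *)
definition constant_chain :: "(nat \<Rightarrow> 'a monoid) \<Rightarrow> bool" where
  "constant_chain G \<longleftrightarrow>
     (\<exists>H :: 'a monoid. group H \<and> (\<forall>n. carrier (G n) = carrier H \<and> (\<lambda>x. x) \<in> hom (G n) H))"

definition property_star :: "(nat \<Rightarrow> 'a monoid) \<Rightarrow> (nat \<Rightarrow> rat poly) \<Rightarrow> bool" where
  "property_star G f \<longleftrightarrow>
     (\<forall>l\<ge>1. \<forall>n\<ge>l. \<forall>v \<in> rep_space (G n).
        Ind_pow G n l (Res_pow G n l v) =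
        poly_operator (f l) (Ind (G (n - 1)) (G n) \<circ> Res (G (n - 1)) (G n)) v)"

definition order_ratio :: "(nat \<Rightarrow> 'a monoid) \<Rightarrow> nat \<Rightarrow> rat" where
  "order_ratio G n = of_nat (Coset.order (G n)) / of_nat (Coset.order (G (n - 1)))"

end

theory Submission
  imports Defs "Jordan_Normal_Form.Spectral_Radius"
begin

text \<open>Characters turn the theorem into a statement about fixed points on cosets. The operator
  \<open>Ind Res\<close> multiplies the character of a vector by the permutation character of \<open>G n\<close> on the cosets of
  \<open>G (n - 1)\<close>, and likewise \<open>Ind\<^sup>l Res\<^sup>l\<close> by the permutation character on the cosets of \<open>G (n - l)\<close>. Applied
  to the trivial representation, the polynomial identity says that \<open>f l\<close> maps the number of cosets of
  \<open>G (n - 1)\<close> fixed by \<open>x\<close> to the number of cosets of \<open>G (n - l)\<close> fixed by \<open>x\<close>, for each \<open>x\<close> in \<open>G n\<close>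
  (\<open>property_star_fixpoints\<close>).

  For the unit this reads \<open>f l (a n) = a n * a (n - 1) * ... * a (n - l + 1)\<close>, where \<open>a n\<close> is the index of
  \<open>G (n - 1)\<close> in \<open>G n\<close>. Once the \<open>a n\<close> are known to take infinitely many values, the rest is elementary.
  The polynomial \<open>f 2\<close> vanishes at zero, so \<open>f 2 / X\<close> is a polynomial mapping \<open>a n\<close> to \<open>a (n - 1)\<close>; since
  the \<open>a n\<close> are positive and unbounded, growth forces it to be linear (\<open>backward_step_linear\<close>). Its inverse
  gives the recurrence, integrality of the \<open>a n\<close> makes \<open>B\<close> and \<open>C\<close> integers
  (\<open>affine_recurrence_of_star\<close>), and solving the recurrence backwards gives \<open>f l\<close> at infinitely many points
  (\<open>polynomial_of_affine_recurrence\<close>).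

  That the indices are unbounded is the heart of the matter (\<open>infinite_chain_index\<close>). At a step where the
  chain grows, Jordan's theorem provides an \<open>x\<close> in \<open>G (m + 1)\<close> that is not conjugate into \<open>G m\<close>
  (\<open>ex_coset_fixpoints_eq_0\<close>). Surjectivity of restriction extends the permutation character that
  separates \<open>x\<close> from \<open>G m\<close> to all larger groups, so \<open>x\<close> does not become conjugate into \<open>G m\<close> further up
  (\<open>coset_fixpoints_eq_0_mono\<close>). The fixed point numbers of \<open>x\<close> in the steps above \<open>G m\<close> are then told apart
  by which of the \<open>f l\<close> vanish at them. They are infinitely many natural numbers bounded by the indices.

  The vector of a representation is defined through a decomposition into irreducible representations.
  Its character is available only after Maschke's theorem (\<open>completely_reducible\<close>) and the orthogonality
  of irreducible characters (\<open>multiplicity_eq_char_pairing\<close>), which show that a decomposition exists and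
  that the multiplicities are unique.\<close>

section \<open>Traces, sums and column spaces of matrices\<close>

definition mat_trace :: "complex mat \<Rightarrow> complex" where
  "mat_trace A = (\<Sum>i<dim_row A. A $$ (i, i))"

lemma mat_mult_index_sum:
  assumes "A \<in> carrier_mat l m" "B \<in> carrier_mat m n" "i < l" "j < n"
  shows "(A * B) $$ (i, j) = (\<Sum>k<m. A $$ (i, k) * B $$ (k, j))"
  using assms by (auto simp: scalar_prod_def atLeast0LessThan intro!: sum.cong)

lemma mat_mult_vec_index_sum:
  assumes "A \<in> carrier_mat l m" "v \<in> carrier_vec m" "i < l"
  shows "(A *\<^sub>v v) $ i = (\<Sum>k<m. A $$ (i, k) * v $ k)"
  using assms by (auto simp: scalar_prod_def atLeast0LessThan intro!: sum.cong)

lemma mat_trace_comm: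
  assumes A: "A \<in> carrier_mat m n" and B: "B \<in> carrier_mat n m"
  shows "mat_trace (A * B) = mat_trace (B * A)"
proof -
  have "mat_trace (A * B) = (\<Sum>i<m. \<Sum>k<n. A $$ (i, k) * B $$ (k, i))"
    unfolding mat_trace_def using A B
    by (intro sum.cong) (simp_all add: mat_mult_index_sum[OF A B] del: index_mult_mat(1))
  also have "\<dots> = (\<Sum>k<n. \<Sum>i<m. B $$ (k, i) * A $$ (i, k))"
    by (subst sum.swap) (simp add: mult.commute)
  also have "\<dots> = mat_trace (B * A)"
    unfolding mat_trace_def using A B
    by (intro sum.cong) (simp_all add: mat_mult_index_sum[OF B A] del: index_mult_mat(1))
  finally show ?thesis .
qed

lemma mat_trace_four_block:
  assumes "A \<in> carrier_mat m m" "D \<in> carrier_mat n n"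
  shows "mat_trace (four_block_mat A B C D) = mat_trace A + mat_trace D"
proof -
  have "mat_trace (four_block_mat A B C D) = (\<Sum>i<m + n. four_block_mat A B C D $$ (i, i))"
    using assms by (simp add: mat_trace_def)
  also have "\<dots> = (\<Sum>i<m. four_block_mat A B C D $$ (i, i)) +
      (\<Sum>i<n. four_block_mat A B C D $$ (m + i, m + i))"
    by (induction n) (simp_all add: algebra_simps)
  also have "\<dots> = mat_trace A + mat_trace D"
    using assms by (simp add: mat_trace_def)
  finally show ?thesis .
qed

lemma mat_trace_one: "mat_trace (1\<^sub>m n) = of_nat n"
  by (simp add: mat_trace_def)

text \<open>Matrices of varying sizes carry no additive type class, so a finite sum of matrices is
  formed entrywise.\<close>

definition mat_sum :: "nat \<Rightarrow> nat \<Rightarrow> 'b set \<Rightarrow> ('b \<Rightarrow> complex mat) \<Rightarrow> complex mat" where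
  "mat_sum m n S F = mat m n (\<lambda>(i, j). \<Sum>g\<in>S. F g $$ (i, j))"

lemma mat_sum_carrier [simp, intro]: "mat_sum m n S F \<in> carrier_mat m n"
  by (simp add: mat_sum_def)

lemma mat_sum_index:
  "i < m \<Longrightarrow> j < n \<Longrightarrow> mat_sum m n S F $$ (i, j) = (\<Sum>g\<in>S. F g $$ (i, j))"
  by (simp add: mat_sum_def)

lemma mat_sum_cong: "(\<And>g. g \<in> S \<Longrightarrow> F g = F' g) \<Longrightarrow> mat_sum m n S F = mat_sum m n S F'"
  by (auto simp: mat_sum_def intro!: eq_matI sum.cong)

lemma mat_sum_reindex:
  assumes "bij_betw p S S"
  shows "mat_sum m n S (\<lambda>g. F (p g)) = mat_sum m n S F"
proof -
  have "(\<Sum>g\<in>S. F (p g) $$ (i, j)) = (\<Sum>g\<in>S. F g $$ (i, j))" for i j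
    using assms by (rule sum.reindex_bij_betw)
  thus ?thesis by (simp add: mat_sum_def)
qed

lemma mult_mat_sum:
  assumes A: "A \<in> carrier_mat l m" and F: "\<And>g. g \<in> S \<Longrightarrow> F g \<in> carrier_mat m n"
  shows "A * mat_sum m n S F = mat_sum l n S (\<lambda>g. A * F g)"
proof (rule eq_matI)
  fix i j assume "i < dim_row (mat_sum l n S (\<lambda>g. A * F g))"
    "j < dim_col (mat_sum l n S (\<lambda>g. A * F g))"
  hence ij: "i < l" "j < n" by (auto simp: mat_sum_def)
  have "(A * mat_sum m n S F) $$ (i, j) = (\<Sum>k<m. \<Sum>g\<in>S. A $$ (i, k) * F g $$ (k, j))"
    using ij
    by (simp add: mat_mult_index_sum[OF A mat_sum_carrier] mat_sum_index sum_distrib_left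
        del: index_mult_mat(1))
  also have "\<dots> = (\<Sum>g\<in>S. \<Sum>k<m. A $$ (i, k) * F g $$ (k, j))" by (rule sum.swap)
  also have "\<dots> = (\<Sum>g\<in>S. (A * F g) $$ (i, j))"
    by (rule sum.cong[OF refl], rule mat_mult_index_sum[OF A F ij, symmetric])
  finally show "(A * mat_sum m n S F) $$ (i, j) = mat_sum l n S (\<lambda>g. A * F g) $$ (i, j)"
    using ij by (simp add: mat_sum_def)
qed (use A in \<open>auto simp: mat_sum_def\<close>)

lemma mat_sum_mult:
  assumes A: "A \<in> carrier_mat n l" and F: "\<And>g. g \<in> S \<Longrightarrow> F g \<in> carrier_mat m n"
  shows "mat_sum m n S F * A = mat_sum m l S (\<lambda>g. F g * A)"
proof (rule eq_matI)
  fix i j assume "i < dim_row (mat_sum m l S (\<lambda>g. F g * A))"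
    "j < dim_col (mat_sum m l S (\<lambda>g. F g * A))"
  hence ij: "i < m" "j < l" by (auto simp: mat_sum_def)
  have "(mat_sum m n S F * A) $$ (i, j) = (\<Sum>k<n. \<Sum>g\<in>S. F g $$ (i, k) * A $$ (k, j))"
    using ij
    by (simp add: mat_mult_index_sum[OF mat_sum_carrier A] mat_sum_index sum_distrib_right
        del: index_mult_mat(1))
  also have "\<dots> = (\<Sum>g\<in>S. \<Sum>k<n. F g $$ (i, k) * A $$ (k, j))" by (rule sum.swap)
  also have "\<dots> = (\<Sum>g\<in>S. (F g * A) $$ (i, j))"
    by (rule sum.cong[OF refl], rule mat_mult_index_sum[OF F A ij, symmetric])
  finally show "(mat_sum m n S F * A) $$ (i, j) = mat_sum m l S (\<lambda>g. F g * A) $$ (i, j)"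
    using ij by (simp add: mat_sum_def)
qed (use A in \<open>auto simp: mat_sum_def\<close>)

lemma mat_sum_const:
  assumes "A \<in> carrier_mat m n"
  shows "mat_sum m n S (\<lambda>_. A) = of_nat (card S) \<cdot>\<^sub>m A"
  using assms by (auto simp: mat_sum_def intro!: eq_matI)

lemma mat_trace_mat_sum:
  assumes "\<And>g. g \<in> S \<Longrightarrow> F g \<in> carrier_mat n n"
  shows "mat_trace (mat_sum n n S F) = (\<Sum>g\<in>S. mat_trace (F g))"
proof -
  have "mat_trace (mat_sum n n S F) = (\<Sum>i<n. \<Sum>g\<in>S. F g $$ (i, i))"
    by (simp add: mat_trace_def mat_sum_def)
  also have "\<dots> = (\<Sum>g\<in>S. \<Sum>i<n. F g $$ (i, i))" by (rule sum.swap)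
  also have "\<dots> = (\<Sum>g\<in>S. mat_trace (F g))"
    by (intro sum.cong refl) (use assms in \<open>auto simp: mat_trace_def\<close>)
  finally show ?thesis .
qed

lemma left_inverse_dim_le:
  fixes M L :: "complex mat"
  assumes M: "M \<in> carrier_mat d k" and L: "L \<in> carrier_mat k d" and LM: "L * M = 1\<^sub>m k"
  shows "k \<le> d"
proof (rule ccontr)
  assume "\<not> k \<le> d"
  hence dk: "d < k" by simp
  \<comment> \<open>Padded by zeros to square matrices, the two would be inverse to each other, although one of
    them has a zero row.\<close>
  define M' where "M' = mat k k (\<lambda>(i, j). if i < d then M $$ (i, j) else 0)"
  define L' where "L' = mat k k (\<lambda>(i, j). if j < d then L $$ (i, j) else 0)"
  have M': "M' \<in> carrier_mat k k" and L': "L' \<in> carrier_mat k k" by (auto simp: M'_def L'_def)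
  have "L' * M' = 1\<^sub>m k"
  proof (rule eq_matI)
    fix i j assume "i < dim_row (1\<^sub>m k)" "j < dim_col (1\<^sub>m k)"
    hence ij: "i < k" "j < k" by auto
    have "(L' * M') $$ (i, j) = (\<Sum>t<k. L' $$ (i, t) * M' $$ (t, j))"
      by (rule mat_mult_index_sum[OF L' M' ij])
    also have "\<dots> = (\<Sum>t<d. L $$ (i, t) * M $$ (t, j))"
      using dk ij by (intro sum.mono_neutral_cong_right) (auto simp: L'_def M'_def)
    also have "\<dots> = (L * M) $$ (i, j)" by (rule mat_mult_index_sum[OF L M ij, symmetric])
    finally show "(L' * M') $$ (i, j) = 1\<^sub>m k $$ (i, j)" by (simp add: LM)
  qed (auto simp: L'_def M'_def)
  hence "M' * L' = 1\<^sub>m k" using mat_mult_left_right_inverse[OF L' M'] by simp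
  hence "(M' * L') $$ (d, d) = 1" using dk by simp
  moreover have "(M' * L') $$ (d, d) = 0"
    by (subst mat_mult_index_sum[OF M' L']) (use dk in \<open>auto simp: M'_def\<close>)
  ultimately show False by simp
qed

text \<open>A subspace is the column space of a matrix with a left inverse. One takes such a matrix with
  as many columns as possible; a vector outside its column space would supply one more.\<close>

lemma subspace_eq_range:
  fixes W :: "complex vec set"
  assumes sub: "W \<subseteq> carrier_vec d" and zero: "0\<^sub>v d \<in> W"
    and add: "\<And>u v. u \<in> W \<Longrightarrow> v \<in> W \<Longrightarrow> u + v \<in> W"
    and smult: "\<And>c v. v \<in> W \<Longrightarrow> c \<cdot>\<^sub>v v \<in> W"
  obtains k M L where "M \<in> carrier_mat d k" "L \<in> carrier_mat k d" "L * M = 1\<^sub>m k"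
    "W = {M *\<^sub>v v | v. v \<in> carrier_vec k}"
proof -
  define P where "P k \<longleftrightarrow> (\<exists>M L. M \<in> carrier_mat d k \<and> L \<in> carrier_mat k d \<and> L * M = 1\<^sub>m k \<and>
    (\<forall>v \<in> carrier_vec k. M *\<^sub>v v \<in> W))" for k
  have "P 0"
  proof -
    have "0\<^sub>m d 0 *\<^sub>v v \<in> W" if "v \<in> carrier_vec 0" for v :: "complex vec"
    proof -
      have "0\<^sub>m d 0 *\<^sub>v v = 0\<^sub>v d" using that by (intro eq_vecI) (auto simp: scalar_prod_def)
      thus ?thesis using zero by simp
    qed
    moreover have "0\<^sub>m 0 d * 0\<^sub>m d 0 = (1\<^sub>m 0 :: complex mat)" by (intro eq_matI) auto
    ultimately show ?thesis unfolding P_def by (intro exI[of _ "0\<^sub>m d 0"] exI[of _ "0\<^sub>m 0 d"]) auto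
  qed
  have bound: "k \<le> d" if "P k" for k
    using that left_inverse_dim_le unfolding P_def by blast
  define k where "k = (GREATEST k. P k)"
  have "P k" unfolding k_def using \<open>P 0\<close> bound by (rule GreatestI_nat)
  have notP: "\<not> P (Suc k)"
  proof
    assume "P (Suc k)"
    hence "Suc k \<le> k" unfolding k_def using bound by (rule Greatest_le_nat)
    thus False by simp
  qed
  obtain M L where M: "M \<in> carrier_mat d k" and L: "L \<in> carrier_mat k d" and LM: "L * M = 1\<^sub>m k"
    and MW: "\<And>v. v \<in> carrier_vec k \<Longrightarrow> M *\<^sub>v v \<in> W"
    using \<open>P k\<close> unfolding P_def by blast
  have "W \<subseteq> {M *\<^sub>v v | v. v \<in> carrier_vec k}"
  proof
    fix w0 assume w0: "w0 \<in> W"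
    hence w0c: "w0 \<in> carrier_vec d" using sub by auto
    show "w0 \<in> {M *\<^sub>v v | v. v \<in> carrier_vec k}"
    proof (rule ccontr)
      assume notin: "w0 \<notin> {M *\<^sub>v v | v. v \<in> carrier_vec k}"
      define Q where "Q = 1\<^sub>m d - M * L"
      have MLc: "M * L \<in> carrier_mat d d" using M L by simp
      have Q: "Q \<in> carrier_mat d d" using MLc unfolding Q_def by (intro minus_carrier_mat)
      define w where "w = w0 + (- 1) \<cdot>\<^sub>v (M *\<^sub>v (L *\<^sub>v w0))"
      have wW: "w \<in> W" unfolding w_def
        using w0 L w0c by (intro add smult MW) auto
      have wc: "w \<in> carrier_vec d" using wW sub by auto
      have Lw: "L *\<^sub>v w = 0\<^sub>v k"
      proof -
        have "L *\<^sub>v w = L *\<^sub>v w0 + (-1) \<cdot>\<^sub>v (L *\<^sub>v (M *\<^sub>v (L *\<^sub>v w0)))"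
          unfolding w_def using L M w0c
          by (simp add: mult_add_distrib_mat_vec[of _ k d] mult_mat_vec[of _ k d])
        also have "L *\<^sub>v (M *\<^sub>v (L *\<^sub>v w0)) = (L * M) *\<^sub>v (L *\<^sub>v w0)"
          using L M w0c by (intro assoc_mult_mat_vec[symmetric]) auto
        finally show ?thesis using L w0c by (auto simp: LM intro!: eq_vecI)
      qed
      have "w \<noteq> 0\<^sub>v d"
      proof
        assume w: "w = 0\<^sub>v d"
        have c: "M *\<^sub>v (L *\<^sub>v w0) \<in> carrier_vec d" using M L w0c by auto
        have "w0 = M *\<^sub>v (L *\<^sub>v w0)"
        proof (rule eq_vecI)
          fix i assume i: "i < dim_vec (M *\<^sub>v (L *\<^sub>v w0))"
          hence "w $ i = 0" using w c M by simp
          thus "w0 $ i = (M *\<^sub>v (L *\<^sub>v w0)) $ i" unfolding w_def using c i w0c by simp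
        qed (use M w0c in simp)
        thus False using notin L w0c by auto
      qed
      then obtain p where p: "p < d" "w $ p \<noteq> 0" using wc by (auto simp: vec_eq_iff)
      have QM: "Q * M = 0\<^sub>m d k"
      proof -
        have "Q * M = M - M * L * M" unfolding Q_def
          using M MLc by (simp add: minus_mult_distrib_mat[of _ d d])
        also have "M * L * M = M" using M L by (simp add: assoc_mult_mat[of _ d k] LM)
        finally show ?thesis using M by simp
      qed
      have Qw: "Q *\<^sub>v w = w"
      proof -
        have "Q *\<^sub>v w = w - (M * L) *\<^sub>v w" unfolding Q_def
          using wc MLc by (simp add: minus_mult_distrib_mat_vec[of _ d d])
        also have "(M * L) *\<^sub>v w = 0\<^sub>v d"
          using M L wc by (auto simp: assoc_mult_mat_vec[of _ d k] Lw intro!: eq_vecI)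
        finally show ?thesis using wc by simp
      qed
      define M1 where "M1 = mat d (Suc k) (\<lambda>(i, j). if j < k then M $$ (i, j) else w $ i)"
      define L1 where
        "L1 = mat (Suc k) d (\<lambda>(i, j). if i < k then L $$ (i, j) else Q $$ (p, j) / w $ p)"
      have M1: "M1 \<in> carrier_mat d (Suc k)" and L1: "L1 \<in> carrier_mat (Suc k) d"
        by (auto simp: M1_def L1_def)
      have "L1 * M1 = 1\<^sub>m (Suc k)"
      proof (rule eq_matI)
        fix i j assume "i < dim_row (1\<^sub>m (Suc k))" "j < dim_col (1\<^sub>m (Suc k))"
        hence ij: "i < Suc k" "j < Suc k" by auto
        have eq: "(L1 * M1) $$ (i, j) = (\<Sum>t<d. L1 $$ (i, t) * M1 $$ (t, j))"
          by (rule mat_mult_index_sum[OF L1 M1 ij])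
        consider "i < k" "j < k" | "i < k" "j = k" | "i = k" "j < k" | "i = k" "j = k"
          using ij by linarith
        thus "(L1 * M1) $$ (i, j) = 1\<^sub>m (Suc k) $$ (i, j)"
        proof cases
          case 1
          hence "(L1 * M1) $$ (i, j) = (\<Sum>t<d. L $$ (i, t) * M $$ (t, j))"
            unfolding eq by (simp add: L1_def M1_def)
          also have "\<dots> = (L * M) $$ (i, j)" using 1 by (simp only: mat_mult_index_sum[OF L M])
          finally show ?thesis using 1 by (simp add: LM)
        next
          case 2
          hence "(L1 * M1) $$ (i, j) = (\<Sum>t<d. L $$ (i, t) * w $ t)"
            unfolding eq by (simp add: L1_def M1_def)
          also have "\<dots> = (L *\<^sub>v w) $ i" using 2 by (simp only: mat_mult_vec_index_sum[OF L wc])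
          finally show ?thesis using 2 by (simp add: Lw)
        next
          case 3
          hence "(L1 * M1) $$ (i, j) = (\<Sum>t<d. Q $$ (p, t) * M $$ (t, j)) / w $ p"
            unfolding eq by (simp add: L1_def M1_def sum_divide_distrib)
          also have "(\<Sum>t<d. Q $$ (p, t) * M $$ (t, j)) = (Q * M) $$ (p, j)"
            using 3 p by (simp only: mat_mult_index_sum[OF Q M])
          finally show ?thesis using 3 p by (simp add: QM)
        next
          case 4
          hence "(L1 * M1) $$ (i, j) = (\<Sum>t<d. Q $$ (p, t) * w $ t) / w $ p"
            unfolding eq by (simp add: L1_def M1_def sum_divide_distrib)
          also have "(\<Sum>t<d. Q $$ (p, t) * w $ t) = (Q *\<^sub>v w) $ p"
            using p by (simp only: mat_mult_vec_index_sum[OF Q wc])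
          finally show ?thesis using 4 p by (simp add: Qw)
        qed
      qed (auto simp: L1_def M1_def)
      moreover have "M1 *\<^sub>v v \<in> W" if v: "v \<in> carrier_vec (Suc k)" for v
      proof -
        have "M1 *\<^sub>v v = M *\<^sub>v vec k (\<lambda>i. v $ i) + (v $ k) \<cdot>\<^sub>v w"
        proof (rule eq_vecI)
          fix i assume "i < dim_vec (M *\<^sub>v vec k (\<lambda>i. v $ i) + (v $ k) \<cdot>\<^sub>v w)"
          hence i: "i < d" using wc by simp
          have "(M1 *\<^sub>v v) $ i = (\<Sum>t<Suc k. M1 $$ (i, t) * v $ t)"
            by (rule mat_mult_vec_index_sum[OF M1 v i])
          also have "\<dots> = (\<Sum>t<k. M $$ (i, t) * v $ t) + w $ i * v $ k"
            using i by (simp add: M1_def)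
          also have "(\<Sum>t<k. M $$ (i, t) * v $ t) = (M *\<^sub>v vec k (\<lambda>i. v $ i)) $ i"
            using i by (subst mat_mult_vec_index_sum[OF M]) auto
          finally show "(M1 *\<^sub>v v) $ i = (M *\<^sub>v vec k (\<lambda>i. v $ i) + (v $ k) \<cdot>\<^sub>v w) $ i"
            using i wc M by (simp add: mult.commute)
        qed (use M1 M wc in auto)
        thus ?thesis using wW by (auto intro!: add smult MW)
      qed
      ultimately have "P (Suc k)" unfolding P_def using M1 L1 by blast
      thus False using notP by simp
    qed
  qed
  hence "W = {M *\<^sub>v v | v. v \<in> carrier_vec k}" using MW by auto
  thus ?thesis using that M L LM by blast
qed

lemma mat_eqI_mult_vec:
  fixes A B :: "complex mat"
  assumes A: "A \<in> carrier_mat m n" and B: "B \<in> carrier_mat m n"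
    and eq: "\<And>v. v \<in> carrier_vec n \<Longrightarrow> A *\<^sub>v v = B *\<^sub>v v"
  shows "A = B"
proof (rule eq_matI)
  fix i j assume "i < dim_row B" "j < dim_col B"
  hence ij: "i < m" "j < n" using B by auto
  have col: "(C *\<^sub>v unit_vec n j) $ i = C $$ (i, j)" if "C \<in> carrier_mat m n" for C :: "complex mat"
  proof -
    have "(C *\<^sub>v unit_vec n j) $ i = (\<Sum>k<n. C $$ (i, k) * unit_vec n j $ k)"
      using that ij by (intro mat_mult_vec_index_sum) auto
    also have "\<dots> = (\<Sum>k<n. if k = j then C $$ (i, j) else 0)"
      using ij by (intro sum.cong) auto
    finally show ?thesis using ij by simp
  qed
  show "A $$ (i, j) = B $$ (i, j)"
    using col[OF A] col[OF B] eq[of "unit_vec n j"] by simp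
qed (use A B in auto)

section \<open>Representations, intertwiners and Schur's lemma\<close>

lemma representationI:
  assumes "group G"
    and c: "\<And>g. g \<in> carrier G \<Longrightarrow> \<rho> g \<in> carrier_mat d d"
    and m: "\<And>g h. g \<in> carrier G \<Longrightarrow> h \<in> carrier G \<Longrightarrow> \<rho> (g \<otimes>\<^bsub>G\<^esub> h) = \<rho> g * \<rho> h"
    and o: "\<rho> \<one>\<^bsub>G\<^esub> = 1\<^sub>m d"
  shows "representation G \<rho>" "rep_dim G \<rho> = d"
proof -
  interpret group G by fact
  show d: "rep_dim G \<rho> = d" using o by (simp add: rep_dim_def)
  have "\<rho> g \<in> carrier (GL d)" if g: "g \<in> carrier G" for g
  proof -
    have "\<rho> (inv\<^bsub>G\<^esub> g) * \<rho> g = 1\<^sub>m d" "\<rho> g * \<rho> (inv\<^bsub>G\<^esub> g) = 1\<^sub>m d"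
      using m[of "inv\<^bsub>G\<^esub> g" g] m[of g "inv\<^bsub>G\<^esub> g"] g o by simp_all
    thus ?thesis using c[OF g] c[of "inv\<^bsub>G\<^esub> g"] g
      by (auto simp: units_of_def Units_def ring_mat_simps)
  qed
  thus "representation G \<rho>" unfolding representation_def d
    using m by (auto simp: hom_def units_of_def ring_mat_simps)
qed

lemma
  assumes "group G" "representation G \<rho>"
  shows rep_carrier: "g \<in> carrier G \<Longrightarrow> \<rho> g \<in> carrier_mat (rep_dim G \<rho>) (rep_dim G \<rho>)"
    and rep_mult: "g \<in> carrier G \<Longrightarrow> h \<in> carrier G \<Longrightarrow> \<rho> (g \<otimes>\<^bsub>G\<^esub> h) = \<rho> g * \<rho> h"
    and rep_one: "\<rho> \<one>\<^bsub>G\<^esub> = 1\<^sub>m (rep_dim G \<rho>)"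
    and rep_inv: "g \<in> carrier G \<Longrightarrow> \<rho> g * \<rho> (inv\<^bsub>G\<^esub> g) = 1\<^sub>m (rep_dim G \<rho>)"
    and rep_inv': "g \<in> carrier G \<Longrightarrow> \<rho> (inv\<^bsub>G\<^esub> g) * \<rho> g = 1\<^sub>m (rep_dim G \<rho>)"
proof -
  interpret group G by fact
  let ?d = "rep_dim G \<rho>"
  have hom: "\<rho> \<in> hom G (GL ?d)" using assms(2) by (simp add: representation_def)
  show c: "\<rho> g \<in> carrier_mat ?d ?d" if "g \<in> carrier G" for g
    using hom that by (auto simp: hom_def units_of_def Units_def ring_mat_simps Pi_iff)
  show m: "\<rho> (g \<otimes>\<^bsub>G\<^esub> h) = \<rho> g * \<rho> h" if "g \<in> carrier G" "h \<in> carrier G" for g h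
    using hom that by (auto simp: hom_def units_of_def ring_mat_simps)
  interpret R: ring "ring_mat TYPE(complex) ?d ()" by (rule ring_mat)
  have "group (GL ?d)" by (rule R.units_group)
  hence "\<rho> \<one>\<^bsub>G\<^esub> = \<one>\<^bsub>GL ?d\<^esub>" using hom_one[OF hom] by (simp add: group_axioms)
  thus o: "\<rho> \<one>\<^bsub>G\<^esub> = 1\<^sub>m ?d" by (simp add: units_of_def ring_mat_simps)
  show "\<rho> g * \<rho> (inv\<^bsub>G\<^esub> g) = 1\<^sub>m ?d" "\<rho> (inv\<^bsub>G\<^esub> g) * \<rho> g = 1\<^sub>m ?d" if "g \<in> carrier G" for g
    using m[of "inv\<^bsub>G\<^esub> g" g] m[of g "inv\<^bsub>G\<^esub> g"] that o by simp_all
qed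

lemma rep_isoI:
  assumes G: "group G" and \<rho>: "representation G \<rho>" and \<sigma>: "representation G \<sigma>"
    and P: "P \<in> carrier_mat (rep_dim G \<sigma>) (rep_dim G \<rho>)"
    and Q: "Q \<in> carrier_mat (rep_dim G \<rho>) (rep_dim G \<sigma>)"
    and PQ: "P * Q = 1\<^sub>m (rep_dim G \<sigma>)" and QP: "Q * P = 1\<^sub>m (rep_dim G \<rho>)"
    and int: "\<And>g. g \<in> carrier G \<Longrightarrow> P * \<rho> g = \<sigma> g * P"
  shows "rep_iso G \<rho> \<sigma>"
proof -
  have "complex_of_nat (rep_dim G \<sigma>) = of_nat (rep_dim G \<rho>)"
    using mat_trace_comm[OF P Q] by (simp add: PQ QP mat_trace_one)
  hence d: "rep_dim G \<rho> = rep_dim G \<sigma>" by simp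
  have "inverts_mat P Q" "inverts_mat Q P" "square_mat P"
    using P Q PQ QP d by (auto simp: inverts_mat_def)
  hence "invertible_mat P" unfolding invertible_mat_def by blast
  thus ?thesis unfolding rep_iso_def using d P int by auto
qed

lemma rep_isoE:
  assumes "rep_iso G \<rho> \<sigma>"
  obtains P Q where "P \<in> carrier_mat (rep_dim G \<sigma>) (rep_dim G \<rho>)"
    "Q \<in> carrier_mat (rep_dim G \<rho>) (rep_dim G \<sigma>)"
    "P * Q = 1\<^sub>m (rep_dim G \<sigma>)" "Q * P = 1\<^sub>m (rep_dim G \<rho>)"
    "\<And>g. g \<in> carrier G \<Longrightarrow> P * \<rho> g = \<sigma> g * P"
proof -
  let ?d = "rep_dim G \<rho>"
  obtain P where d: "?d = rep_dim G \<sigma>" and P: "P \<in> carrier_mat ?d ?d" and inv: "invertible_mat P"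
    and int: "\<And>g. g \<in> carrier G \<Longrightarrow> P * \<rho> g = \<sigma> g * P"
    using assms unfolding rep_iso_def by blast
  obtain Q where PQ: "P * Q = 1\<^sub>m (dim_row P)" and QP: "Q * P = 1\<^sub>m (dim_row Q)"
    using inv unfolding invertible_mat_def inverts_mat_def by blast
  have "dim_col (P * Q) = ?d" using PQ P by simp
  hence 1: "dim_col Q = ?d" by simp
  have "dim_col (Q * P) = dim_row Q" using QP by simp
  hence "dim_row Q = ?d" using P by simp
  thus ?thesis using that[of P Q] 1 P PQ QP int d by auto
qed

lemma rep_iso_refl: "group G \<Longrightarrow> representation G \<rho> \<Longrightarrow> rep_iso G \<rho> \<rho>"
  by (rule rep_isoI[of G \<rho> \<rho> "1\<^sub>m (rep_dim G \<rho>)" "1\<^sub>m (rep_dim G \<rho>)"])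
    (auto dest: rep_carrier)

lemma rep_iso_sym:
  assumes G: "group G" and \<rho>: "representation G \<rho>" and \<sigma>: "representation G \<sigma>"
    and "rep_iso G \<rho> \<sigma>"
  shows "rep_iso G \<sigma> \<rho>"
proof -
  obtain P Q where P: "P \<in> carrier_mat (rep_dim G \<sigma>) (rep_dim G \<rho>)"
    and Q: "Q \<in> carrier_mat (rep_dim G \<rho>) (rep_dim G \<sigma>)"
    and PQ: "P * Q = 1\<^sub>m (rep_dim G \<sigma>)" and QP: "Q * P = 1\<^sub>m (rep_dim G \<rho>)"
    and int: "\<And>g. g \<in> carrier G \<Longrightarrow> P * \<rho> g = \<sigma> g * P"
    using rep_isoE[OF assms(4)] by blast
  show ?thesis
  proof (rule rep_isoI[OF G \<sigma> \<rho> Q P QP PQ])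
    fix g assume g: "g \<in> carrier G"
    note c = rep_carrier[OF G \<rho> g] rep_carrier[OF G \<sigma> g]
    have "Q * \<sigma> g = Q * (\<sigma> g * (P * Q))" using c by (simp add: PQ)
    also have "\<dots> = Q * ((\<sigma> g * P) * Q)" using c P Q by (simp add: assoc_mult_mat)
    also have "\<dots> = Q * ((P * \<rho> g) * Q)" by (simp add: int[OF g])
    also have "\<dots> = Q * (P * (\<rho> g * Q))"
      by (subst assoc_mult_mat[OF P c(1) Q]) simp
    also have "\<dots> = (Q * P) * (\<rho> g * Q)"
      using c P Q by (intro assoc_mult_mat[symmetric]) auto
    also have "\<dots> = \<rho> g * Q" using c Q by (simp add: QP)
    finally show "Q * \<sigma> g = \<rho> g * Q" .
  qed
qed

text \<open>Reassociation as a single rule, since associativity of products of matrices of different sizes is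
  conditional on the sizes.\<close>

lemma mat_mult_regroup:
  fixes A :: "complex mat"
  assumes A: "A \<in> carrier_mat k l" and B: "B \<in> carrier_mat l m" and C: "C \<in> carrier_mat m n"
    and D: "D \<in> carrier_mat n p"
  shows "A * B * (C * D) = A * ((B * C) * D)"
  using assoc_mult_mat[OF A B, of "C * D" p] assoc_mult_mat[OF B C D] C D by auto

lemma rep_iso_trans:
  assumes G: "group G" and \<rho>: "representation G \<rho>" and \<sigma>: "representation G \<sigma>"
    and \<tau>: "representation G \<tau>"
    and "rep_iso G \<rho> \<sigma>" "rep_iso G \<sigma> \<tau>"
  shows "rep_iso G \<rho> \<tau>"
proof -
  obtain P Q where P: "P \<in> carrier_mat (rep_dim G \<sigma>) (rep_dim G \<rho>)"
    and Q: "Q \<in> carrier_mat (rep_dim G \<rho>) (rep_dim G \<sigma>)"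
    and PQ: "P * Q = 1\<^sub>m (rep_dim G \<sigma>)" and QP: "Q * P = 1\<^sub>m (rep_dim G \<rho>)"
    and int: "\<And>g. g \<in> carrier G \<Longrightarrow> P * \<rho> g = \<sigma> g * P"
    using rep_isoE[OF assms(5)] by blast
  obtain P' Q' where P': "P' \<in> carrier_mat (rep_dim G \<tau>) (rep_dim G \<sigma>)"
    and Q': "Q' \<in> carrier_mat (rep_dim G \<sigma>) (rep_dim G \<tau>)"
    and PQ': "P' * Q' = 1\<^sub>m (rep_dim G \<tau>)" and QP': "Q' * P' = 1\<^sub>m (rep_dim G \<sigma>)"
    and int': "\<And>g. g \<in> carrier G \<Longrightarrow> P' * \<sigma> g = \<tau> g * P'"
    using rep_isoE[OF assms(6)] by blast
  show ?thesis
  proof (rule rep_isoI[OF G \<rho> \<tau>, of "P' * P" "Q * Q'"])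
    have "P' * P * (Q * Q') = P' * ((P * Q) * Q')"
      by (rule mat_mult_regroup[OF P' P Q Q'])
    thus "P' * P * (Q * Q') = 1\<^sub>m (rep_dim G \<tau>)" using PQ PQ' Q' by simp
    have "Q * Q' * (P' * P) = Q * ((Q' * P') * P)"
      by (rule mat_mult_regroup[OF Q Q' P' P])
    thus "Q * Q' * (P' * P) = 1\<^sub>m (rep_dim G \<rho>)" using QP QP' P by simp
    fix g assume g: "g \<in> carrier G"
    note c = rep_carrier[OF G \<rho> g] rep_carrier[OF G \<sigma> g] rep_carrier[OF G \<tau> g]
    have "P' * P * \<rho> g = P' * (P * \<rho> g)" by (rule assoc_mult_mat[OF P' P c(1)])
    also have "\<dots> = P' * (\<sigma> g * P)" by (simp add: int[OF g])
    also have "\<dots> = (P' * \<sigma> g) * P" by (rule assoc_mult_mat[OF P' c(2) P, symmetric])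
    also have "\<dots> = (\<tau> g * P') * P" by (simp add: int'[OF g])
    also have "\<dots> = \<tau> g * (P' * P)" by (rule assoc_mult_mat[OF c(3) P' P])
    finally show "P' * P * \<rho> g = \<tau> g * (P' * P)" .
  qed (use P Q P' Q' in auto)
qed

lemma rep_iso_trace:
  assumes G: "group G" and \<rho>: "representation G \<rho>" and \<sigma>: "representation G \<sigma>"
    and "rep_iso G \<rho> \<sigma>" and g: "g \<in> carrier G"
  shows "mat_trace (\<rho> g) = mat_trace (\<sigma> g)"
proof -
  obtain P Q where P: "P \<in> carrier_mat (rep_dim G \<sigma>) (rep_dim G \<rho>)"
    and Q: "Q \<in> carrier_mat (rep_dim G \<rho>) (rep_dim G \<sigma>)"
    and PQ: "P * Q = 1\<^sub>m (rep_dim G \<sigma>)" and QP: "Q * P = 1\<^sub>m (rep_dim G \<rho>)"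
    and int: "\<And>g. g \<in> carrier G \<Longrightarrow> P * \<rho> g = \<sigma> g * P"
    using rep_isoE[OF assms(4)] by blast
  note c = rep_carrier[OF G \<rho> g] rep_carrier[OF G \<sigma> g]
  have "\<rho> g = (Q * P) * \<rho> g" using c by (simp add: QP)
  also have "\<dots> = Q * (P * \<rho> g)" by (rule assoc_mult_mat[OF Q P c(1)])
  finally have "mat_trace (\<rho> g) = mat_trace (Q * (P * \<rho> g))" by simp
  also have "\<dots> = mat_trace ((P * \<rho> g) * Q)"
    using Q P c by (intro mat_trace_comm) auto
  also have "(P * \<rho> g) * Q = \<sigma> g * (P * Q)"
    unfolding int[OF g] by (rule assoc_mult_mat[OF c(2) P Q])
  also have "\<dots> = \<sigma> g" using c by (simp add: PQ)
  finally show ?thesis .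
qed

lemma invariant_subspace_iff:
  "invariant_subspace G \<rho> W \<longleftrightarrow>
     W \<subseteq> carrier_vec (rep_dim G \<rho>) \<and> 0\<^sub>v (rep_dim G \<rho>) \<in> W \<and>
     (\<forall>u\<in>W. \<forall>v\<in>W. u + v \<in> W) \<and> (\<forall>c. \<forall>v\<in>W. c \<cdot>\<^sub>v v \<in> W) \<and>
     (\<forall>g \<in> carrier G. \<forall>w \<in> W. \<rho> g *\<^sub>v w \<in> W)"
proof -
  have "vectorspace class_ring (module_vec TYPE(complex) n)" for n by (rule vec_vs)
  hence "Module.module class_ring (module_vec TYPE(complex) n)" for n
    by (simp add: vectorspace_def)
  thus ?thesis
    unfolding invariant_subspace_def VectorSpace.subspace_def submodule_def
    using vec_vs by (auto simp: module_vec_simps)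
qed

lemma invariant_kernel:
  assumes G: "group G" and \<sigma>: "representation G \<sigma>"
    and \<tau>: "\<And>g. g \<in> carrier G \<Longrightarrow> \<tau> g \<in> carrier_mat n n"
    and T: "T \<in> carrier_mat n (rep_dim G \<sigma>)"
    and int: "\<And>g. g \<in> carrier G \<Longrightarrow> T * \<sigma> g = \<tau> g * T"
  shows "invariant_subspace G \<sigma> {v \<in> carrier_vec (rep_dim G \<sigma>). T *\<^sub>v v = 0\<^sub>v n}"
proof -
  let ?m = "rep_dim G \<sigma>"
  have "T *\<^sub>v (\<sigma> g *\<^sub>v w) = 0\<^sub>v n" if g: "g \<in> carrier G" and w: "w \<in> carrier_vec ?m"
    and Tw: "T *\<^sub>v w = 0\<^sub>v n" for g w
  proof -
    have "T *\<^sub>v (\<sigma> g *\<^sub>v w) = (T * \<sigma> g) *\<^sub>v w"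
      by (rule assoc_mult_mat_vec[OF T rep_carrier[OF G \<sigma> g] w, symmetric])
    also have "\<dots> = \<tau> g *\<^sub>v (T *\<^sub>v w)"
      unfolding int[OF g] by (rule assoc_mult_mat_vec[OF \<tau>[OF g] T w])
    also have "\<dots> = 0\<^sub>v n" unfolding Tw using \<tau>[OF g] by (auto intro!: eq_vecI)
    finally show ?thesis .
  qed
  moreover have "\<sigma> g *\<^sub>v w \<in> carrier_vec ?m" if "g \<in> carrier G" "w \<in> carrier_vec ?m" for g w
    using rep_carrier[OF G \<sigma> that(1)] that(2) by auto
  moreover have "T *\<^sub>v 0\<^sub>v ?m = 0\<^sub>v n" using T by (auto intro!: eq_vecI)
  ultimately show ?thesis unfolding invariant_subspace_iff
    using T by (auto simp: mult_add_distrib_mat_vec[of _ n ?m] mult_mat_vec[of _ n ?m] intro!: eq_vecI)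
qed

lemma invariant_range:
  assumes G: "group G" and \<tau>: "representation G \<tau>"
    and \<sigma>: "\<And>g. g \<in> carrier G \<Longrightarrow> \<sigma> g \<in> carrier_mat m m"
    and T: "T \<in> carrier_mat (rep_dim G \<tau>) m"
    and int: "\<And>g. g \<in> carrier G \<Longrightarrow> T * \<sigma> g = \<tau> g * T"
  shows "invariant_subspace G \<tau> {T *\<^sub>v v | v. v \<in> carrier_vec m}"
  unfolding invariant_subspace_iff
proof (intro conjI ballI allI)
  let ?n = "rep_dim G \<tau>"
  show "{T *\<^sub>v v | v. v \<in> carrier_vec m} \<subseteq> carrier_vec ?n" using T by auto
  have "0\<^sub>v ?n = T *\<^sub>v 0\<^sub>v m" using T by (auto intro!: eq_vecI)
  thus "0\<^sub>v ?n \<in> {T *\<^sub>v v | v. v \<in> carrier_vec m}" by auto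
  fix u v assume "u \<in> {T *\<^sub>v v | v. v \<in> carrier_vec m}" "v \<in> {T *\<^sub>v v | v. v \<in> carrier_vec m}"
  then obtain a b where "a \<in> carrier_vec m" "b \<in> carrier_vec m" "u = T *\<^sub>v a" "v = T *\<^sub>v b" by auto
  thus "u + v \<in> {T *\<^sub>v v | v. v \<in> carrier_vec m}"
    using T by (auto simp: mult_add_distrib_mat_vec[symmetric, of _ ?n m] intro!: exI[of _ "a + b"])
next
  fix c v assume "v \<in> {T *\<^sub>v v | v. v \<in> carrier_vec m}"
  then obtain b where "b \<in> carrier_vec m" "v = T *\<^sub>v b" by auto
  thus "c \<cdot>\<^sub>v v \<in> {T *\<^sub>v v | v. v \<in> carrier_vec m}"
    using T by (auto simp: mult_mat_vec[symmetric, of _ "rep_dim G \<tau>" m] intro!: exI[of _ "c \<cdot>\<^sub>v b"])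
next
  fix g w assume g: "g \<in> carrier G" and "w \<in> {T *\<^sub>v v | v. v \<in> carrier_vec m}"
  then obtain b where b: "b \<in> carrier_vec m" "w = T *\<^sub>v b" by auto
  have "\<tau> g *\<^sub>v w = (\<tau> g * T) *\<^sub>v b"
    unfolding b(2) by (rule assoc_mult_mat_vec[OF rep_carrier[OF G \<tau> g] T b(1), symmetric])
  also have "\<dots> = T *\<^sub>v (\<sigma> g *\<^sub>v b)"
    unfolding int[OF g, symmetric] by (rule assoc_mult_mat_vec[OF T \<sigma>[OF g] b(1)])
  finally show "\<tau> g *\<^sub>v w \<in> {T *\<^sub>v v | v. v \<in> carrier_vec m}"
    using b(1) \<sigma>[OF g] by (auto intro!: exI[of _ "\<sigma> g *\<^sub>v b"])
qed

lemma irreducible_repD: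
  assumes "irreducible_rep G \<rho>"
  shows "representation G \<rho>" "rep_dim G \<rho> > 0"
    "invariant_subspace G \<rho> W \<Longrightarrow> W = {0\<^sub>v (rep_dim G \<rho>)} \<or> W = carrier_vec (rep_dim G \<rho>)"
  using assms unfolding irreducible_rep_def by auto

text \<open>Schur's lemma. The kernel and the image of an intertwiner are invariant, so irreducibility of both
  sides makes a nonzero intertwiner injective and surjective.\<close>

lemma schur_zero_or_iso:
  assumes G: "group G" and irr\<sigma>: "irreducible_rep G \<sigma>" and irr\<tau>: "irreducible_rep G \<tau>"
    and T: "T \<in> carrier_mat (rep_dim G \<tau>) (rep_dim G \<sigma>)"
    and int: "\<And>g. g \<in> carrier G \<Longrightarrow> T * \<sigma> g = \<tau> g * T"
  shows "T = 0\<^sub>m (rep_dim G \<tau>) (rep_dim G \<sigma>) \<or> rep_iso G \<sigma> \<tau>"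
proof -
  let ?m = "rep_dim G \<sigma>" and ?n = "rep_dim G \<tau>"
  note \<sigma> = irreducible_repD[OF irr\<sigma>] and \<tau> = irreducible_repD[OF irr\<tau>]
  let ?K = "{v \<in> carrier_vec ?m. T *\<^sub>v v = 0\<^sub>v ?n}" and ?R = "{T *\<^sub>v v | v. v \<in> carrier_vec ?m}"
  have K: "?K = {0\<^sub>v ?m} \<or> ?K = carrier_vec ?m"
    using \<sigma>(3)[OF invariant_kernel[OF G \<sigma>(1) rep_carrier[OF G \<tau>(1)] T int]] .
  have R: "?R = {0\<^sub>v ?n} \<or> ?R = carrier_vec ?n"
    using \<tau>(3)[OF invariant_range[OF G \<tau>(1) rep_carrier[OF G \<sigma>(1)] T int]] .
  have zero: "T = 0\<^sub>m ?n ?m" if "\<And>v. v \<in> carrier_vec ?m \<Longrightarrow> T *\<^sub>v v = 0\<^sub>v ?n"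
    by (rule mat_eqI_mult_vec[OF T]) (use that in auto)
  show ?thesis
  proof (cases "?K = carrier_vec ?m \<or> ?R = {0\<^sub>v ?n}")
    case True
    hence "T *\<^sub>v v = 0\<^sub>v ?n" if "v \<in> carrier_vec ?m" for v using that by blast
    thus ?thesis using zero by blast
  next
    case False
    hence K: "?K = {0\<^sub>v ?m}" and R: "?R = carrier_vec ?n" using K R by auto
    \<comment> \<open>The columns of a right inverse are preimages of the unit vectors.\<close>
    have "\<forall>j<?n. \<exists>v. v \<in> carrier_vec ?m \<and> T *\<^sub>v v = unit_vec ?n j"
    proof (intro allI impI)
      fix j assume "j < ?n"
      have "unit_vec ?n j \<in> ?R" unfolding R by simp
      thus "\<exists>v. v \<in> carrier_vec ?m \<and> T *\<^sub>v v = unit_vec ?n j" by auto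
    qed
    then obtain u where u: "\<And>j. j < ?n \<Longrightarrow> u j \<in> carrier_vec ?m"
      "\<And>j. j < ?n \<Longrightarrow> T *\<^sub>v u j = unit_vec ?n j" by metis
    define S where "S = mat ?m ?n (\<lambda>(i, j). u j $ i)"
    have S: "S \<in> carrier_mat ?m ?n" by (simp add: S_def)
    have TS: "T * S = 1\<^sub>m ?n"
    proof (rule eq_matI)
      fix i j assume "i < dim_row (1\<^sub>m ?n)" "j < dim_col (1\<^sub>m ?n)"
      hence ij: "i < ?n" "j < ?n" by auto
      have "(T * S) $$ (i, j) = (\<Sum>k<?m. T $$ (i, k) * u j $ k)"
        unfolding mat_mult_index_sum[OF T S ij]
        by (rule sum.cong[OF refl]) (use ij in \<open>simp add: S_def\<close>)
      also have "\<dots> = (T *\<^sub>v u j) $ i" by (rule mat_mult_vec_index_sum[OF T u(1) ij(1), symmetric]) fact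
      also have "\<dots> = 1\<^sub>m ?n $$ (i, j)" using ij by (simp add: u(2))
      finally show "(T * S) $$ (i, j) = 1\<^sub>m ?n $$ (i, j)" .
    qed (use T S in auto)
    have ST: "S * T = 1\<^sub>m ?m"
    proof (rule mat_eqI_mult_vec[of _ ?m ?m])
      fix v :: "complex vec" assume v: "v \<in> carrier_vec ?m"
      define w where "w = S *\<^sub>v (T *\<^sub>v v) - v"
      have STv: "S *\<^sub>v (T *\<^sub>v v) \<in> carrier_vec ?m" using S T v by auto
      have w: "w \<in> carrier_vec ?m" using STv v by (simp add: w_def)
      have "T *\<^sub>v w = T *\<^sub>v (S *\<^sub>v (T *\<^sub>v v)) - T *\<^sub>v v"
        unfolding w_def by (rule mult_minus_distrib_mat_vec[OF T STv v])
      also have "T *\<^sub>v (S *\<^sub>v (T *\<^sub>v v)) = (T * S) *\<^sub>v (T *\<^sub>v v)"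
        using T S v by (intro assoc_mult_mat_vec[symmetric]) auto
      also have "\<dots> = T *\<^sub>v v" using T v by (simp add: TS)
      also have "T *\<^sub>v v - T *\<^sub>v v = 0\<^sub>v ?n" using T v by (auto intro!: eq_vecI)
      finally have "w \<in> ?K" using w by simp
      hence w0: "w = 0\<^sub>v ?m" unfolding K by simp
      have "S *\<^sub>v (T *\<^sub>v v) = v"
      proof (rule eq_vecI)
        fix i assume i: "i < dim_vec v"
        hence "w $ i = 0" using w0 v by simp
        thus "(S *\<^sub>v (T *\<^sub>v v)) $ i = v $ i" unfolding w_def using i v STv by simp
      qed (use STv v S in auto)
      moreover have "S *\<^sub>v (T *\<^sub>v v) = (S * T) *\<^sub>v v"
        by (rule assoc_mult_mat_vec[OF S T v, symmetric])
      ultimately show "(S * T) *\<^sub>v v = 1\<^sub>m ?m *\<^sub>v v" using v by simp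
    qed (use S T in auto)
    have "rep_iso G \<sigma> \<tau>" by (rule rep_isoI[OF G \<sigma>(1) \<tau>(1) T S TS ST int])
    thus ?thesis by simp
  qed
qed

text \<open>Over the complex numbers an intertwiner \<open>T\<close> of an irreducible representation with itself has an
  eigenvalue \<open>c\<close>. The kernel of \<open>T - c\<close> is invariant and nonzero, hence everything.\<close>

lemma schur_scalar:
  assumes G: "group G" and irr: "irreducible_rep G \<sigma>"
    and T: "T \<in> carrier_mat (rep_dim G \<sigma>) (rep_dim G \<sigma>)"
    and int: "\<And>g. g \<in> carrier G \<Longrightarrow> T * \<sigma> g = \<sigma> g * T"
  obtains c where "T = c \<cdot>\<^sub>m 1\<^sub>m (rep_dim G \<sigma>)"
proof -
  let ?m = "rep_dim G \<sigma>"
  note \<sigma> = irreducible_repD[OF irr]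
  obtain c where "eigenvalue T c"
    using spectrum_non_empty[OF T \<sigma>(2)] by (auto simp: spectrum_def)
  then obtain v where v: "v \<in> carrier_vec ?m" "v \<noteq> 0\<^sub>v ?m" "T *\<^sub>v v = c \<cdot>\<^sub>v v"
    using T unfolding eigenvalue_def eigenvector_def by auto
  define N where "N = T - c \<cdot>\<^sub>m 1\<^sub>m ?m"
  have N: "N \<in> carrier_mat ?m ?m" unfolding N_def by (intro minus_carrier_mat) auto
  have "N * \<sigma> g = \<sigma> g * N" if g: "g \<in> carrier G" for g
  proof -
    note c = rep_carrier[OF G \<sigma>(1) g]
    have "N * \<sigma> g = T * \<sigma> g - (c \<cdot>\<^sub>m 1\<^sub>m ?m) * \<sigma> g" unfolding N_def
      using T c by (intro minus_mult_distrib_mat) auto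
    also have "(c \<cdot>\<^sub>m 1\<^sub>m ?m) * \<sigma> g = c \<cdot>\<^sub>m \<sigma> g" using c
      by (simp add: mult_smult_assoc_mat[of _ ?m ?m])
    also have "c \<cdot>\<^sub>m \<sigma> g = \<sigma> g * (c \<cdot>\<^sub>m 1\<^sub>m ?m)"
      using mult_smult_distrib[OF c one_carrier_mat, of c] c by simp
    also have "T * \<sigma> g - \<sigma> g * (c \<cdot>\<^sub>m 1\<^sub>m ?m) = \<sigma> g * N" unfolding N_def int[OF g]
      using T c by (intro mult_minus_distrib_mat[symmetric]) auto
    finally show ?thesis .
  qed
  hence "invariant_subspace G \<sigma> {v \<in> carrier_vec ?m. N *\<^sub>v v = 0\<^sub>v ?m}" (is "invariant_subspace G \<sigma> ?K")
    by (intro invariant_kernel[OF G \<sigma>(1) rep_carrier[OF G \<sigma>(1)] N])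
  hence K: "?K = {0\<^sub>v ?m} \<or> ?K = carrier_vec ?m" by (rule \<sigma>(3))
  have "N *\<^sub>v v = T *\<^sub>v v - (c \<cdot>\<^sub>m 1\<^sub>m ?m) *\<^sub>v v" unfolding N_def
    using T v(1) by (intro minus_mult_distrib_mat_vec) auto
  also have "(c \<cdot>\<^sub>m 1\<^sub>m ?m) *\<^sub>v v = c \<cdot>\<^sub>v v" using v(1) by (auto intro!: eq_vecI)
  also have "T *\<^sub>v v - c \<cdot>\<^sub>v v = 0\<^sub>v ?m" unfolding v(3) using v(1) by (auto intro!: eq_vecI)
  finally have "v \<in> ?K" using v(1) by simp
  hence "?K = carrier_vec ?m" using K v(2) by auto
  hence "N *\<^sub>v u = 0\<^sub>v ?m" if "u \<in> carrier_vec ?m" for u using that by blast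
  hence "N = 0\<^sub>m ?m ?m" by (intro mat_eqI_mult_vec[OF N]) auto
  hence "T = c \<cdot>\<^sub>m 1\<^sub>m ?m"
  proof -
    have "T $$ (i, j) = (c \<cdot>\<^sub>m 1\<^sub>m ?m) $$ (i, j)" if "i < ?m" "j < ?m" for i j
    proof -
      have "N $$ (i, j) = 0" using \<open>N = 0\<^sub>m ?m ?m\<close> that by simp
      thus ?thesis unfolding N_def using T that by simp
    qed
    thus ?thesis using T by (intro eq_matI) auto
  qed
  thus ?thesis by (rule that)
qed

section \<open>Averaging, orthogonality of characters and complete reducibility\<close>

definition group_average ::
  "'a monoid \<Rightarrow> 'a rep \<Rightarrow> complex mat \<Rightarrow> 'a rep \<Rightarrow> complex mat" where
  "group_average G \<sigma> A \<tau> =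
     mat_sum (dim_row A) (dim_col A) (carrier G) (\<lambda>g. \<sigma> g * A * \<tau> (inv\<^bsub>G\<^esub> g))"

text \<open>Left translation by \<open>h\<close> permutes the summands, and moves \<open>\<sigma> h\<close> from one side to \<open>\<tau> h\<close> on the
  other.\<close>

lemma group_average_intertwines:
  assumes G: "group G" and \<sigma>: "representation G \<sigma>" and \<tau>: "representation G \<tau>"
    and A: "A \<in> carrier_mat (rep_dim G \<sigma>) (rep_dim G \<tau>)" and h: "h \<in> carrier G"
  shows "group_average G \<sigma> A \<tau> * \<tau> h = \<sigma> h * group_average G \<sigma> A \<tau>"
proof -
  interpret group G by fact
  let ?m = "rep_dim G \<sigma>" and ?n = "rep_dim G \<tau>"
  note c\<sigma> = rep_carrier[OF G \<sigma>] and c\<tau> = rep_carrier[OF G \<tau>]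
  let ?F = "\<lambda>g. \<sigma> g * A * \<tau> (inv\<^bsub>G\<^esub> g)"
  have F: "?F g \<in> carrier_mat ?m ?n" if "g \<in> carrier G" for g
    using c\<sigma>[OF that] c\<tau>[of "inv\<^bsub>G\<^esub> g"] A that by auto
  have avg: "group_average G \<sigma> A \<tau> = mat_sum ?m ?n (carrier G) ?F"
    using A by (simp add: group_average_def)
  have bij: "bij_betw (\<lambda>g. h \<otimes>\<^bsub>G\<^esub> g) (carrier G) (carrier G)"
    using h by (intro bij_betw_byWitness[where f' = "\<lambda>g. inv\<^bsub>G\<^esub> h \<otimes>\<^bsub>G\<^esub> g"])
      (auto simp: m_assoc[symmetric])
  have "mat_sum ?m ?n (carrier G) ?F * \<tau> h = mat_sum ?m ?n (carrier G) (\<lambda>g. ?F g * \<tau> h)"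
    by (rule mat_sum_mult[OF c\<tau>[OF h] F])
  also have "\<dots> = mat_sum ?m ?n (carrier G) (\<lambda>g. ?F (h \<otimes>\<^bsub>G\<^esub> g) * \<tau> h)"
    by (rule mat_sum_reindex[OF bij, symmetric])
  also have "\<dots> = mat_sum ?m ?n (carrier G) (\<lambda>g. \<sigma> h * ?F g)"
  proof (rule mat_sum_cong)
    fix g assume g: "g \<in> carrier G"
    have gi: "inv\<^bsub>G\<^esub> (h \<otimes>\<^bsub>G\<^esub> g) \<in> carrier G" using g h by simp
    have "inv\<^bsub>G\<^esub> (h \<otimes>\<^bsub>G\<^esub> g) \<otimes>\<^bsub>G\<^esub> h = inv\<^bsub>G\<^esub> g"
      using g h by (simp add: inv_mult_group m_assoc)
    hence 1: "\<tau> (inv\<^bsub>G\<^esub> (h \<otimes>\<^bsub>G\<^esub> g)) * \<tau> h = \<tau> (inv\<^bsub>G\<^esub> g)"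
      using rep_mult[OF G \<tau> gi h] by simp
    have gh: "h \<otimes>\<^bsub>G\<^esub> g \<in> carrier G" using g h by simp
    have "?F (h \<otimes>\<^bsub>G\<^esub> g) * \<tau> h = \<sigma> (h \<otimes>\<^bsub>G\<^esub> g) * A * (\<tau> (inv\<^bsub>G\<^esub> (h \<otimes>\<^bsub>G\<^esub> g)) * \<tau> h)"
      using c\<sigma>[OF gh] c\<tau>[OF gi] c\<tau>[OF h] A by (intro assoc_mult_mat) auto
    also have "\<dots> = \<sigma> h * \<sigma> g * A * \<tau> (inv\<^bsub>G\<^esub> g)"
      by (simp only: 1 rep_mult[OF G \<sigma> h g])
    also have "\<sigma> h * \<sigma> g * A = \<sigma> h * (\<sigma> g * A)"
      by (rule assoc_mult_mat[OF c\<sigma>[OF h] c\<sigma>[OF g] A])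
    also have "\<dots> * \<tau> (inv\<^bsub>G\<^esub> g) = \<sigma> h * ?F g"
      using c\<sigma>[OF g] c\<sigma>[OF h] c\<tau>[of "inv\<^bsub>G\<^esub> g"] A g by (intro assoc_mult_mat) auto
    finally show "?F (h \<otimes>\<^bsub>G\<^esub> g) * \<tau> h = \<sigma> h * ?F g" .
  qed
  also have "\<dots> = \<sigma> h * mat_sum ?m ?n (carrier G) ?F"
    by (rule mult_mat_sum[OF c\<sigma>[OF h] F, symmetric])
  finally show ?thesis by (simp add: avg)
qed

text \<open>The inner product of two characters without the factor \<open>1 / |G|\<close>. The inverse takes the place of
  complex conjugation.\<close>

definition char_pairing :: "'a monoid \<Rightarrow> 'a rep \<Rightarrow> 'a rep \<Rightarrow> complex" where
  "char_pairing G \<sigma> \<tau> = (\<Sum>g\<in>carrier G. mat_trace (\<sigma> g) * mat_trace (\<tau> (inv\<^bsub>G\<^esub> g)))"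

definition elementary_mat :: "nat \<Rightarrow> nat \<Rightarrow> nat \<Rightarrow> nat \<Rightarrow> complex mat" where
  "elementary_mat m n i j = mat m n (\<lambda>(a, b). if a = i \<and> b = j then 1 else 0)"

text \<open>The pairing of two characters collects diagonal entries of averages of elementary matrices;
  these averages are intertwiners, so Schur's lemma evaluates it.\<close>

lemma char_pairing_average:
  assumes G: "group G" and \<sigma>: "representation G \<sigma>" and \<tau>: "representation G \<tau>"
  shows "char_pairing G \<sigma> \<tau> = (\<Sum>i<rep_dim G \<sigma>. \<Sum>j<rep_dim G \<tau>.
    group_average G \<sigma> (elementary_mat (rep_dim G \<sigma>) (rep_dim G \<tau>) i j) \<tau> $$ (i, j))"
proof -
  interpret group G by fact
  let ?m = "rep_dim G \<sigma>" and ?n = "rep_dim G \<tau>"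
  note c\<sigma> = rep_carrier[OF G \<sigma>] and c\<tau> = rep_carrier[OF G \<tau>]
  have entry: "group_average G \<sigma> (elementary_mat ?m ?n i j) \<tau> $$ (i, j) =
      (\<Sum>g\<in>carrier G. \<sigma> g $$ (i, i) * \<tau> (inv\<^bsub>G\<^esub> g) $$ (j, j))" if ij: "i < ?m" "j < ?n" for i j
  proof -
    let ?E = "elementary_mat ?m ?n i j"
    have E: "?E \<in> carrier_mat ?m ?n" by (simp add: elementary_mat_def)
    have "group_average G \<sigma> ?E \<tau> $$ (i, j) =
        (\<Sum>g\<in>carrier G. (\<sigma> g * ?E * \<tau> (inv\<^bsub>G\<^esub> g)) $$ (i, j))"
      unfolding group_average_def using E ij by (simp add: mat_sum_index del: index_mult_mat(1))
    also have "\<dots> = (\<Sum>g\<in>carrier G. \<sigma> g $$ (i, i) * \<tau> (inv\<^bsub>G\<^esub> g) $$ (j, j))"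
    proof (rule sum.cong[OF refl])
      fix g assume g: "g \<in> carrier G"
      note c = c\<sigma>[OF g] c\<tau>[OF inv_closed[OF g]]
      have \<sigma>E: "\<sigma> g * ?E \<in> carrier_mat ?m ?n" using c E by auto
      have row: "(\<sigma> g * ?E) $$ (i, k) = (if k = j then \<sigma> g $$ (i, i) else 0)" if k: "k < ?n" for k
      proof -
        have "(\<sigma> g * ?E) $$ (i, k) = (\<Sum>t<?m. \<sigma> g $$ (i, t) * ?E $$ (t, k))"
          by (rule mat_mult_index_sum[OF c(1) E ij(1) k])
        also have "\<dots> = (\<Sum>t<?m. if t = i then (if k = j then \<sigma> g $$ (i, i) else 0) else 0)"
          by (rule sum.cong[OF refl]) (use k in \<open>auto simp: elementary_mat_def\<close>)
        finally show ?thesis using ij by simp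
      qed
      have "(\<sigma> g * ?E * \<tau> (inv\<^bsub>G\<^esub> g)) $$ (i, j) =
          (\<Sum>k<?n. (\<sigma> g * ?E) $$ (i, k) * \<tau> (inv\<^bsub>G\<^esub> g) $$ (k, j))"
        by (rule mat_mult_index_sum[OF \<sigma>E c(2) ij])
      also have "\<dots> = (\<Sum>k<?n. if k = j then \<sigma> g $$ (i, i) * \<tau> (inv\<^bsub>G\<^esub> g) $$ (j, j) else 0)"
        by (rule sum.cong[OF refl]) (simp add: row del: index_mult_mat(1))
      finally show "(\<sigma> g * ?E * \<tau> (inv\<^bsub>G\<^esub> g)) $$ (i, j) = \<sigma> g $$ (i, i) * \<tau> (inv\<^bsub>G\<^esub> g) $$ (j, j)"
        using ij by simp
    qed
    finally show ?thesis .
  qed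
  have "char_pairing G \<sigma> \<tau> =
      (\<Sum>g\<in>carrier G. \<Sum>i<?m. \<Sum>j<?n. \<sigma> g $$ (i, i) * \<tau> (inv\<^bsub>G\<^esub> g) $$ (j, j))"
    unfolding char_pairing_def
  proof (rule sum.cong[OF refl])
    fix g assume g: "g \<in> carrier G"
    show "mat_trace (\<sigma> g) * mat_trace (\<tau> (inv\<^bsub>G\<^esub> g)) =
        (\<Sum>i<?m. \<Sum>j<?n. \<sigma> g $$ (i, i) * \<tau> (inv\<^bsub>G\<^esub> g) $$ (j, j))"
      using c\<sigma>[OF g] c\<tau>[OF inv_closed[OF g]] by (simp add: mat_trace_def sum_product)
  qed
  also have "\<dots> = (\<Sum>i<?m. \<Sum>g\<in>carrier G. \<Sum>j<?n. \<sigma> g $$ (i, i) * \<tau> (inv\<^bsub>G\<^esub> g) $$ (j, j))"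
    by (rule sum.swap)
  also have "\<dots> = (\<Sum>i<?m. \<Sum>j<?n. \<Sum>g\<in>carrier G. \<sigma> g $$ (i, i) * \<tau> (inv\<^bsub>G\<^esub> g) $$ (j, j))"
    by (intro sum.cong refl sum.swap)
  also have "\<dots> = (\<Sum>i<?m. \<Sum>j<?n. group_average G \<sigma> (elementary_mat ?m ?n i j) \<tau> $$ (i, j))"
    by (intro sum.cong refl) (simp add: entry)
  finally show ?thesis .
qed

lemma char_pairing_not_iso:
  assumes G: "group G" and irr: "irreducible_rep G \<sigma>" "irreducible_rep G \<tau>"
    and "\<not> rep_iso G \<tau> \<sigma>"
  shows "char_pairing G \<sigma> \<tau> = 0"
proof -
  let ?m = "rep_dim G \<sigma>" and ?n = "rep_dim G \<tau>"
  note \<sigma> = irreducible_repD(1)[OF irr(1)] and \<tau> = irreducible_repD(1)[OF irr(2)]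
  have E: "elementary_mat ?m ?n i j \<in> carrier_mat ?m ?n" for i j by (simp add: elementary_mat_def)
  have "group_average G \<sigma> (elementary_mat ?m ?n i j) \<tau> = 0\<^sub>m ?m ?n" for i j
  proof -
    have "group_average G \<sigma> (elementary_mat ?m ?n i j) \<tau> \<in> carrier_mat ?m ?n"
      using E by (simp add: group_average_def elementary_mat_def)
    thus ?thesis
      using schur_zero_or_iso[OF G irr(2,1) _ group_average_intertwines[OF G \<sigma> \<tau> E]] assms(4)
      by blast
  qed
  thus ?thesis by (simp add: char_pairing_average[OF G \<sigma> \<tau>])
qed

lemma char_pairing_self:
  assumes G: "group G" and irr: "irreducible_rep G \<sigma>"
  shows "char_pairing G \<sigma> \<sigma> = of_nat (card (carrier G))"
proof -
  interpret group G by fact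
  let ?m = "rep_dim G \<sigma>"
  note \<sigma> = irreducible_repD(1)[OF irr] and pos = irreducible_repD(2)[OF irr]
  let ?E = "elementary_mat ?m ?m"
  have E: "?E i j \<in> carrier_mat ?m ?m" for i j by (simp add: elementary_mat_def)
  have trE: "mat_trace (?E i j) = (if i = j then 1 else 0)" if "i < ?m" for i j
  proof -
    have "mat_trace (?E i j) = (\<Sum>k<?m. if k = i then (if i = j then 1 else 0) else 0)"
      unfolding mat_trace_def by (rule sum.cong) (auto simp: elementary_mat_def)
    thus ?thesis using that by simp
  qed
  have entry: "group_average G \<sigma> (?E i j) \<sigma> $$ (i, j) =
      (if i = j then of_nat (card (carrier G)) / of_nat ?m else 0)" if ij: "i < ?m" "j < ?m" for i j
  proof -
    let ?A = "group_average G \<sigma> (?E i j) \<sigma>"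
    have A: "?A \<in> carrier_mat ?m ?m" using E by (simp add: group_average_def elementary_mat_def)
    obtain c where c: "?A = c \<cdot>\<^sub>m 1\<^sub>m ?m"
      using schur_scalar[OF G irr A group_average_intertwines[OF G \<sigma> \<sigma> E]] by blast
    \<comment> \<open>Conjugation preserves the trace, which determines the scalar.\<close>
    have "mat_trace ?A = (\<Sum>g\<in>carrier G. mat_trace (\<sigma> g * ?E i j * \<sigma> (inv\<^bsub>G\<^esub> g)))"
    proof -
      have d: "dim_row (?E i j) = ?m" "dim_col (?E i j) = ?m" using E by auto
      show ?thesis unfolding group_average_def d
      proof (rule mat_trace_mat_sum)
        fix g assume g: "g \<in> carrier G"
        show "\<sigma> g * ?E i j * \<sigma> (inv\<^bsub>G\<^esub> g) \<in> carrier_mat ?m ?m"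
          using rep_carrier[OF G \<sigma> g] rep_carrier[OF G \<sigma> inv_closed[OF g]] E by auto
      qed
    qed
    also have "\<dots> = (\<Sum>g\<in>carrier G. mat_trace (?E i j))"
    proof (rule sum.cong[OF refl])
      fix g assume g: "g \<in> carrier G"
      note c = rep_carrier[OF G \<sigma> g] rep_carrier[OF G \<sigma> inv_closed[OF g]]
      have "mat_trace (\<sigma> g * ?E i j * \<sigma> (inv\<^bsub>G\<^esub> g)) = mat_trace (\<sigma> (inv\<^bsub>G\<^esub> g) * (\<sigma> g * ?E i j))"
        using c E by (intro mat_trace_comm) auto
      also have "\<sigma> (inv\<^bsub>G\<^esub> g) * (\<sigma> g * ?E i j) = (\<sigma> (inv\<^bsub>G\<^esub> g) * \<sigma> g) * ?E i j"
        by (rule assoc_mult_mat[OF c(2,1) E, symmetric])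
      also have "\<dots> = ?E i j" unfolding rep_inv'[OF G \<sigma> g] by (rule left_mult_one_mat[OF E])
      finally show "mat_trace (\<sigma> g * ?E i j * \<sigma> (inv\<^bsub>G\<^esub> g)) = mat_trace (?E i j)" .
    qed
    also have "\<dots> = (if i = j then of_nat (card (carrier G)) else 0)" using ij by (simp add: trE)
    also have "mat_trace ?A = c * of_nat ?m" unfolding c by (simp add: mat_trace_def)
    finally have "c = (if i = j then of_nat (card (carrier G)) / of_nat ?m else 0)"
      using pos by (auto simp: field_simps split: if_splits)
    moreover have "?A $$ (i, j) = (if i = j then c else 0)" unfolding c using ij by simp
    ultimately show ?thesis by auto
  qed
  have "char_pairing G \<sigma> \<sigma> = (\<Sum>i<?m. \<Sum>j<?m. group_average G \<sigma> (?E i j) \<sigma> $$ (i, j))"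
    by (rule char_pairing_average[OF G \<sigma> \<sigma>])
  also have "\<dots> = (\<Sum>i<?m. \<Sum>j<?m. if i = j then of_nat (card (carrier G)) / of_nat ?m else 0)"
    by (intro sum.cong refl) (simp add: entry)
  also have "\<dots> = of_nat (card (carrier G))" using pos by simp
  finally show ?thesis .
qed

definition block_sum_rep :: "'a rep \<Rightarrow> 'a rep \<Rightarrow> 'a rep" where
  "block_sum_rep \<sigma> \<tau> = (\<lambda>g. four_block_mat (\<sigma> g) (0\<^sub>m (dim_row (\<sigma> g)) (dim_col (\<tau> g)))
     (0\<^sub>m (dim_row (\<tau> g)) (dim_col (\<sigma> g))) (\<tau> g))"

lemma direct_sum_rep_Cons: "direct_sum_rep (\<sigma> # \<sigma>s) = block_sum_rep \<sigma> (direct_sum_rep \<sigma>s)"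
  by (simp add: direct_sum_rep_def block_sum_rep_def Let_def)

lemma direct_sum_rep_append:
  "direct_sum_rep (\<sigma>s @ \<tau>s) = block_sum_rep (direct_sum_rep \<sigma>s) (direct_sum_rep \<tau>s)"
  by (simp add: direct_sum_rep_def block_sum_rep_def diag_block_mat_append Let_def)

lemma direct_sum_rep_singleton: "direct_sum_rep [\<sigma>] = \<sigma>"
  by (simp add: direct_sum_rep_def del: diag_block_mat.simps)

lemma block_sum_rep_eq:
  assumes "group G" "representation G \<sigma>" "representation G \<tau>" "g \<in> carrier G"
  shows "block_sum_rep \<sigma> \<tau> g = four_block_mat (\<sigma> g) (0\<^sub>m (rep_dim G \<sigma>) (rep_dim G \<tau>))
    (0\<^sub>m (rep_dim G \<tau>) (rep_dim G \<sigma>)) (\<tau> g)"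
  using rep_carrier[OF assms(1,2,4)] rep_carrier[OF assms(1,3,4)] by (simp add: block_sum_rep_def)

lemma block_sum_rep:
  assumes G: "group G" and \<sigma>: "representation G \<sigma>" and \<tau>: "representation G \<tau>"
  shows "representation G (block_sum_rep \<sigma> \<tau>)"
    "rep_dim G (block_sum_rep \<sigma> \<tau>) = rep_dim G \<sigma> + rep_dim G \<tau>"
proof -
  interpret group G by fact
  let ?m = "rep_dim G \<sigma>" and ?n = "rep_dim G \<tau>"
  note c\<sigma> = rep_carrier[OF G \<sigma>] and c\<tau> = rep_carrier[OF G \<tau>]
  note eq = block_sum_rep_eq[OF G \<sigma> \<tau>]
  have 1: "block_sum_rep \<sigma> \<tau> g \<in> carrier_mat (?m + ?n) (?m + ?n)" if "g \<in> carrier G" for g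
    using c\<sigma>[OF that] c\<tau>[OF that] by (simp add: eq[OF that])
  have 2: "block_sum_rep \<sigma> \<tau> (g \<otimes>\<^bsub>G\<^esub> h) = block_sum_rep \<sigma> \<tau> g * block_sum_rep \<sigma> \<tau> h"
    if g: "g \<in> carrier G" and h: "h \<in> carrier G" for g h
  proof -
    have "block_sum_rep \<sigma> \<tau> g * block_sum_rep \<sigma> \<tau> h =
        four_block_mat (\<sigma> g * \<sigma> h + 0\<^sub>m ?m ?n * 0\<^sub>m ?n ?m) (\<sigma> g * 0\<^sub>m ?m ?n + 0\<^sub>m ?m ?n * \<tau> h)
          (0\<^sub>m ?n ?m * \<sigma> h + \<tau> g * 0\<^sub>m ?n ?m) (0\<^sub>m ?n ?m * 0\<^sub>m ?m ?n + \<tau> g * \<tau> h)"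
      unfolding eq[OF g] eq[OF h]
      by (rule mult_four_block_mat[OF c\<sigma>[OF g] _ _ c\<tau>[OF g] c\<sigma>[OF h] _ _ c\<tau>[OF h]]) auto
    also have "\<dots> = four_block_mat (\<sigma> g * \<sigma> h) (0\<^sub>m ?m ?n) (0\<^sub>m ?n ?m) (\<tau> g * \<tau> h)"
      using c\<sigma>[OF g] c\<tau>[OF g] c\<sigma>[OF h] c\<tau>[OF h] by (intro cong_four_block_mat) auto
    also have "\<dots> = block_sum_rep \<sigma> \<tau> (g \<otimes>\<^bsub>G\<^esub> h)"
      using c\<sigma>[of "g \<otimes>\<^bsub>G\<^esub> h"] c\<tau>[of "g \<otimes>\<^bsub>G\<^esub> h"] g h
      by (simp add: eq rep_mult[OF G \<sigma>] rep_mult[OF G \<tau>])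
    finally show ?thesis by simp
  qed
  have 3: "block_sum_rep \<sigma> \<tau> \<one>\<^bsub>G\<^esub> = 1\<^sub>m (?m + ?n)"
    using c\<sigma>[OF one_closed] c\<tau>[OF one_closed] by (simp add: eq rep_one[OF G \<sigma>] rep_one[OF G \<tau>])
  show "representation G (block_sum_rep \<sigma> \<tau>)" "rep_dim G (block_sum_rep \<sigma> \<tau>) = ?m + ?n"
    using representationI[of G "block_sum_rep \<sigma> \<tau>", OF G 1 2 3] by auto
qed

lemma block_sum_rep_trace:
  assumes G: "group G" and \<sigma>: "representation G \<sigma>" and \<tau>: "representation G \<tau>"
    and g: "g \<in> carrier G"
  shows "mat_trace (block_sum_rep \<sigma> \<tau> g) = mat_trace (\<sigma> g) + mat_trace (\<tau> g)"
  unfolding block_sum_rep_eq[OF G \<sigma> \<tau> g]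
  by (rule mat_trace_four_block[OF rep_carrier[OF G \<sigma> g] rep_carrier[OF G \<tau> g]])

lemma direct_sum_rep:
  assumes G: "group G" and "\<forall>\<sigma>\<in>set \<sigma>s. representation G \<sigma>"
  shows "representation G (direct_sum_rep \<sigma>s) \<and>
    (\<forall>g\<in>carrier G. mat_trace (direct_sum_rep \<sigma>s g) = (\<Sum>\<sigma>\<leftarrow>\<sigma>s. mat_trace (\<sigma> g)))"
  using assms(2)
proof (induction \<sigma>s)
  case Nil
  have "representation G (direct_sum_rep [] :: 'a rep)"
    by (rule representationI[OF G, of _ 0]) (auto simp: direct_sum_rep_def)
  thus ?case by (simp add: direct_sum_rep_def mat_trace_def)
next
  case (Cons \<sigma> \<sigma>s)
  thus ?case using block_sum_rep[OF G, of \<sigma> "direct_sum_rep \<sigma>s"]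
      block_sum_rep_trace[OF G, of \<sigma> "direct_sum_rep \<sigma>s"]
    by (simp add: direct_sum_rep_Cons)
qed

lemma block_sum_rep_iso:
  assumes G: "group G" and \<sigma>: "representation G \<sigma>" "representation G \<sigma>'"
    and \<tau>: "representation G \<tau>" "representation G \<tau>'"
    and iso: "rep_iso G \<sigma> \<sigma>'" "rep_iso G \<tau> \<tau>'"
  shows "rep_iso G (block_sum_rep \<sigma> \<tau>) (block_sum_rep \<sigma>' \<tau>')"
proof -
  let ?m = "rep_dim G \<sigma>" and ?n = "rep_dim G \<tau>"
  let ?m' = "rep_dim G \<sigma>'" and ?n' = "rep_dim G \<tau>'"
  obtain P Q where P: "P \<in> carrier_mat ?m' ?m" and Q: "Q \<in> carrier_mat ?m ?m'"
    and PQ: "P * Q = 1\<^sub>m ?m'" and QP: "Q * P = 1\<^sub>m ?m"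
    and int: "\<And>g. g \<in> carrier G \<Longrightarrow> P * \<sigma> g = \<sigma>' g * P"
    using rep_isoE[OF iso(1)] by blast
  obtain R S where R: "R \<in> carrier_mat ?n' ?n" and S: "S \<in> carrier_mat ?n ?n'"
    and RS: "R * S = 1\<^sub>m ?n'" and SR: "S * R = 1\<^sub>m ?n"
    and int': "\<And>g. g \<in> carrier G \<Longrightarrow> R * \<tau> g = \<tau>' g * R"
    using rep_isoE[OF iso(2)] by blast
  note b = block_sum_rep[OF G \<sigma>(1) \<tau>(1)] and b' = block_sum_rep[OF G \<sigma>(2) \<tau>(2)]
  have diag: "four_block_mat A (0\<^sub>m a b) (0\<^sub>m c d) D * four_block_mat A' (0\<^sub>m b' a') (0\<^sub>m d' c') D' =
      four_block_mat (A * A') (0\<^sub>m a a') (0\<^sub>m c c') (D * D')"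
    if "A \<in> carrier_mat a b'" "D \<in> carrier_mat c b" "A' \<in> carrier_mat b' c'"
      "D' \<in> carrier_mat b a'" "d = b'" "d' = b"
    for A D A' D' :: "complex mat" and a b c d a' b' c' d'
  proof -
    have "four_block_mat A (0\<^sub>m a b) (0\<^sub>m c d) D * four_block_mat A' (0\<^sub>m b' a') (0\<^sub>m d' c') D' =
      four_block_mat (A * A' + 0\<^sub>m a b * 0\<^sub>m d' c') (A * 0\<^sub>m b' a' + 0\<^sub>m a b * D')
        (0\<^sub>m c d * A' + D * 0\<^sub>m d' c') (0\<^sub>m c d * 0\<^sub>m b' a' + D * D')"
      using that by (intro mult_four_block_mat[of _ a b' _ b _ c _ _ c' _ a']) auto
    also have "\<dots> = four_block_mat (A * A') (0\<^sub>m a a') (0\<^sub>m c c') (D * D')"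
      using that by (intro cong_four_block_mat) auto
    finally show ?thesis .
  qed
  show ?thesis
  proof (rule rep_isoI[OF G b(1) b'(1), unfolded b(2) b'(2)])
    let ?P = "four_block_mat P (0\<^sub>m ?m' ?n) (0\<^sub>m ?n' ?m) R"
    let ?Q = "four_block_mat Q (0\<^sub>m ?m ?n') (0\<^sub>m ?n ?m') S"
    show "?P \<in> carrier_mat (?m' + ?n') (?m + ?n)" "?Q \<in> carrier_mat (?m + ?n) (?m' + ?n')"
      using P Q R S by auto
    show "?P * ?Q = 1\<^sub>m (?m' + ?n')" using P Q R S by (subst diag) (auto simp: PQ RS)
    show "?Q * ?P = 1\<^sub>m (?m + ?n)" using P Q R S by (subst diag) (auto simp: QP SR)
    fix g assume g: "g \<in> carrier G"
    note c = rep_carrier[OF G \<sigma>(1) g] rep_carrier[OF G \<tau>(1) g]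
      rep_carrier[OF G \<sigma>(2) g] rep_carrier[OF G \<tau>(2) g]
    show "?P * block_sum_rep \<sigma> \<tau> g = block_sum_rep \<sigma>' \<tau>' g * ?P"
      unfolding block_sum_rep_eq[OF G \<sigma>(1) \<tau>(1) g] block_sum_rep_eq[OF G \<sigma>(2) \<tau>(2) g]
      using P R c by (subst (1 2) diag) (auto simp: int[OF g] int'[OF g])
  qed
qed

lemma mat_minus_zero: "A \<in> carrier_mat m n \<Longrightarrow> A - 0\<^sub>m m n = (A :: complex mat)"
  by (intro eq_matI) auto

lemma invariant_subspace_eq_range:
  assumes "invariant_subspace G \<rho> W"
  obtains k M L where "M \<in> carrier_mat (rep_dim G \<rho>) k" "L \<in> carrier_mat k (rep_dim G \<rho>)"
    "L * M = 1\<^sub>m k" "W = {M *\<^sub>v v | v. v \<in> carrier_vec k}"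
proof -
  note W = assms[unfolded invariant_subspace_iff]
  have sub: "W \<subseteq> carrier_vec (rep_dim G \<rho>)" "0\<^sub>v (rep_dim G \<rho>) \<in> W"
    "\<And>u v. u \<in> W \<Longrightarrow> v \<in> W \<Longrightarrow> u + v \<in> W" "\<And>c v. v \<in> W \<Longrightarrow> c \<cdot>\<^sub>v v \<in> W"
    using W by simp_all
  show ?thesis
  proof (rule subspace_eq_range[OF sub])
    fix k M L
    assume "M \<in> carrier_mat (rep_dim G \<rho>) k" "L \<in> carrier_mat k (rep_dim G \<rho>)"
      "L * M = 1\<^sub>m k" "W = {M *\<^sub>v v | v. v \<in> carrier_vec k}"
    thus thesis by (rule that)
  qed
qed

text \<open>Maschke's theorem. Averaging a left inverse of an injective intertwiner makes the left inverse
  equivariant, and its kernel is an invariant complement of the image.\<close>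

lemma maschke:
  assumes G: "group G" and fin: "finite (carrier G)" and \<rho>: "representation G \<rho>"
    and inv: "invariant_subspace G \<rho> W" and W0: "W \<noteq> {0\<^sub>v (rep_dim G \<rho>)}"
    and W1: "W \<noteq> carrier_vec (rep_dim G \<rho>)"
  obtains \<sigma> \<tau> where "representation G \<sigma>" "representation G \<tau>"
    "rep_dim G \<sigma> < rep_dim G \<rho>" "rep_dim G \<tau> < rep_dim G \<rho>" "rep_iso G \<rho> (block_sum_rep \<sigma> \<tau>)"
proof -
  interpret group G by fact
  let ?d = "rep_dim G \<rho>"
  note c\<rho> = rep_carrier[OF G \<rho>]
  note W = inv[unfolded invariant_subspace_iff]
  \<comment> \<open>If the column space of \<open>M\<close> is invariant, compressing \<open>\<rho>\<close> by \<open>M\<close> and a left inverse gives a representation.\<close>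
  have sub: "representation G (\<lambda>g. L * \<rho> g * M)" "rep_dim G (\<lambda>g. L * \<rho> g * M) = k"
    if M: "M \<in> carrier_mat ?d k" and L: "L \<in> carrier_mat k ?d" and LM: "L * M = 1\<^sub>m k"
      and inv: "\<And>g. g \<in> carrier G \<Longrightarrow> M * (L * \<rho> g * M) = \<rho> g * M" for M L k
  proof -
    have 1: "L * \<rho> g * M \<in> carrier_mat k k" if "g \<in> carrier G" for g using M L c\<rho>[OF that] by auto
    have 2: "L * \<rho> (g \<otimes>\<^bsub>G\<^esub> h) * M = (L * \<rho> g * M) * (L * \<rho> h * M)"
      if g: "g \<in> carrier G" and h: "h \<in> carrier G" for g h
    proof -
      have L\<rho>: "L * \<rho> g \<in> carrier_mat k ?d" and \<rho>M: "\<rho> h * M \<in> carrier_mat ?d k"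
        using L M c\<rho>[OF g] c\<rho>[OF h] by auto
      have "(L * \<rho> g * M) * (L * \<rho> h * M) = (L * \<rho> g) * (M * (L * \<rho> h * M))"
        by (rule assoc_mult_mat[OF L\<rho> M 1[OF h]])
      also have "\<dots> = (L * \<rho> g) * (\<rho> h * M)" by (simp only: inv[OF h])
      also have "\<dots> = L * \<rho> g * \<rho> h * M" by (rule assoc_mult_mat[OF L\<rho> c\<rho>[OF h] M, symmetric])
      also have "L * \<rho> g * \<rho> h = L * \<rho> (g \<otimes>\<^bsub>G\<^esub> h)"
        unfolding rep_mult[OF G \<rho> g h] by (rule assoc_mult_mat[OF L c\<rho>[OF g] c\<rho>[OF h]])
      finally show ?thesis by simp
    qed
    have 3: "L * \<rho> \<one>\<^bsub>G\<^esub> * M = 1\<^sub>m k" using L LM by (simp add: rep_one[OF G \<rho>])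
    show "representation G (\<lambda>g. L * \<rho> g * M)" "rep_dim G (\<lambda>g. L * \<rho> g * M) = k"
      using representationI[OF G, of "\<lambda>g. L * \<rho> g * M" k, OF 1 2 3] by auto
  qed
  obtain k M L0 where M: "M \<in> carrier_mat ?d k" and L0: "L0 \<in> carrier_mat k ?d"
    and L0M: "L0 * M = 1\<^sub>m k" and WM: "W = {M *\<^sub>v v | v. v \<in> carrier_vec k}"
    by (rule invariant_subspace_eq_range[OF inv])
  define \<sigma> where "\<sigma> = (\<lambda>g. L0 * \<rho> g * M)"
  have retract: "M *\<^sub>v (L0 *\<^sub>v w) = w" if "w \<in> W" for w
  proof -
    obtain v where v: "v \<in> carrier_vec k" "w = M *\<^sub>v v" using \<open>w \<in> W\<close> WM by auto
    have "L0 *\<^sub>v w = (L0 * M) *\<^sub>v v" unfolding v(2) by (rule assoc_mult_mat_vec[OF L0 M v(1), symmetric])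
    thus ?thesis using v by (simp add: L0M)
  qed
  have M\<sigma>: "M * \<sigma> g = \<rho> g * M" if g: "g \<in> carrier G" for g
  proof (rule mat_eqI_mult_vec[of _ ?d k])
    fix v :: "complex vec" assume v: "v \<in> carrier_vec k"
    have "(\<rho> g * M) *\<^sub>v v = \<rho> g *\<^sub>v (M *\<^sub>v v)" by (rule assoc_mult_mat_vec[OF c\<rho>[OF g] M v])
    also have "\<dots> \<in> W" using W WM v g by blast
    finally have w: "(\<rho> g * M) *\<^sub>v v \<in> W" .
    have \<rho>M: "\<rho> g * M \<in> carrier_mat ?d k" using c\<rho>[OF g] M by auto
    have \<sigma>eq: "\<sigma> g = L0 * (\<rho> g * M)" unfolding \<sigma>_def by (rule assoc_mult_mat[OF L0 c\<rho>[OF g] M])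
    have "(M * \<sigma> g) *\<^sub>v v = M *\<^sub>v (\<sigma> g *\<^sub>v v)"
      using M L0 \<rho>M v by (intro assoc_mult_mat_vec) (auto simp: \<sigma>eq)
    also have "\<sigma> g *\<^sub>v v = L0 *\<^sub>v ((\<rho> g * M) *\<^sub>v v)"
      unfolding \<sigma>eq by (rule assoc_mult_mat_vec[OF L0 \<rho>M v])
    also have "M *\<^sub>v \<dots> = (\<rho> g * M) *\<^sub>v v" by (rule retract[OF w])
    finally show "(M * \<sigma> g) *\<^sub>v v = (\<rho> g * M) *\<^sub>v v" .
  qed (use M L0 c\<rho>[OF g] in \<open>auto simp: \<sigma>_def\<close>)
  have \<sigma>: "representation G \<sigma>" "rep_dim G \<sigma> = k"
    unfolding \<sigma>_def using sub[OF M L0 L0M] M\<sigma> by (auto simp: \<sigma>_def)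
  note c\<sigma> = rep_carrier[OF G \<sigma>(1), unfolded \<sigma>(2)]
  define N :: complex where "N = of_nat (card (carrier G))"
  have N: "N \<noteq> 0" using fin by (auto simp: N_def)
  define L where "L = (1 / N) \<cdot>\<^sub>m group_average G \<sigma> L0 \<rho>"
  have avg: "group_average G \<sigma> L0 \<rho> \<in> carrier_mat k ?d" using L0 by (simp add: group_average_def)
  have L: "L \<in> carrier_mat k ?d" using avg by (simp add: L_def)
  have LM: "L * M = 1\<^sub>m k"
  proof -
    have F: "\<sigma> g * L0 * \<rho> (inv\<^bsub>G\<^esub> g) \<in> carrier_mat k ?d" if "g \<in> carrier G" for g
      using c\<sigma>[OF that] c\<rho>[OF inv_closed[OF that]] L0 by auto
    have "group_average G \<sigma> L0 \<rho> * M =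
        mat_sum k k (carrier G) (\<lambda>g. \<sigma> g * L0 * \<rho> (inv\<^bsub>G\<^esub> g) * M)"
      unfolding group_average_def using L0 mat_sum_mult[OF M F] by auto
    also have "\<dots> = mat_sum k k (carrier G) (\<lambda>g. 1\<^sub>m k)"
    proof (rule mat_sum_cong)
      fix g assume g: "g \<in> carrier G"
      note gi = inv_closed[OF g]
      have \<sigma>L: "\<sigma> g * L0 \<in> carrier_mat k ?d" using c\<sigma>[OF g] L0 by auto
      have "\<sigma> g * L0 * \<rho> (inv\<^bsub>G\<^esub> g) * M = \<sigma> g * L0 * (\<rho> (inv\<^bsub>G\<^esub> g) * M)"
        by (rule assoc_mult_mat[OF \<sigma>L c\<rho>[OF gi] M])
      also have "\<dots> = \<sigma> g * L0 * (M * \<sigma> (inv\<^bsub>G\<^esub> g))" by (simp only: M\<sigma>[OF gi])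
      also have "\<dots> = \<sigma> g * ((L0 * M) * \<sigma> (inv\<^bsub>G\<^esub> g))"
        by (rule mat_mult_regroup[OF c\<sigma>[OF g] L0 M c\<sigma>[OF gi]])
      also have "\<dots> = \<sigma> g * \<sigma> (inv\<^bsub>G\<^esub> g)" using c\<sigma>[OF gi] by (simp add: L0M)
      also have "\<dots> = 1\<^sub>m k" using rep_inv[OF G \<sigma>(1) g] \<sigma>(2) by simp
      finally show "\<sigma> g * L0 * \<rho> (inv\<^bsub>G\<^esub> g) * M = 1\<^sub>m k" .
    qed
    also have "\<dots> = N \<cdot>\<^sub>m 1\<^sub>m k" unfolding N_def by (rule mat_sum_const) simp
    finally have eq: "group_average G \<sigma> L0 \<rho> * M = N \<cdot>\<^sub>m 1\<^sub>m k" .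
    have "L * M = (1 / N) \<cdot>\<^sub>m (group_average G \<sigma> L0 \<rho> * M)"
      unfolding L_def by (rule mult_smult_assoc_mat[OF avg M])
    thus ?thesis using N by (auto simp: eq intro!: eq_matI)
  qed
  have L\<rho>: "L * \<rho> g = \<sigma> g * L" if g: "g \<in> carrier G" for g
  proof -
    have "L * \<rho> g = (1 / N) \<cdot>\<^sub>m (group_average G \<sigma> L0 \<rho> * \<rho> g)"
      unfolding L_def by (rule mult_smult_assoc_mat[OF avg c\<rho>[OF g]])
    also have "\<dots> = (1 / N) \<cdot>\<^sub>m (\<sigma> g * group_average G \<sigma> L0 \<rho>)"
      using group_average_intertwines[OF G \<sigma>(1) \<rho> _ g] L0 \<sigma>(2) by simp
    also have "\<dots> = \<sigma> g * L"
      unfolding L_def by (rule mult_smult_distrib[OF c\<sigma>[OF g] avg, symmetric])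
    finally show ?thesis .
  qed
  define W' where "W' = {v \<in> carrier_vec ?d. L *\<^sub>v v = 0\<^sub>v k}"
  have inv': "invariant_subspace G \<rho> W'" unfolding W'_def
    by (rule invariant_kernel[OF G \<rho> c\<sigma> L L\<rho>])
  note W' = inv'[unfolded invariant_subspace_iff]
  obtain k' M' L0' where M': "M' \<in> carrier_mat ?d k'" and L0': "L0' \<in> carrier_mat k' ?d"
    and L0M': "L0' * M' = 1\<^sub>m k'" and WM': "W' = {M' *\<^sub>v v | v. v \<in> carrier_vec k'}"
    by (rule invariant_subspace_eq_range[OF inv'])
  define Q where "Q = 1\<^sub>m ?d - M * L"
  have MLc: "M * L \<in> carrier_mat ?d ?d" using M L by auto
  have Q: "Q \<in> carrier_mat ?d ?d" unfolding Q_def using MLc by (intro minus_carrier_mat)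
  define L' where "L' = L0' * Q"
  have L': "L' \<in> carrier_mat k' ?d" using L0' Q by (simp add: L'_def)
  have LM': "L * M' = 0\<^sub>m k k'"
  proof (rule mat_eqI_mult_vec[of _ k k'])
    fix v :: "complex vec" assume v: "v \<in> carrier_vec k'"
    have "M' *\<^sub>v v \<in> W'" using WM' v by auto
    moreover have "(L * M') *\<^sub>v v = L *\<^sub>v (M' *\<^sub>v v)" by (rule assoc_mult_mat_vec[OF L M' v])
    ultimately show "(L * M') *\<^sub>v v = 0\<^sub>m k k' *\<^sub>v v"
      using v by (auto simp: W'_def)
  qed (use L M' in auto)
  have QM': "Q * M' = M'"
  proof -
    have "Q * M' = M' - M * L * M'" unfolding Q_def
      using M' MLc by (simp add: minus_mult_distrib_mat[of _ ?d ?d])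
    also have "M * L * M' = M * (L * M')" by (rule assoc_mult_mat[OF M L M'])
    also have "\<dots> = 0\<^sub>m ?d k'" using M by (simp add: LM')
    finally show ?thesis using M' by (auto intro!: eq_matI)
  qed
  have QM: "Q * M = 0\<^sub>m ?d k"
  proof -
    have "Q * M = M - M * L * M" unfolding Q_def
      using M MLc by (simp add: minus_mult_distrib_mat[of _ ?d ?d])
    also have "M * L * M = M * (L * M)" by (rule assoc_mult_mat[OF M L M])
    also have "\<dots> = M" using M by (simp add: LM)
    finally show ?thesis using M by simp
  qed
  have L'M': "L' * M' = 1\<^sub>m k'"
    unfolding L'_def using assoc_mult_mat[OF L0' Q M'] by (simp add: QM' L0M')
  have L'M: "L' * M = 0\<^sub>m k' k"
    unfolding L'_def using assoc_mult_mat[OF L0' Q M] L0' by (simp add: QM)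
  have LQ: "L * Q = 0\<^sub>m k ?d"
  proof -
    have "L * Q = L - L * (M * L)" unfolding Q_def
      using mult_minus_distrib_mat[OF L one_carrier_mat MLc] L by simp
    also have "L * (M * L) = (L * M) * L" by (rule assoc_mult_mat[OF L M L, symmetric])
    also have "\<dots> = L" using L by (simp add: LM)
    finally show ?thesis using L by simp
  qed
  have M'L': "M' * L' = Q"
  proof (rule mat_eqI_mult_vec[of _ ?d ?d])
    fix v :: "complex vec" assume v: "v \<in> carrier_vec ?d"
    have Qv: "Q *\<^sub>v v \<in> carrier_vec ?d" using Q v by auto
    have "L *\<^sub>v (Q *\<^sub>v v) = (L * Q) *\<^sub>v v" by (rule assoc_mult_mat_vec[OF L Q v, symmetric])
    hence "Q *\<^sub>v v \<in> W'" using v Qv by (auto simp: W'_def LQ)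
    then obtain u where u: "u \<in> carrier_vec k'" "Q *\<^sub>v v = M' *\<^sub>v u" using WM' by auto
    have "(M' * L') *\<^sub>v v = M' *\<^sub>v (L' *\<^sub>v v)" by (rule assoc_mult_mat_vec[OF M' L' v])
    also have "L' *\<^sub>v v = L0' *\<^sub>v (Q *\<^sub>v v)" unfolding L'_def by (rule assoc_mult_mat_vec[OF L0' Q v])
    also have "\<dots> = (L0' * M') *\<^sub>v u" unfolding u(2) by (rule assoc_mult_mat_vec[OF L0' M' u(1), symmetric])
    also have "\<dots> = u" using u(1) by (simp add: L0M')
    finally show "(M' * L') *\<^sub>v v = Q *\<^sub>v v" by (simp add: u(2))
  qed (use M' L' Q in auto)
  have complete: "M * L + M' * L' = 1\<^sub>m ?d"
    unfolding M'L' Q_def using M L by (auto intro!: eq_matI)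
  have dims: "k + k' = ?d"
  proof -
    have "complex_of_nat ?d = mat_trace (M * L + M' * L')" by (simp add: complete mat_trace_one)
    also have "\<dots> = mat_trace (M * L) + mat_trace (M' * L')"
      using M L M' L' by (simp add: mat_trace_def sum.distrib del: index_mult_mat(1))
    also have "\<dots> = mat_trace (L * M) + mat_trace (L' * M')"
      by (simp add: mat_trace_comm[OF M L] mat_trace_comm[OF M' L'])
    also have "\<dots> = of_nat (k + k')" by (simp add: LM L'M' mat_trace_one)
    finally show ?thesis by (metis of_nat_eq_iff)
  qed
  define \<tau> where "\<tau> = (\<lambda>g. L' * \<rho> g * M')"
  have M'\<tau>: "M' * \<tau> g = \<rho> g * M'" if g: "g \<in> carrier G" for g
  proof -
    have \<rho>M': "\<rho> g * M' \<in> carrier_mat ?d k'" using c\<rho>[OF g] M' by auto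
    have "M' * \<tau> g = M' * (L' * (\<rho> g * M'))"
      unfolding \<tau>_def by (simp only: assoc_mult_mat[OF L' c\<rho>[OF g] M'])
    also have "\<dots> = (M' * L') * (\<rho> g * M')" by (rule assoc_mult_mat[OF M' L' \<rho>M', symmetric])
    also have "\<dots> = \<rho> g * M' - (M * L) * (\<rho> g * M')" unfolding M'L' Q_def
      using minus_mult_distrib_mat[OF one_carrier_mat MLc \<rho>M'] left_mult_one_mat[OF \<rho>M'] by simp
    also have "(M * L) * (\<rho> g * M') = M * ((L * \<rho> g) * M')"
      by (rule mat_mult_regroup[OF M L c\<rho>[OF g] M'])
    also have "(L * \<rho> g) * M' = \<sigma> g * (L * M')"
      unfolding L\<rho>[OF g] by (rule assoc_mult_mat[OF c\<sigma>[OF g] L M'])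
    also have "M * (\<sigma> g * (L * M')) = 0\<^sub>m ?d k'" using c\<sigma>[OF g] M by (simp add: LM')
    also have "\<rho> g * M' - 0\<^sub>m ?d k' = \<rho> g * M'"
      by (rule mat_minus_zero[OF \<rho>M'])
    finally show ?thesis .
  qed
  have \<tau>: "representation G \<tau>" "rep_dim G \<tau> = k'"
    unfolding \<tau>_def using sub[OF M' L' L'M'] M'\<tau> by (auto simp: \<tau>_def)
  note c\<tau> = rep_carrier[OF G \<tau>(1), unfolded \<tau>(2)]
  note b = block_sum_rep[OF G \<sigma>(1) \<tau>(1), unfolded \<sigma>(2) \<tau>(2)]
  have "rep_iso G (block_sum_rep \<sigma> \<tau>) \<rho>"
  proof (rule rep_isoI[OF G b(1) \<rho>, unfolded b(2)])
    let ?P = "four_block_mat M M' (0\<^sub>m 0 k) (0\<^sub>m 0 k')"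
    let ?Q = "four_block_mat L (0\<^sub>m k 0) L' (0\<^sub>m k' 0)"
    show P: "?P \<in> carrier_mat ?d (k + k')"
      using four_block_carrier_mat[OF M, of "0\<^sub>m 0 k'" 0 k'] by simp
    show "?Q \<in> carrier_mat (k + k') ?d"
      using four_block_carrier_mat[OF L, of "0\<^sub>m k' 0" k' 0] by simp
    have "?P * ?Q = four_block_mat (M * L + M' * L') (M * 0\<^sub>m k 0 + M' * 0\<^sub>m k' 0)
        (0\<^sub>m 0 k * L + 0\<^sub>m 0 k' * L') (0\<^sub>m 0 k * 0\<^sub>m k 0 + 0\<^sub>m 0 k' * 0\<^sub>m k' 0)"
      by (rule mult_four_block_mat[OF M M' _ _ L _ L']) auto
    also have "\<dots> = 1\<^sub>m ?d" unfolding complete by (rule eq_matI) auto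
    finally show "?P * ?Q = 1\<^sub>m ?d" .
    have "?Q * ?P = four_block_mat (L * M + 0\<^sub>m k 0 * 0\<^sub>m 0 k) (L * M' + 0\<^sub>m k 0 * 0\<^sub>m 0 k')
        (L' * M + 0\<^sub>m k' 0 * 0\<^sub>m 0 k) (L' * M' + 0\<^sub>m k' 0 * 0\<^sub>m 0 k')"
      by (rule mult_four_block_mat[OF L _ L' _ M M']) auto
    also have "\<dots> = four_block_mat (1\<^sub>m k) (0\<^sub>m k k') (0\<^sub>m k' k) (1\<^sub>m k')"
      unfolding LM LM' L'M L'M' by (intro cong_four_block_mat) (auto intro!: eq_matI)
    finally show "?Q * ?P = 1\<^sub>m (k + k')" by simp
    fix g assume g: "g \<in> carrier G"
    have "?P * block_sum_rep \<sigma> \<tau> g =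
        four_block_mat (M * \<sigma> g + M' * 0\<^sub>m k' k) (M * 0\<^sub>m k k' + M' * \<tau> g)
          (0\<^sub>m 0 k * \<sigma> g + 0\<^sub>m 0 k' * 0\<^sub>m k' k) (0\<^sub>m 0 k * 0\<^sub>m k k' + 0\<^sub>m 0 k' * \<tau> g)"
      unfolding block_sum_rep_eq[OF G \<sigma>(1) \<tau>(1) g] \<sigma>(2) \<tau>(2)
      by (rule mult_four_block_mat[OF M M' _ _ c\<sigma>[OF g] _ _ c\<tau>[OF g]]) auto
    also have "\<dots> = four_block_mat (\<rho> g * M + 0\<^sub>m ?d 0 * 0\<^sub>m 0 k) (\<rho> g * M' + 0\<^sub>m ?d 0 * 0\<^sub>m 0 k')
        (0\<^sub>m 0 ?d * M + 0\<^sub>m 0 0 * 0\<^sub>m 0 k) (0\<^sub>m 0 ?d * M' + 0\<^sub>m 0 0 * 0\<^sub>m 0 k')"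
      using M M' c\<sigma>[OF g] c\<tau>[OF g] c\<rho>[OF g]
      by (intro cong_four_block_mat) (auto simp: M\<sigma>[OF g] M'\<tau>[OF g] intro!: eq_matI)
    also have "\<dots> = four_block_mat (\<rho> g) (0\<^sub>m ?d 0) (0\<^sub>m 0 ?d) (0\<^sub>m 0 0) * ?P"
      by (rule mult_four_block_mat[OF c\<rho>[OF g] _ _ _ M M', symmetric]) auto
    also have "four_block_mat (\<rho> g) (0\<^sub>m ?d 0) (0\<^sub>m 0 ?d) (0\<^sub>m 0 0) = \<rho> g"
      using c\<rho>[OF g] by (intro eq_matI) auto
    finally show "?P * block_sum_rep \<sigma> \<tau> g = \<rho> g * ?P" .
  qed
  hence iso: "rep_iso G \<rho> (block_sum_rep \<sigma> \<tau>)" by (rule rep_iso_sym[OF G b(1) \<rho>])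
  have "k \<noteq> 0"
  proof
    assume "k = 0"
    have "w = 0\<^sub>v ?d" if "w \<in> W" for w
    proof -
      obtain v where v: "v \<in> carrier_vec k" "w = M *\<^sub>v v" using \<open>w \<in> W\<close> WM by auto
      show ?thesis unfolding v(2) using v(1) M \<open>k = 0\<close> by (intro eq_vecI) (auto simp: scalar_prod_def)
    qed
    thus False using W0 W by auto
  qed
  moreover have "k' \<noteq> 0"
  proof
    assume k': "k' = 0"
    have "M' * L' = 0\<^sub>m ?d ?d" using M' L' k' by (intro eq_matI) (auto simp: scalar_prod_def)
    hence ML1: "M * L = 1\<^sub>m ?d" using complete M L by simp
    have "v \<in> W" if v: "v \<in> carrier_vec ?d" for v
    proof -
      have "v = M *\<^sub>v (L *\<^sub>v v)" using assoc_mult_mat_vec[OF M L v] v by (simp add: ML1)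
      thus ?thesis using WM L v by auto
    qed
    thus False using W1 W by auto
  qed
  ultimately show ?thesis using that[OF \<sigma>(1) \<tau>(1) _ _ iso] \<sigma>(2) \<tau>(2) dims by simp
qed

text \<open>Induction on the dimension: Maschke's theorem splits a representation that is not irreducible into
  two of smaller dimension. In dimension zero the decomposition is the empty one.\<close>

lemma completely_reducible:
  assumes G: "group G" and fin: "finite (carrier G)" and "representation G \<rho>"
  shows "\<exists>\<sigma>s. (\<forall>\<sigma> \<in> set \<sigma>s. irreducible_rep G \<sigma>) \<and> rep_iso G \<rho> (direct_sum_rep \<sigma>s)"
  using assms(3)
proof (induction "rep_dim G \<rho>" arbitrary: \<rho> rule: less_induct)
  case less
  note \<rho> = less.prems
  have rep: "representation G (direct_sum_rep \<sigma>s)" if "\<forall>\<sigma> \<in> set \<sigma>s. irreducible_rep G \<sigma>" for \<sigma>s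
    using direct_sum_rep[OF G] that irreducible_repD(1) by blast
  show ?case
  proof (cases "rep_dim G \<rho> = 0")
    case True
    have r: "representation G (direct_sum_rep [] :: 'a rep)" by (rule rep) simp
    have d: "rep_dim G (direct_sum_rep [] :: 'a rep) = 0" by (simp add: rep_dim_def direct_sum_rep_def)
    have "rep_iso G \<rho> (direct_sum_rep [])"
    proof (rule rep_isoI[OF G \<rho> r, of "1\<^sub>m 0" "1\<^sub>m 0"])
      fix g assume g: "g \<in> carrier G"
      have "\<rho> g \<in> carrier_mat 0 0" "direct_sum_rep [] g \<in> carrier_mat 0 0"
        using rep_carrier[OF G \<rho> g] rep_carrier[OF G r g] by (simp_all only: True d)
      thus "1\<^sub>m 0 * \<rho> g = direct_sum_rep [] g * 1\<^sub>m 0" by (intro eq_matI) auto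
    qed (simp_all add: True d)
    thus ?thesis by (intro exI[of _ "[]"]) simp
  next
    case False
    show ?thesis
    proof (cases "irreducible_rep G \<rho>")
      case True
      thus ?thesis by (intro exI[of _ "[\<rho>]"]) (simp add: direct_sum_rep_singleton rep_iso_refl[OF G \<rho>])
    next
      case red: False
      then obtain W where "invariant_subspace G \<rho> W" "W \<noteq> {0\<^sub>v (rep_dim G \<rho>)}"
        "W \<noteq> carrier_vec (rep_dim G \<rho>)"
        using \<rho> False unfolding irreducible_rep_def by auto
      then obtain \<sigma> \<tau> where \<sigma>: "representation G \<sigma>" "rep_dim G \<sigma> < rep_dim G \<rho>"
        and \<tau>: "representation G \<tau>" "rep_dim G \<tau> < rep_dim G \<rho>"
        and iso: "rep_iso G \<rho> (block_sum_rep \<sigma> \<tau>)"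
        using maschke[OF G fin \<rho>] by metis
      obtain \<sigma>s where \<sigma>s: "\<forall>\<sigma> \<in> set \<sigma>s. irreducible_rep G \<sigma>" "rep_iso G \<sigma> (direct_sum_rep \<sigma>s)"
        using less.hyps[OF \<sigma>(2,1)] by blast
      obtain \<tau>s where \<tau>s: "\<forall>\<sigma> \<in> set \<tau>s. irreducible_rep G \<sigma>" "rep_iso G \<tau> (direct_sum_rep \<tau>s)"
        using less.hyps[OF \<tau>(2,1)] by blast
      have "rep_iso G (block_sum_rep \<sigma> \<tau>) (direct_sum_rep (\<sigma>s @ \<tau>s))"
        unfolding direct_sum_rep_append
        by (rule block_sum_rep_iso[OF G \<sigma>(1) rep[OF \<sigma>s(1)] \<tau>(1) rep[OF \<tau>s(1)] \<sigma>s(2) \<tau>s(2)])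
      hence "rep_iso G \<rho> (direct_sum_rep (\<sigma>s @ \<tau>s))"
        using \<sigma>s(1) \<tau>s(1)
        by (intro rep_iso_trans[OF G \<rho> block_sum_rep(1)[OF G \<sigma>(1) \<tau>(1)] rep iso]) auto
      thus ?thesis using \<sigma>s(1) \<tau>s(1) by (intro exI[of _ "\<sigma>s @ \<tau>s"]) auto
    qed
  qed
qed

section \<open>Representations as vectors\<close>

lemma rep_class_eq_iff:
  assumes G: "group G" and \<sigma>: "representation G \<sigma>" and \<tau>: "representation G \<tau>"
  shows "rep_class G \<sigma> = rep_class G \<tau> \<longleftrightarrow> rep_iso G \<sigma> \<tau>"
proof
  assume "rep_class G \<sigma> = rep_class G \<tau>"
  moreover have "\<tau> \<in> rep_class G \<tau>" using \<tau> rep_iso_refl[OF G \<tau>] by (simp add: rep_class_def)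
  ultimately have "\<tau> \<in> rep_class G \<sigma>" by simp
  thus "rep_iso G \<sigma> \<tau>" by (simp add: rep_class_def)
next
  assume iso: "rep_iso G \<sigma> \<tau>"
  hence iso': "rep_iso G \<tau> \<sigma>" by (rule rep_iso_sym[OF G \<sigma> \<tau>])
  show "rep_class G \<sigma> = rep_class G \<tau>" unfolding rep_class_def
    using rep_iso_trans[OF G \<sigma> \<tau> _ iso] rep_iso_trans[OF G \<tau> \<sigma> _ iso'] by blast
  qed

definition class_char :: "'a rep set \<Rightarrow> 'a \<Rightarrow> complex" where
  "class_char X x = mat_trace ((SOME \<rho>. \<rho> \<in> X) x)"

lemma some_rep:
  assumes G: "group G" and \<sigma>: "representation G \<sigma>"
  shows "representation G (SOME \<rho>. \<rho> \<in> rep_class G \<sigma>)"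
    "rep_iso G \<sigma> (SOME \<rho>. \<rho> \<in> rep_class G \<sigma>)"
proof -
  have "\<sigma> \<in> rep_class G \<sigma>" using \<sigma> rep_iso_refl[OF G \<sigma>] by (simp add: rep_class_def)
  hence "(SOME \<rho>. \<rho> \<in> rep_class G \<sigma>) \<in> rep_class G \<sigma>" by (rule someI[where P = "\<lambda>\<rho>. \<rho> \<in> rep_class G \<sigma>"])
  thus "representation G (SOME \<rho>. \<rho> \<in> rep_class G \<sigma>)"
    "rep_iso G \<sigma> (SOME \<rho>. \<rho> \<in> rep_class G \<sigma>)" by (simp_all add: rep_class_def)
qed

lemma some_rep_Irr:
  assumes "group G" "X \<in> Irr G"
  shows "representation G (SOME \<rho>. \<rho> \<in> X)"
  using assms some_rep(1) irreducible_repD(1) by (auto simp: Irr_def)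

lemma class_char_rep_class:
  assumes "group G" "representation G \<sigma>" "x \<in> carrier G"
  shows "class_char (rep_class G \<sigma>) x = mat_trace (\<sigma> x)"
  unfolding class_char_def
  using rep_iso_trace[OF assms(1,2) some_rep(1)[OF assms(1,2)] some_rep(2)[OF assms(1,2)] assms(3)]
  by simp

definition virtual_char :: "('a rep set \<Rightarrow> complex) \<Rightarrow> 'a \<Rightarrow> complex" where
  "virtual_char v x = (\<Sum>X | v X \<noteq> 0. v X * class_char X x)"

lemma virtual_char_superset:
  assumes "finite S" "{X. v X \<noteq> 0} \<subseteq> S"
  shows "virtual_char v x = (\<Sum>X\<in>S. v X * class_char X x)"
  unfolding virtual_char_def using assms by (intro sum.mono_neutral_left) auto

lemma rep_space_lincomb:
  assumes I: "finite I" and w: "\<And>i. i \<in> I \<Longrightarrow> w i \<in> rep_space G"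
  shows "(\<lambda>X. \<Sum>i\<in>I. c i * w i X) \<in> rep_space G"
    and "virtual_char (\<lambda>X. \<Sum>i\<in>I. c i * w i X) x = (\<Sum>i\<in>I. c i * virtual_char (w i) x)"
proof -
  let ?S = "\<Union>i\<in>I. {X. w i X \<noteq> 0}"
  have S: "finite ?S" "?S \<subseteq> Irr G" using I w by (auto simp: rep_space_def)
  have sub: "{X. (\<Sum>i\<in>I. c i * w i X) \<noteq> 0} \<subseteq> ?S"
    using sum.not_neutral_contains_not_neutral by fastforce
  show "(\<lambda>X. \<Sum>i\<in>I. c i * w i X) \<in> rep_space G"
    using S finite_subset[OF sub S(1)] sub by (auto simp: rep_space_def)
  have "virtual_char (\<lambda>X. \<Sum>i\<in>I. c i * w i X) x = (\<Sum>X\<in>?S. (\<Sum>i\<in>I. c i * w i X) * class_char X x)"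
    by (rule virtual_char_superset[OF S(1) sub])
  also have "\<dots> = (\<Sum>X\<in>?S. \<Sum>i\<in>I. c i * (w i X * class_char X x))"
    by (simp add: sum_distrib_right mult.assoc)
  also have "\<dots> = (\<Sum>i\<in>I. \<Sum>X\<in>?S. c i * (w i X * class_char X x))" by (rule sum.swap)
  also have "\<dots> = (\<Sum>i\<in>I. c i * virtual_char (w i) x)"
  proof (rule sum.cong[OF refl])
    fix i assume i: "i \<in> I"
    have "virtual_char (w i) x = (\<Sum>X\<in>?S. w i X * class_char X x)"
      using i by (intro virtual_char_superset[OF S(1)]) auto
    thus "(\<Sum>X\<in>?S. c i * (w i X * class_char X x)) = c i * virtual_char (w i) x"
      by (simp add: sum_distrib_left)
  qed
  finally show "virtual_char (\<lambda>X. \<Sum>i\<in>I. c i * w i X) x = (\<Sum>i\<in>I. c i * virtual_char (w i) x)" .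
qed

lemma virtual_char_conj:
  assumes G: "group G" and v: "v \<in> rep_space G" and x: "x \<in> carrier G" and h: "h \<in> carrier G"
  shows "virtual_char v (inv\<^bsub>G\<^esub> h \<otimes>\<^bsub>G\<^esub> x \<otimes>\<^bsub>G\<^esub> h) = virtual_char v x"
  unfolding virtual_char_def
proof (rule sum.cong[OF refl])
  interpret group G by fact
  fix X assume "X \<in> {X. v X \<noteq> 0}"
  hence "X \<in> Irr G" using v by (auto simp: rep_space_def)
  hence \<rho>: "representation G (SOME \<rho>. \<rho> \<in> X)" by (rule some_rep_Irr[OF G])
  define \<rho> where "\<rho> = (SOME \<rho>. \<rho> \<in> X)"
  have r: "representation G \<rho>" using \<rho> by (simp add: \<rho>_def)
  note c = rep_carrier[OF G r]
  have "\<rho> (inv\<^bsub>G\<^esub> h \<otimes>\<^bsub>G\<^esub> x \<otimes>\<^bsub>G\<^esub> h) = \<rho> (inv\<^bsub>G\<^esub> h \<otimes>\<^bsub>G\<^esub> x) * \<rho> h"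
    using x h by (simp add: rep_mult[OF G r])
  hence "mat_trace (\<rho> (inv\<^bsub>G\<^esub> h \<otimes>\<^bsub>G\<^esub> x \<otimes>\<^bsub>G\<^esub> h)) = mat_trace (\<rho> h * \<rho> (inv\<^bsub>G\<^esub> h \<otimes>\<^bsub>G\<^esub> x))"
    using x h by (simp add: mat_trace_comm[OF c c])
  also have "\<rho> h * \<rho> (inv\<^bsub>G\<^esub> h \<otimes>\<^bsub>G\<^esub> x) = \<rho> (h \<otimes>\<^bsub>G\<^esub> (inv\<^bsub>G\<^esub> h \<otimes>\<^bsub>G\<^esub> x))"
    using x h by (simp add: rep_mult[OF G r])
  also have "h \<otimes>\<^bsub>G\<^esub> (inv\<^bsub>G\<^esub> h \<otimes>\<^bsub>G\<^esub> x) = x" using x h by (simp add: m_assoc[symmetric])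
  finally show "v X * class_char X (inv\<^bsub>G\<^esub> h \<otimes>\<^bsub>G\<^esub> x \<otimes>\<^bsub>G\<^esub> h) = v X * class_char X x"
    by (simp add: class_char_def \<rho>_def)
qed

lemma sum_list_mult_sum:
  fixes f :: "'b \<Rightarrow> 'c \<Rightarrow> 'd :: comm_semiring_1"
  shows "(\<Sum>g\<in>S. (\<Sum>s\<leftarrow>ss. f s g) * h g) = (\<Sum>s\<leftarrow>ss. \<Sum>g\<in>S. f s g * h g)"
  by (induction ss) (simp_all add: distrib_right sum.distrib)

lemma sum_count_list:
  fixes f :: "'b \<Rightarrow> 'c :: comm_semiring_1"
  assumes "finite S" "set xs \<subseteq> S"
  shows "(\<Sum>x\<in>S. of_nat (count_list xs x) * f x) = (\<Sum>x\<leftarrow>xs. f x)"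
  using assms(2)
proof (induction xs)
  case (Cons a xs)
  have "(\<Sum>x\<in>S. of_nat (count_list (a # xs) x) * f x) =
      (\<Sum>x\<in>S. (if x = a then f a else 0) + of_nat (count_list xs x) * f x)"
    by (intro sum.cong refl) (auto simp: distrib_right)
  thus ?case using Cons assms(1) by (simp add: sum.distrib)
qed simp

text \<open>The multiplicity of an irreducible constituent is a pairing of characters, so it does not
  depend on the decomposition.\<close>

lemma multiplicity_eq_char_pairing:
  assumes G: "group G" and \<rho>: "representation G \<rho>" and irr: "\<forall>\<sigma> \<in> set \<sigma>s. irreducible_rep G \<sigma>"
    and iso: "rep_iso G \<rho> (direct_sum_rep \<sigma>s)" and \<tau>: "irreducible_rep G \<tau>"
  shows "char_pairing G \<rho> \<tau> =
    of_nat (card (carrier G)) * of_nat (count_list (map (rep_class G) \<sigma>s) (rep_class G \<tau>))"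
proof -
  have reps: "\<forall>\<sigma> \<in> set \<sigma>s. representation G \<sigma>" using irr irreducible_repD(1) by blast
  note ds = direct_sum_rep[OF G reps]
  have "char_pairing G \<rho> \<tau> =
      (\<Sum>g\<in>carrier G. (\<Sum>\<sigma>\<leftarrow>\<sigma>s. mat_trace (\<sigma> g)) * mat_trace (\<tau> (inv\<^bsub>G\<^esub> g)))"
    unfolding char_pairing_def using ds rep_iso_trace[OF G \<rho> _ iso] by (intro sum.cong) auto
  also have "\<dots> = (\<Sum>\<sigma>\<leftarrow>\<sigma>s. char_pairing G \<sigma> \<tau>)"
    unfolding char_pairing_def by (rule sum_list_mult_sum)
  also have "\<dots> = of_nat (card (carrier G)) * of_nat (count_list (map (rep_class G) \<sigma>s) (rep_class G \<tau>))"
    using irr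
  proof (induction \<sigma>s)
    case (Cons \<sigma> \<sigma>s)
    hence \<sigma>: "irreducible_rep G \<sigma>" by simp
    note r = irreducible_repD(1)[OF \<sigma>] irreducible_repD(1)[OF \<tau>]
    have "char_pairing G \<sigma> \<tau> =
        (if rep_class G \<sigma> = rep_class G \<tau> then of_nat (card (carrier G)) else 0)"
    proof (cases "rep_class G \<sigma> = rep_class G \<tau>")
      case True
      hence "rep_iso G \<sigma> \<tau>" using rep_class_eq_iff[OF G r] by simp
      hence "char_pairing G \<sigma> \<tau> = char_pairing G \<tau> \<tau>"
        unfolding char_pairing_def using rep_iso_trace[OF G r] by (intro sum.cong) auto
      thus ?thesis using True char_pairing_self[OF G \<tau>] by simp
    next
      case False
      hence "\<not> rep_iso G \<tau> \<sigma>" using rep_class_eq_iff[OF G r(2,1)] by auto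
      thus ?thesis using False char_pairing_not_iso[OF G \<sigma> \<tau>] by simp
    qed
    thus ?case using Cons by (auto simp: algebra_simps)
  qed simp
  finally show ?thesis .
qed

text \<open>This makes the definite description in the definition of \<^const>\<open>rep_vector\<close> meaningful: complete
  reducibility gives existence, and the multiplicity formula gives uniqueness.\<close>

lemma rep_vector_eq:
  assumes G: "group G" and fin: "finite (carrier G)" and \<rho>: "representation G \<rho>"
  obtains \<sigma>s where "\<forall>\<sigma> \<in> set \<sigma>s. irreducible_rep G \<sigma>" "rep_iso G \<rho> (direct_sum_rep \<sigma>s)"
    "rep_vector G \<rho> = (\<lambda>X. of_nat (count_list (map (rep_class G) \<sigma>s) X))"
proof -
  obtain \<sigma>s where \<sigma>s: "\<forall>\<sigma> \<in> set \<sigma>s. irreducible_rep G \<sigma>" "rep_iso G \<rho> (direct_sum_rep \<sigma>s)"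
    using completely_reducible[OF G fin \<rho>] by blast
  let ?v = "\<lambda>\<sigma>s X. of_nat (count_list (map (rep_class G) \<sigma>s) X) :: complex"
  have unique: "?v \<tau>s = ?v \<sigma>s"
    if \<tau>s: "\<forall>\<sigma> \<in> set \<tau>s. irreducible_rep G \<sigma>" "rep_iso G \<rho> (direct_sum_rep \<tau>s)" for \<tau>s
  proof
    fix X
    interpret group G by fact
    have N: "of_nat (card (carrier G)) \<noteq> (0 :: complex)" using fin by auto
    show "?v \<tau>s X = ?v \<sigma>s X"
    proof (cases "X \<in> Irr G")
      case True
      then obtain \<tau> where \<tau>: "irreducible_rep G \<tau>" "X = rep_class G \<tau>" by (auto simp: Irr_def)
      show ?thesis
        using multiplicity_eq_char_pairing[OF G \<rho> \<tau>s \<tau>(1)]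
          multiplicity_eq_char_pairing[OF G \<rho> \<sigma>s \<tau>(1)] N \<tau>(2) by simp
    next
      case False
      hence "X \<notin> set (map (rep_class G) \<sigma>s)" "X \<notin> set (map (rep_class G) \<tau>s)"
        using \<sigma>s(1) \<tau>s(1) by (auto simp: Irr_def)
      thus ?thesis by simp
    qed
  qed
  have "rep_vector G \<rho> = ?v \<sigma>s"
    unfolding rep_vector_def by (rule the_equality) (use \<sigma>s unique in blast)+
  thus ?thesis using that \<sigma>s by blast
qed

text \<open>A representation and its vector have the same character, because traces add up over a direct sum.\<close>

lemma
  assumes G: "group G" and fin: "finite (carrier G)" and \<rho>: "representation G \<rho>"
  shows rep_vector_in_rep_space: "rep_vector G \<rho> \<in> rep_space G"
    and virtual_char_rep_vector:
      "x \<in> carrier G \<Longrightarrow> virtual_char (rep_vector G \<rho>) x = mat_trace (\<rho> x)"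
proof -
  obtain \<sigma>s where irr: "\<forall>\<sigma> \<in> set \<sigma>s. irreducible_rep G \<sigma>"
    and iso: "rep_iso G \<rho> (direct_sum_rep \<sigma>s)"
    and v: "rep_vector G \<rho> = (\<lambda>X. of_nat (count_list (map (rep_class G) \<sigma>s) X))"
    by (rule rep_vector_eq[OF assms])
  have reps: "\<forall>\<sigma> \<in> set \<sigma>s. representation G \<sigma>" using irr irreducible_repD(1) by blast
  let ?S = "set (map (rep_class G) \<sigma>s)"
  have sub: "{X. rep_vector G \<rho> X \<noteq> 0} \<subseteq> ?S" unfolding v by (auto simp: count_list_0_iff)
  have "?S \<subseteq> Irr G" using irr by (auto simp: Irr_def)
  thus "rep_vector G \<rho> \<in> rep_space G"
    using sub finite_subset[OF sub] by (auto simp: rep_space_def)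
  assume x: "x \<in> carrier G"
  have "virtual_char (rep_vector G \<rho>) x =
      (\<Sum>X\<in>?S. of_nat (count_list (map (rep_class G) \<sigma>s) X) * class_char X x)"
    using virtual_char_superset[OF _ sub] by (simp add: v)
  also have "\<dots> = (\<Sum>X\<leftarrow>map (rep_class G) \<sigma>s. class_char X x)" by (rule sum_count_list) auto
  also have "\<dots> = (\<Sum>\<sigma>\<leftarrow>\<sigma>s. class_char (rep_class G \<sigma>) x)" by (simp add: o_def)
  also have "\<dots> = (\<Sum>\<sigma>\<leftarrow>\<sigma>s. mat_trace (\<sigma> x))"
    using reps class_char_rep_class[OF G _ x] by (intro arg_cong[where f = sum_list] map_cong) auto
  also have "\<dots> = mat_trace (direct_sum_rep \<sigma>s x)" using direct_sum_rep[OF G reps] x by simp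
  also have "\<dots> = mat_trace (\<rho> x)"
    using rep_iso_trace[OF G \<rho> _ iso x] direct_sum_rep[OF G reps] by simp
  finally show "virtual_char (rep_vector G \<rho>) x = mat_trace (\<rho> x)" .
qed

lemma
  assumes v: "v \<in> rep_space K" and F: "\<And>X. X \<in> Irr K \<Longrightarrow> F X \<in> rep_space H"
  shows linear_extension_in_rep_space: "linear_extension F v \<in> rep_space H"
    and virtual_char_linear_extension:
      "virtual_char (linear_extension F v) x = (\<Sum>X | v X \<noteq> 0. v X * virtual_char (F X) x)"
proof -
  have fin: "finite {X. v X \<noteq> 0}" and sub: "{X. v X \<noteq> 0} \<subseteq> Irr K"
    using v by (auto simp: rep_space_def)
  have F': "F X \<in> rep_space H" if "X \<in> {X. v X \<noteq> 0}" for X using F sub that by blast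
  show "linear_extension F v \<in> rep_space H"
    "virtual_char (linear_extension F v) x = (\<Sum>X | v X \<noteq> 0. v X * virtual_char (F X) x)"
    unfolding linear_extension_def using rep_space_lincomb[of "{X. v X \<noteq> 0}" F H v, OF fin F'] by blast+
qed

definition trivial_vector :: "'a monoid \<Rightarrow> 'a rep set \<Rightarrow> complex" where
  "trivial_vector G = (\<lambda>X. if X = rep_class G (\<lambda>_. 1\<^sub>m 1) then 1 else 0)"

lemma trivial_rep:
  assumes G: "group G"
  shows "representation G (\<lambda>_. 1\<^sub>m 1)" "irreducible_rep G (\<lambda>_. 1\<^sub>m 1)"
proof -
  let ?\<rho> = "\<lambda>_ :: 'a. 1\<^sub>m 1 :: complex mat"
  show rep: "representation G ?\<rho>"
    by (rule representationI[OF G, of ?\<rho> 1]) auto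
  have d: "rep_dim G ?\<rho> = 1" by (simp add: rep_dim_def)
  show "irreducible_rep G ?\<rho>" unfolding irreducible_rep_def
  proof (intro conjI allI impI rep)
    show "0 < rep_dim G ?\<rho>" by (simp add: rep_dim_def)
    fix W assume inv: "invariant_subspace G ?\<rho> W"
    note W = inv[unfolded invariant_subspace_iff d]
    show "W = {0\<^sub>v (rep_dim G ?\<rho>)} \<or> W = carrier_vec (rep_dim G ?\<rho>)" unfolding d
    proof (cases "W \<subseteq> {0\<^sub>v 1}")
      case True
      thus "W = {0\<^sub>v 1} \<or> W = carrier_vec 1" using W by blast
    next
      case False
      then obtain w where w: "w \<in> W" "w \<noteq> 0\<^sub>v 1" by blast
      hence wc: "w \<in> carrier_vec 1" using W by blast
      have w0: "w $ 0 \<noteq> 0"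
      proof
        assume "w $ 0 = 0"
        hence "w = 0\<^sub>v 1" using wc by (intro eq_vecI) auto
        thus False using w(2) by simp
      qed
      have "v \<in> W" if v: "v \<in> carrier_vec 1" for v
      proof -
        have "v = (v $ 0 / w $ 0) \<cdot>\<^sub>v w" using v wc w0 by (intro eq_vecI) auto
        thus ?thesis using W w(1) by metis
      qed
      thus "W = {0\<^sub>v 1} \<or> W = carrier_vec 1" using W by blast
    qed
  qed
qed

lemma trivial_vector:
  assumes G: "group G"
  shows "trivial_vector G \<in> rep_space G"
    and "x \<in> carrier G \<Longrightarrow> virtual_char (trivial_vector G) x = 1"
proof -
  let ?X = "rep_class G (\<lambda>_. 1\<^sub>m 1)"
  have s: "{X. trivial_vector G X \<noteq> 0} = {?X}" by (auto simp: trivial_vector_def)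
  show "trivial_vector G \<in> rep_space G" unfolding rep_space_def
    using trivial_rep(2)[OF G] by (auto simp: s Irr_def)
  assume x: "x \<in> carrier G"
  show "virtual_char (trivial_vector G) x = 1" unfolding virtual_char_def s
    using class_char_rep_class[OF G trivial_rep(1)[OF G] x]
    by (simp add: trivial_vector_def mat_trace_one)
qed

section \<open>Restriction and induction on characters\<close>

text \<open>The operations of the subgroup agree with those of the big group on its carrier only. Products,
  inverses and the unit of the subgroup are therefore rewritten into those of the big group.\<close>

locale finite_subgroup = H: group H + K: group K for H :: "'a monoid" and K :: "'a monoid" +
  assumes finite_K: "finite (carrier K)" and incl: "(\<lambda>x. x) \<in> hom H K"
begin

lemma H_sub: "x \<in> carrier H \<Longrightarrow> x \<in> carrier K"
  using incl by (auto simp: hom_def)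

lemma H_mult: "x \<in> carrier H \<Longrightarrow> y \<in> carrier H \<Longrightarrow> x \<otimes>\<^bsub>H\<^esub> y = x \<otimes>\<^bsub>K\<^esub> y"
  using incl by (auto simp: hom_def)

lemma H_one: "\<one>\<^bsub>H\<^esub> = \<one>\<^bsub>K\<^esub>"
  using hom_one[OF incl H.group_axioms K.group_axioms] by simp

lemma H_inv: "x \<in> carrier H \<Longrightarrow> inv\<^bsub>H\<^esub> x = inv\<^bsub>K\<^esub> x"
  using K.inv_equality[of "inv\<^bsub>H\<^esub> x" x] H_mult[of "inv\<^bsub>H\<^esub> x" x] H_one H_sub by simp

lemma H_closed [simp]:
  "x \<in> carrier H \<Longrightarrow> y \<in> carrier H \<Longrightarrow> x \<otimes>\<^bsub>K\<^esub> y \<in> carrier H"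
  "x \<in> carrier H \<Longrightarrow> inv\<^bsub>K\<^esub> x \<in> carrier H"
  "\<one>\<^bsub>K\<^esub> \<in> carrier H"
  using H.m_closed[of x y] H.inv_closed[of x] H.one_closed by (simp_all add: H_mult H_inv H_one)

lemma finite_H: "finite (carrier H)"
  using finite_subset[OF _ finite_K] H_sub by blast

lemma card_H_pos: "card (carrier H) > 0"
  using finite_H H.one_closed card_gt_0_iff by blast

lemma H_cancel_left:
  assumes "x \<in> carrier H" "y \<in> carrier K"
  shows "x \<otimes>\<^bsub>K\<^esub> y \<in> carrier H \<longleftrightarrow> y \<in> carrier H"
proof
  assume "x \<otimes>\<^bsub>K\<^esub> y \<in> carrier H"
  hence "inv\<^bsub>K\<^esub> x \<otimes>\<^bsub>K\<^esub> (x \<otimes>\<^bsub>K\<^esub> y) \<in> carrier H" using assms by simp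
  thus "y \<in> carrier H" using assms H_sub by (simp add: K.m_assoc[symmetric])
qed (use assms in simp)

lemma H_cancel_right:
  assumes "x \<in> carrier H" "y \<in> carrier K"
  shows "y \<otimes>\<^bsub>K\<^esub> x \<in> carrier H \<longleftrightarrow> y \<in> carrier H"
proof
  assume "y \<otimes>\<^bsub>K\<^esub> x \<in> carrier H"
  hence "(y \<otimes>\<^bsub>K\<^esub> x) \<otimes>\<^bsub>K\<^esub> inv\<^bsub>K\<^esub> x \<in> carrier H" using assms by simp
  thus "y \<in> carrier H" using assms H_sub by (simp add: K.m_assoc)
qed (use assms in simp)

lemma left_transversal_exists: "\<exists>ts. left_transversal H K ts"
proof -
  \<comment> \<open>The left coset of \<open>x\<close>.\<close>
  define C where "C x = {y \<in> carrier K. inv\<^bsub>K\<^esub> x \<otimes>\<^bsub>K\<^esub> y \<in> carrier H}" for x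
  have C_eq: "C x = C y \<longleftrightarrow> inv\<^bsub>K\<^esub> x \<otimes>\<^bsub>K\<^esub> y \<in> carrier H" if x: "x \<in> carrier K" and y: "y \<in> carrier K" for x y
  proof
    assume "C x = C y"
    moreover have "y \<in> C y" using y by (simp add: C_def)
    ultimately show "inv\<^bsub>K\<^esub> x \<otimes>\<^bsub>K\<^esub> y \<in> carrier H" by (auto simp: C_def)
  next
    assume xy: "inv\<^bsub>K\<^esub> x \<otimes>\<^bsub>K\<^esub> y \<in> carrier H"
    have "inv\<^bsub>K\<^esub> x \<otimes>\<^bsub>K\<^esub> z \<in> carrier H \<longleftrightarrow> inv\<^bsub>K\<^esub> y \<otimes>\<^bsub>K\<^esub> z \<in> carrier H" if z: "z \<in> carrier K" for z
    proof -
      have "y \<otimes>\<^bsub>K\<^esub> (inv\<^bsub>K\<^esub> y \<otimes>\<^bsub>K\<^esub> z) = z" using y z by (simp add: K.m_assoc[symmetric])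
      hence "inv\<^bsub>K\<^esub> x \<otimes>\<^bsub>K\<^esub> z = (inv\<^bsub>K\<^esub> x \<otimes>\<^bsub>K\<^esub> y) \<otimes>\<^bsub>K\<^esub> (inv\<^bsub>K\<^esub> y \<otimes>\<^bsub>K\<^esub> z)"
        using x y z by (simp add: K.m_assoc)
      thus ?thesis using H_cancel_left[OF xy, of "inv\<^bsub>K\<^esub> y \<otimes>\<^bsub>K\<^esub> z"] y z by simp
    qed
    thus "C x = C y" by (auto simp: C_def)
  qed
  obtain cs where cs: "distinct cs" "set cs = C ` carrier K"
    using finite_distinct_list[of "C ` carrier K"] finite_K by auto
  define t where "t c = (SOME x. x \<in> carrier K \<and> C x = c)" for c
  have t: "t c \<in> carrier K \<and> C (t c) = c" if "c \<in> set cs" for c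
    unfolding t_def using that cs(2) by (intro someI_ex[of "\<lambda>x. x \<in> carrier K \<and> C x = c"]) auto
  have "\<exists>!i. i < length (map t cs) \<and> inv\<^bsub>K\<^esub> (map t cs ! i) \<otimes>\<^bsub>K\<^esub> x \<in> carrier H"
    if x: "x \<in> carrier K" for x
  proof -
    have iff: "inv\<^bsub>K\<^esub> (map t cs ! i) \<otimes>\<^bsub>K\<^esub> x \<in> carrier H \<longleftrightarrow> cs ! i = C x" if "i < length cs" for i
      using C_eq[of "t (cs ! i)" x] t[of "cs ! i"] that x by simp
    have "C x \<in> set cs" using x cs(2) by simp
    then obtain i where i: "i < length cs" "cs ! i = C x" by (auto simp: in_set_conv_nth)
    show ?thesis
    proof (rule ex1I[of _ i])
      show "i < length (map t cs) \<and> inv\<^bsub>K\<^esub> (map t cs ! i) \<otimes>\<^bsub>K\<^esub> x \<in> carrier H"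
        using i iff[OF i(1)] by simp
      fix j assume "j < length (map t cs) \<and> inv\<^bsub>K\<^esub> (map t cs ! j) \<otimes>\<^bsub>K\<^esub> x \<in> carrier H"
      hence j: "j < length cs" "inv\<^bsub>K\<^esub> (map t cs ! j) \<otimes>\<^bsub>K\<^esub> x \<in> carrier H" by auto
      hence "cs ! j = cs ! i" using iff[OF j(1)] i(2) by simp
      thus "j = i" using j i(1) cs(1) by (simp add: nth_eq_iff_index_eq)
    qed
  qed
  moreover have "set (map t cs) \<subseteq> carrier K" using t by auto
  ultimately have "left_transversal H K (map t cs)" unfolding left_transversal_def by simp
  thus ?thesis ..
qed

definition coset_reps :: "'a list" where
  "coset_reps = (SOME ts. left_transversal H K ts)"

lemma coset_reps: "left_transversal H K coset_reps"
  unfolding coset_reps_def using left_transversal_exists by (rule someI_ex)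

lemma coset_reps_closed: "i < length coset_reps \<Longrightarrow> coset_reps ! i \<in> carrier K"
  using coset_reps nth_mem unfolding left_transversal_def by blast

lemma coset_reps_unique:
  assumes "i < length coset_reps" "j < length coset_reps" "x \<in> carrier K"
    "inv\<^bsub>K\<^esub> (coset_reps ! i) \<otimes>\<^bsub>K\<^esub> x \<in> carrier H" "inv\<^bsub>K\<^esub> (coset_reps ! j) \<otimes>\<^bsub>K\<^esub> x \<in> carrier H"
  shows "i = j"
  using coset_reps assms unfolding left_transversal_def by blast

lemma coset_reps_ex:
  assumes "x \<in> carrier K"
  obtains i where "i < length coset_reps" "inv\<^bsub>K\<^esub> (coset_reps ! i) \<otimes>\<^bsub>K\<^esub> x \<in> carrier H"
  using coset_reps assms unfolding left_transversal_def by blast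

lemma coset_reps_bij:
  "bij_betw (\<lambda>(i, h). coset_reps ! i \<otimes>\<^bsub>K\<^esub> h) ({..<length coset_reps} \<times> carrier H) (carrier K)"
  unfolding bij_betw_def
proof
  let ?t = "\<lambda>i. coset_reps ! i"
  have cancel: "inv\<^bsub>K\<^esub> (?t i) \<otimes>\<^bsub>K\<^esub> (?t i \<otimes>\<^bsub>K\<^esub> h) = h" if "i < length coset_reps" "h \<in> carrier H" for i h
    using coset_reps_closed[OF that(1)] H_sub[OF that(2)] by (simp add: K.m_assoc[symmetric])
  show "inj_on (\<lambda>(i, h). ?t i \<otimes>\<^bsub>K\<^esub> h) ({..<length coset_reps} \<times> carrier H)"
  proof (rule inj_onI, clarsimp)
    fix i h j h'
    assume ij: "i < length coset_reps" "j < length coset_reps" and h: "h \<in> carrier H" "h' \<in> carrier H"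
      and eq: "?t i \<otimes>\<^bsub>K\<^esub> h = ?t j \<otimes>\<^bsub>K\<^esub> h'"
    have x: "?t i \<otimes>\<^bsub>K\<^esub> h \<in> carrier K" using coset_reps_closed[OF ij(1)] H_sub[OF h(1)] by simp
    have "inv\<^bsub>K\<^esub> (?t i) \<otimes>\<^bsub>K\<^esub> (?t i \<otimes>\<^bsub>K\<^esub> h) \<in> carrier H"
      "inv\<^bsub>K\<^esub> (?t j) \<otimes>\<^bsub>K\<^esub> (?t i \<otimes>\<^bsub>K\<^esub> h) \<in> carrier H"
      using cancel[OF ij(1) h(1)] cancel[OF ij(2) h(2)] h by (simp_all add: eq)
    hence "i = j" by (rule coset_reps_unique[OF ij x])
    thus "i = j \<and> h = h'" using eq cancel[OF ij(1) h(1)] cancel[OF ij(2) h(2)] by metis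
  qed
  show "(\<lambda>(i, h). ?t i \<otimes>\<^bsub>K\<^esub> h) ` ({..<length coset_reps} \<times> carrier H) = carrier K"
  proof (intro equalityI subsetI)
    fix x assume "x \<in> (\<lambda>(i, h). ?t i \<otimes>\<^bsub>K\<^esub> h) ` ({..<length coset_reps} \<times> carrier H)"
    thus "x \<in> carrier K" using coset_reps_closed H_sub by auto
  next
    fix x assume x: "x \<in> carrier K"
    then obtain i where i: "i < length coset_reps" "inv\<^bsub>K\<^esub> (?t i) \<otimes>\<^bsub>K\<^esub> x \<in> carrier H"
      by (rule coset_reps_ex)
    have "x = ?t i \<otimes>\<^bsub>K\<^esub> (inv\<^bsub>K\<^esub> (?t i) \<otimes>\<^bsub>K\<^esub> x)"
      using coset_reps_closed[OF i(1)] x by (simp add: K.m_assoc[symmetric])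
    thus "x \<in> (\<lambda>(i, h). ?t i \<otimes>\<^bsub>K\<^esub> h) ` ({..<length coset_reps} \<times> carrier H)"
      using i by (intro image_eqI[of _ _ "(i, inv\<^bsub>K\<^esub> (?t i) \<otimes>\<^bsub>K\<^esub> x)"]) auto
  qed
qed

end

lemma sum_div_mod:
  fixes F :: "nat \<Rightarrow> nat \<Rightarrow> 'b :: comm_monoid_add"
  shows "(\<Sum>s<n * d. F (s div d) (s mod d)) = (\<Sum>j<n. \<Sum>k<d. F j k)"
proof (induction n)
  case (Suc n)
  have "(\<Sum>s<n * d + m. F (s div d) (s mod d)) =
      (\<Sum>s<n * d. F (s div d) (s mod d)) + (\<Sum>k<m. F n k)" if "m \<le> d" for m
    using that
  proof (induction m)
    case (Suc m)
    hence "(n * d + m) div d = n" "(n * d + m) mod d = m" by auto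
    thus ?case using Suc by (simp add: add.assoc)
  qed simp
  from this[of d] show ?case using Suc.IH by (simp add: add.commute)
qed simp

context finite_subgroup
begin

text \<open>The blocks of the induced matrices are values of the representation extended by zero outside the
  subgroup; this extension is still multiplicative when the right factor lies in the subgroup.\<close>

definition zero_ext :: "'a rep \<Rightarrow> 'a rep" where
  "zero_ext \<rho> x = (if x \<in> carrier H then \<rho> x else 0\<^sub>m (rep_dim H \<rho>) (rep_dim H \<rho>))"

lemma zero_ext_carrier:
  "representation H \<rho> \<Longrightarrow> zero_ext \<rho> x \<in> carrier_mat (rep_dim H \<rho>) (rep_dim H \<rho>)"
  using rep_carrier[OF H.group_axioms, of \<rho> x] by (simp add: zero_ext_def)

lemma induced_rep_carrier:
  "induced_rep H K \<rho> g \<in>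
    carrier_mat (length coset_reps * rep_dim H \<rho>) (length coset_reps * rep_dim H \<rho>)"
  by (simp add: induced_rep_def Let_def coset_reps_def[symmetric])

lemma induced_rep_index:
  assumes "r < length coset_reps * rep_dim H \<rho>" "c < length coset_reps * rep_dim H \<rho>"
  shows "induced_rep H K \<rho> g $$ (r, c) =
    zero_ext \<rho> (inv\<^bsub>K\<^esub> (coset_reps ! (r div rep_dim H \<rho>)) \<otimes>\<^bsub>K\<^esub> g \<otimes>\<^bsub>K\<^esub> (coset_reps ! (c div rep_dim H \<rho>)))
      $$ (r mod rep_dim H \<rho>, c mod rep_dim H \<rho>)"
proof -
  have "rep_dim H \<rho> > 0" using assms(1) by (cases "rep_dim H \<rho>") auto
  hence "r mod rep_dim H \<rho> < rep_dim H \<rho>" "c mod rep_dim H \<rho> < rep_dim H \<rho>" by auto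
  thus ?thesis using assms
    by (simp add: induced_rep_def Let_def coset_reps_def[symmetric] zero_ext_def)
qed

lemma zero_ext_mult:
  assumes \<rho>: "representation H \<rho>" and x: "x \<in> carrier K" and y: "y \<in> carrier H"
  shows "zero_ext \<rho> x * zero_ext \<rho> y = zero_ext \<rho> (x \<otimes>\<^bsub>K\<^esub> y)"
proof (cases "x \<in> carrier H")
  case True
  thus ?thesis using y rep_mult[OF H.group_axioms \<rho> True y] by (simp add: zero_ext_def H_mult)
next
  case False
  hence "x \<otimes>\<^bsub>K\<^esub> y \<notin> carrier H" using H_cancel_right[OF y x] by simp
  thus ?thesis using False rep_carrier[OF H.group_axioms \<rho> y] y by (simp add: zero_ext_def)
qed

lemma induced_representation:
  assumes \<rho>: "representation H \<rho>"
  shows "representation K (induced_rep H K \<rho>)"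
proof -
  let ?d = "rep_dim H \<rho>" and ?n = "length coset_reps" and ?t = "\<lambda>i. coset_reps ! i"
  let ?z = "zero_ext \<rho>" and ?I = "induced_rep H K \<rho>"
  note zc = zero_ext_carrier[OF \<rho>] and Ic = induced_rep_carrier[of \<rho>]
  have idx: "r div ?d < ?n" "r mod ?d < ?d" if "r < ?n * ?d" for r
  proof -
    have "?d > 0" using that by (cases ?d) auto
    thus "r div ?d < ?n" "r mod ?d < ?d" using that by (auto simp: less_mult_imp_div_less)
  qed
  have mult: "?I (g \<otimes>\<^bsub>K\<^esub> h) = ?I g * ?I h" if g: "g \<in> carrier K" and h: "h \<in> carrier K" for g h
  proof (rule eq_matI)
    fix r c assume "r < dim_row (?I g * ?I h)" "c < dim_col (?I g * ?I h)"
    hence rc: "r < ?n * ?d" "c < ?n * ?d" using Ic[of g] Ic[of h] by auto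
    define i l where "i = r div ?d" and "l = c div ?d"
    have il: "i < ?n" "l < ?n" using idx rc by (auto simp: i_def l_def)
    note tK = coset_reps_closed
    let ?u = "\<lambda>j. inv\<^bsub>K\<^esub> (?t i) \<otimes>\<^bsub>K\<^esub> g \<otimes>\<^bsub>K\<^esub> ?t j" and ?w = "\<lambda>j. inv\<^bsub>K\<^esub> (?t j) \<otimes>\<^bsub>K\<^esub> h \<otimes>\<^bsub>K\<^esub> ?t l"
    \<comment> \<open>Only the block column of the coset containing \<open>h t\<^sub>l\<close> contributes to the product.\<close>
    obtain j0 where j0: "j0 < ?n" "inv\<^bsub>K\<^esub> (?t j0) \<otimes>\<^bsub>K\<^esub> (h \<otimes>\<^bsub>K\<^esub> ?t l) \<in> carrier H"
      using coset_reps_ex[of "h \<otimes>\<^bsub>K\<^esub> ?t l"] h tK[OF il(2)] by auto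
    have w0: "?w j0 \<in> carrier H" using j0 h tK[OF il(2)] tK[OF j0(1)] by (simp add: K.m_assoc)
    have wz: "?z (?w j) = 0\<^sub>m ?d ?d" if j: "j < ?n" "j \<noteq> j0" for j
    proof -
      have "inv\<^bsub>K\<^esub> (?t j) \<otimes>\<^bsub>K\<^esub> (h \<otimes>\<^bsub>K\<^esub> ?t l) \<notin> carrier H"
        using coset_reps_unique[OF j(1) j0(1), of "h \<otimes>\<^bsub>K\<^esub> ?t l"] j0 j h tK[OF il(2)] by auto
      thus ?thesis using h tK[OF il(2)] tK[OF j(1)] by (simp add: K.m_assoc zero_ext_def)
    qed
    have uK: "?u j0 \<in> carrier K" using g tK il(1) j0(1) by simp
    have uw: "?u j0 \<otimes>\<^bsub>K\<^esub> ?w j0 = inv\<^bsub>K\<^esub> (?t i) \<otimes>\<^bsub>K\<^esub> (g \<otimes>\<^bsub>K\<^esub> h) \<otimes>\<^bsub>K\<^esub> ?t l"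
    proof -
      have "?t j0 \<otimes>\<^bsub>K\<^esub> (inv\<^bsub>K\<^esub> (?t j0) \<otimes>\<^bsub>K\<^esub> (h \<otimes>\<^bsub>K\<^esub> ?t l)) = h \<otimes>\<^bsub>K\<^esub> ?t l"
        using h tK il j0(1) by (simp add: K.m_assoc[symmetric])
      thus ?thesis using g h tK il j0(1) by (simp add: K.m_assoc)
    qed
    have "(?I g * ?I h) $$ (r, c) = (\<Sum>s<?n * ?d. ?I g $$ (r, s) * ?I h $$ (s, c))"
      by (rule mat_mult_index_sum[OF Ic Ic rc])
    also have "\<dots> = (\<Sum>s<?n * ?d. ?z (?u (s div ?d)) $$ (r mod ?d, s mod ?d) *
        ?z (?w (s div ?d)) $$ (s mod ?d, c mod ?d))"
      using rc by (intro sum.cong refl) (simp add: induced_rep_index i_def l_def)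
    also have "\<dots> = (\<Sum>j<?n. \<Sum>k<?d. ?z (?u j) $$ (r mod ?d, k) * ?z (?w j) $$ (k, c mod ?d))"
      by (rule sum_div_mod)
    also have "\<dots> = (\<Sum>j<?n. if j = j0 then
        \<Sum>k<?d. ?z (?u j) $$ (r mod ?d, k) * ?z (?w j) $$ (k, c mod ?d) else 0)"
      using wz idx(2)[OF rc(2)] by (intro sum.cong refl) auto
    also have "\<dots> = (\<Sum>k<?d. ?z (?u j0) $$ (r mod ?d, k) * ?z (?w j0) $$ (k, c mod ?d))"
      using j0(1) by simp
    also have "\<dots> = (?z (?u j0) * ?z (?w j0)) $$ (r mod ?d, c mod ?d)"
      by (rule mat_mult_index_sum[OF zc zc idx(2)[OF rc(1)] idx(2)[OF rc(2)], symmetric])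
    also have "\<dots> = ?I (g \<otimes>\<^bsub>K\<^esub> h) $$ (r, c)"
      unfolding zero_ext_mult[OF \<rho> uK w0] uw
      using rc by (simp add: induced_rep_index i_def l_def)
    finally show "?I (g \<otimes>\<^bsub>K\<^esub> h) $$ (r, c) = (?I g * ?I h) $$ (r, c)" by simp
  qed (use Ic[of g] Ic[of h] Ic[of "g \<otimes>\<^bsub>K\<^esub> h"] in auto)
  have one: "?I \<one>\<^bsub>K\<^esub> = 1\<^sub>m (?n * ?d)"
  proof (rule eq_matI)
    fix r c assume "r < dim_row (1\<^sub>m (?n * ?d))" "c < dim_col (1\<^sub>m (?n * ?d))"
    hence rc: "r < ?n * ?d" "c < ?n * ?d" by auto
    define i l where "i = r div ?d" and "l = c div ?d"
    have il: "i < ?n" "l < ?n" using idx rc by (auto simp: i_def l_def)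
    note t = coset_reps_closed[OF il(1)] coset_reps_closed[OF il(2)]
    have eq: "?I \<one>\<^bsub>K\<^esub> $$ (r, c) = ?z (inv\<^bsub>K\<^esub> (?t i) \<otimes>\<^bsub>K\<^esub> ?t l) $$ (r mod ?d, c mod ?d)"
      using rc t by (simp add: induced_rep_index i_def l_def)
    show "?I \<one>\<^bsub>K\<^esub> $$ (r, c) = 1\<^sub>m (?n * ?d) $$ (r, c)"
    proof (cases "i = l")
      case True
      hence "?z (inv\<^bsub>K\<^esub> (?t i) \<otimes>\<^bsub>K\<^esub> ?t l) = 1\<^sub>m ?d"
        using t rep_one[OF H.group_axioms \<rho>] by (simp add: zero_ext_def H_one)
      moreover have "r = c \<longleftrightarrow> r mod ?d = c mod ?d"
        using True unfolding i_def l_def by (metis div_mult_mod_eq)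
      ultimately show ?thesis using eq rc idx(2)[OF rc(1)] idx(2)[OF rc(2)] by simp
    next
      case False
      have "inv\<^bsub>K\<^esub> (?t i) \<otimes>\<^bsub>K\<^esub> ?t l \<notin> carrier H"
        using coset_reps_unique[OF il t(2)] False t by auto
      thus ?thesis using eq rc idx(2)[OF rc(1)] idx(2)[OF rc(2)] False
        by (auto simp: zero_ext_def i_def l_def)
    qed
  qed (use Ic[of "\<one>\<^bsub>K\<^esub>"] in auto)
  show ?thesis
    using representationI(1)[of K ?I "?n * ?d"] K.group_axioms Ic mult one by blast
qed

lemma induced_rep_trace:
  assumes \<rho>: "representation H \<rho>"
  shows "mat_trace (induced_rep H K \<rho> x) =
    (\<Sum>i<length coset_reps. if inv\<^bsub>K\<^esub> (coset_reps ! i) \<otimes>\<^bsub>K\<^esub> x \<otimes>\<^bsub>K\<^esub> coset_reps ! i \<in> carrier H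
      then mat_trace (\<rho> (inv\<^bsub>K\<^esub> (coset_reps ! i) \<otimes>\<^bsub>K\<^esub> x \<otimes>\<^bsub>K\<^esub> coset_reps ! i)) else 0)"
proof -
  let ?d = "rep_dim H \<rho>" and ?n = "length coset_reps"
  let ?y = "\<lambda>i. inv\<^bsub>K\<^esub> (coset_reps ! i) \<otimes>\<^bsub>K\<^esub> x \<otimes>\<^bsub>K\<^esub> coset_reps ! i"
  have "mat_trace (induced_rep H K \<rho> x) = (\<Sum>s<?n * ?d. induced_rep H K \<rho> x $$ (s, s))"
    using induced_rep_carrier[of \<rho> x] by (simp add: mat_trace_def)
  also have "\<dots> = (\<Sum>s<?n * ?d. zero_ext \<rho> (?y (s div ?d)) $$ (s mod ?d, s mod ?d))"
    by (intro sum.cong refl) (simp add: induced_rep_index)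
  also have "\<dots> = (\<Sum>i<?n. \<Sum>k<?d. zero_ext \<rho> (?y i) $$ (k, k))" by (rule sum_div_mod)
  also have "\<dots> = (\<Sum>i<?n. if ?y i \<in> carrier H then mat_trace (\<rho> (?y i)) else 0)"
    using carrier_matD(1)[OF rep_carrier[OF H.group_axioms \<rho>]]
    by (intro sum.cong refl) (auto simp: zero_ext_def mat_trace_def)
  finally show ?thesis .
qed

end

text \<open>Frobenius's formula for the induced character, with the sum over all of \<open>K\<close>: it refers to no
  transversal and makes transitivity of induction a change of variables.\<close>

definition induced_fun :: "'a monoid \<Rightarrow> 'a monoid \<Rightarrow> ('a \<Rightarrow> complex) \<Rightarrow> 'a \<Rightarrow> complex" where
  "induced_fun H K \<phi> x = (\<Sum>g\<in>carrier K.
     if inv\<^bsub>K\<^esub> g \<otimes>\<^bsub>K\<^esub> x \<otimes>\<^bsub>K\<^esub> g \<in> carrier H then \<phi> (inv\<^bsub>K\<^esub> g \<otimes>\<^bsub>K\<^esub> x \<otimes>\<^bsub>K\<^esub> g) else 0) /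
     of_nat (card (carrier H))"

lemma induced_fun_cong:
  "(\<And>y. y \<in> carrier H \<Longrightarrow> \<phi> y = \<psi> y) \<Longrightarrow> induced_fun H K \<phi> x = induced_fun H K \<psi> x"
  unfolding induced_fun_def by (intro arg_cong2[where f = "(/)"] sum.cong refl) auto

context finite_subgroup
begin

text \<open>Summing over all of \<open>K\<close> instead of a transversal counts every coset once for each element of \<open>H\<close>.\<close>

lemma induced_fun_transversal:
  assumes x: "x \<in> carrier K"
    and \<phi>: "\<And>y h. y \<in> carrier H \<Longrightarrow> h \<in> carrier H \<Longrightarrow>
      \<phi> (inv\<^bsub>H\<^esub> h \<otimes>\<^bsub>H\<^esub> y \<otimes>\<^bsub>H\<^esub> h) = \<phi> y"
  shows "induced_fun H K \<phi> x =
    (\<Sum>i<length coset_reps. if inv\<^bsub>K\<^esub> (coset_reps ! i) \<otimes>\<^bsub>K\<^esub> x \<otimes>\<^bsub>K\<^esub> coset_reps ! i \<in> carrier H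
      then \<phi> (inv\<^bsub>K\<^esub> (coset_reps ! i) \<otimes>\<^bsub>K\<^esub> x \<otimes>\<^bsub>K\<^esub> coset_reps ! i) else 0)"
proof -
  let ?t = "\<lambda>i. coset_reps ! i" and ?n = "length coset_reps"
  define F where "F g = (if inv\<^bsub>K\<^esub> g \<otimes>\<^bsub>K\<^esub> x \<otimes>\<^bsub>K\<^esub> g \<in> carrier H
    then \<phi> (inv\<^bsub>K\<^esub> g \<otimes>\<^bsub>K\<^esub> x \<otimes>\<^bsub>K\<^esub> g) else 0)" for g
  have F: "F (?t i \<otimes>\<^bsub>K\<^esub> h) = F (?t i)" if i: "i < ?n" and h: "h \<in> carrier H" for i h
  proof -
    note t = coset_reps_closed[OF i] and hK = H_sub[OF h]
    define y where "y = inv\<^bsub>K\<^esub> (?t i) \<otimes>\<^bsub>K\<^esub> x \<otimes>\<^bsub>K\<^esub> ?t i"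
    have y: "y \<in> carrier K" using t x by (simp add: y_def)
    have eq: "inv\<^bsub>K\<^esub> (?t i \<otimes>\<^bsub>K\<^esub> h) \<otimes>\<^bsub>K\<^esub> x \<otimes>\<^bsub>K\<^esub> (?t i \<otimes>\<^bsub>K\<^esub> h) = inv\<^bsub>K\<^esub> h \<otimes>\<^bsub>K\<^esub> y \<otimes>\<^bsub>K\<^esub> h"
      using t hK x by (simp add: y_def K.inv_mult_group K.m_assoc)
    have iff: "inv\<^bsub>K\<^esub> h \<otimes>\<^bsub>K\<^esub> y \<otimes>\<^bsub>K\<^esub> h \<in> carrier H \<longleftrightarrow> y \<in> carrier H"
      using H_cancel_right[OF h, of "inv\<^bsub>K\<^esub> h \<otimes>\<^bsub>K\<^esub> y"] H_cancel_left[of "inv\<^bsub>K\<^esub> h" y] h hK y by simp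
    show ?thesis
    proof (cases "y \<in> carrier H")
      case True
      have "inv\<^bsub>K\<^esub> h \<otimes>\<^bsub>K\<^esub> y \<otimes>\<^bsub>K\<^esub> h = inv\<^bsub>H\<^esub> h \<otimes>\<^bsub>H\<^esub> y \<otimes>\<^bsub>H\<^esub> h"
        using True h by (simp add: H_mult H_inv)
      hence "\<phi> (inv\<^bsub>K\<^esub> h \<otimes>\<^bsub>K\<^esub> y \<otimes>\<^bsub>K\<^esub> h) = \<phi> y" using \<phi>[OF True h] by simp
      thus ?thesis unfolding F_def eq y_def[symmetric] using True iff by simp
    next
      case False
      thus ?thesis unfolding F_def eq y_def[symmetric] using iff by simp
    qed
  qed
  have "(\<Sum>g\<in>carrier K. F g) = (\<Sum>(i, h)\<in>{..<?n} \<times> carrier H. F (?t i \<otimes>\<^bsub>K\<^esub> h))"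
    using sum.reindex_bij_betw[OF coset_reps_bij, of F] by (simp add: case_prod_unfold)
  also have "\<dots> = (\<Sum>i<?n. \<Sum>h\<in>carrier H. F (?t i \<otimes>\<^bsub>K\<^esub> h))" by (rule sum.cartesian_product[symmetric])
  also have "\<dots> = (\<Sum>i<?n. of_nat (card (carrier H)) * F (?t i))" using F by simp
  also have "\<dots> = of_nat (card (carrier H)) * (\<Sum>i<?n. F (?t i))" by (rule sum_distrib_left[symmetric])
  finally show ?thesis using card_H_pos by (simp add: induced_fun_def F_def)
qed

lemma
  assumes v: "v \<in> rep_space K"
  shows Res_in_rep_space: "Res H K v \<in> rep_space H"
    and virtual_char_Res: "x \<in> carrier H \<Longrightarrow> virtual_char (Res H K v) x = virtual_char v x"
proof -
  have rep: "representation H (SOME \<rho>. \<rho> \<in> X)" if X: "X \<in> Irr K" for X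
  proof -
    note \<rho> = some_rep_Irr[OF K.group_axioms X]
    show ?thesis
      using rep_carrier[OF K.group_axioms \<rho>] rep_mult[OF K.group_axioms \<rho>] rep_one[OF K.group_axioms \<rho>]
      by (intro representationI(1)[OF H.group_axioms]) (auto simp: H_sub H_mult H_one)
  qed
  have F: "rep_vector H (SOME \<rho>. \<rho> \<in> X) \<in> rep_space H" if "X \<in> Irr K" for X
    by (rule rep_vector_in_rep_space[OF H.group_axioms finite_H rep[OF that]])
  show "Res H K v \<in> rep_space H"
    unfolding Res_def by (rule linear_extension_in_rep_space[OF v F])
  assume x: "x \<in> carrier H"
  have "virtual_char (Res H K v) x =
      (\<Sum>X | v X \<noteq> 0. v X * virtual_char (rep_vector H (SOME \<rho>. \<rho> \<in> X)) x)"
    unfolding Res_def by (rule virtual_char_linear_extension[OF v F])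
  also have "\<dots> = virtual_char v x" unfolding virtual_char_def[of v]
  proof (rule sum.cong[OF refl])
    fix X assume "X \<in> {X. v X \<noteq> 0}"
    hence "X \<in> Irr K" using v by (auto simp: rep_space_def)
    thus "v X * virtual_char (rep_vector H (SOME \<rho>. \<rho> \<in> X)) x = v X * class_char X x"
      using virtual_char_rep_vector[OF H.group_axioms finite_H rep x] by (simp add: class_char_def)
  qed
  finally show "virtual_char (Res H K v) x = virtual_char v x" .
qed

lemma
  assumes v: "v \<in> rep_space H"
  shows Ind_in_rep_space: "Ind H K v \<in> rep_space K"
    and virtual_char_Ind:
      "x \<in> carrier K \<Longrightarrow> virtual_char (Ind H K v) x = induced_fun H K (virtual_char v) x"
proof -
  note rep = some_rep_Irr[OF H.group_axioms]
  have F: "rep_vector K (induced_rep H K (SOME \<rho>. \<rho> \<in> X)) \<in> rep_space K" if "X \<in> Irr H" for X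
    by (rule rep_vector_in_rep_space[OF K.group_axioms finite_K induced_representation[OF rep[OF that]]])
  show "Ind H K v \<in> rep_space K"
    unfolding Ind_def by (rule linear_extension_in_rep_space[OF v F])
  assume x: "x \<in> carrier K"
  have "virtual_char (Ind H K v) x =
      (\<Sum>X | v X \<noteq> 0. v X * virtual_char (rep_vector K (induced_rep H K (SOME \<rho>. \<rho> \<in> X))) x)"
    unfolding Ind_def by (rule virtual_char_linear_extension[OF v F])
  also have "\<dots> = (\<Sum>X | v X \<noteq> 0. v X * mat_trace (induced_rep H K (SOME \<rho>. \<rho> \<in> X) x))"
  proof (rule sum.cong[OF refl])
    fix X assume "X \<in> {X. v X \<noteq> 0}"
    hence "X \<in> Irr H" using v by (auto simp: rep_space_def)
    thus "v X * virtual_char (rep_vector K (induced_rep H K (SOME \<rho>. \<rho> \<in> X))) x =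
        v X * mat_trace (induced_rep H K (SOME \<rho>. \<rho> \<in> X) x)"
      using virtual_char_rep_vector[OF K.group_axioms finite_K induced_representation[OF rep] x] by simp
  qed
  also have "\<dots> = (\<Sum>X | v X \<noteq> 0. v X *
      (\<Sum>i<length coset_reps. if inv\<^bsub>K\<^esub> (coset_reps ! i) \<otimes>\<^bsub>K\<^esub> x \<otimes>\<^bsub>K\<^esub> coset_reps ! i \<in> carrier H
        then class_char X (inv\<^bsub>K\<^esub> (coset_reps ! i) \<otimes>\<^bsub>K\<^esub> x \<otimes>\<^bsub>K\<^esub> coset_reps ! i) else 0))"
  proof (rule sum.cong[OF refl])
    fix X assume "X \<in> {X. v X \<noteq> 0}"
    hence "X \<in> Irr H" using v by (auto simp: rep_space_def)
    thus "v X * mat_trace (induced_rep H K (SOME \<rho>. \<rho> \<in> X) x) = v X *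
      (\<Sum>i<length coset_reps. if inv\<^bsub>K\<^esub> (coset_reps ! i) \<otimes>\<^bsub>K\<^esub> x \<otimes>\<^bsub>K\<^esub> coset_reps ! i \<in> carrier H
        then class_char X (inv\<^bsub>K\<^esub> (coset_reps ! i) \<otimes>\<^bsub>K\<^esub> x \<otimes>\<^bsub>K\<^esub> coset_reps ! i) else 0)"
      by (simp add: induced_rep_trace[OF rep] class_char_def cong: if_cong)
  qed
  also have "\<dots> = (\<Sum>i<length coset_reps. if inv\<^bsub>K\<^esub> (coset_reps ! i) \<otimes>\<^bsub>K\<^esub> x \<otimes>\<^bsub>K\<^esub> coset_reps ! i \<in> carrier H
        then virtual_char v (inv\<^bsub>K\<^esub> (coset_reps ! i) \<otimes>\<^bsub>K\<^esub> x \<otimes>\<^bsub>K\<^esub> coset_reps ! i) else 0)"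
    unfolding virtual_char_def sum_distrib_left
    by (subst sum.swap) (intro sum.cong refl, auto)
  also have "\<dots> = induced_fun H K (virtual_char v) x"
    by (rule induced_fun_transversal[OF x virtual_char_conj[OF H.group_axioms v], symmetric])
  finally show "virtual_char (Ind H K v) x = induced_fun H K (virtual_char v) x" .
qed

text \<open>On characters, \<open>Ind Res\<close> is multiplication by the permutation character on the cosets: the
  character of a vector is constant on conjugacy classes and leaves the sum in Frobenius's formula.\<close>

lemma virtual_char_Ind_Res:
  assumes v: "v \<in> rep_space K" and x: "x \<in> carrier K"
  shows "virtual_char (Ind H K (Res H K v)) x = induced_fun H K (\<lambda>_. 1) x * virtual_char v x"
proof -
  have "virtual_char (Ind H K (Res H K v)) x = induced_fun H K (virtual_char (Res H K v)) x"
    by (rule virtual_char_Ind[OF Res_in_rep_space[OF v] x])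
  also have "\<dots> = induced_fun H K (virtual_char v) x"
    by (rule induced_fun_cong) (rule virtual_char_Res[OF v])
  also have "\<dots> = induced_fun H K (\<lambda>_. 1) x * virtual_char v x"
  proof -
    have "(\<Sum>g\<in>carrier K. if inv\<^bsub>K\<^esub> g \<otimes>\<^bsub>K\<^esub> x \<otimes>\<^bsub>K\<^esub> g \<in> carrier H
          then virtual_char v (inv\<^bsub>K\<^esub> g \<otimes>\<^bsub>K\<^esub> x \<otimes>\<^bsub>K\<^esub> g) else 0) =
        (\<Sum>g\<in>carrier K. (if inv\<^bsub>K\<^esub> g \<otimes>\<^bsub>K\<^esub> x \<otimes>\<^bsub>K\<^esub> g \<in> carrier H then 1 else 0) * virtual_char v x)"
      by (intro sum.cong refl) (use virtual_char_conj[OF K.group_axioms v x] in auto)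
    thus ?thesis by (simp add: induced_fun_def sum_distrib_right)
  qed
  finally show ?thesis .
qed

end

text \<open>Transitivity of induction. Both sides sum over conjugates of \<open>x\<close>; on the left each conjugating
  element \<open>g k\<close> occurs once for every \<open>k\<close> in \<open>K\<close>.\<close>

lemma induced_fun_trans:
  assumes "finite_subgroup H K" "finite_subgroup K L" and x: "x \<in> carrier L"
  shows "induced_fun K L (induced_fun H K \<phi>) x = induced_fun H L \<phi> x"
proof -
  interpret HK: finite_subgroup H K by fact
  interpret KL: finite_subgroup K L by fact
  define \<psi> where "\<psi> y = (if inv\<^bsub>L\<^esub> y \<otimes>\<^bsub>L\<^esub> x \<otimes>\<^bsub>L\<^esub> y \<in> carrier H
    then \<phi> (inv\<^bsub>L\<^esub> y \<otimes>\<^bsub>L\<^esub> x \<otimes>\<^bsub>L\<^esub> y) else 0)" for y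
  have inner: "(if inv\<^bsub>L\<^esub> g \<otimes>\<^bsub>L\<^esub> x \<otimes>\<^bsub>L\<^esub> g \<in> carrier K
      then induced_fun H K \<phi> (inv\<^bsub>L\<^esub> g \<otimes>\<^bsub>L\<^esub> x \<otimes>\<^bsub>L\<^esub> g) else 0) =
      (\<Sum>k\<in>carrier K. \<psi> (g \<otimes>\<^bsub>L\<^esub> k)) / of_nat (card (carrier H))" if g: "g \<in> carrier L" for g
  proof -
    define y where "y = inv\<^bsub>L\<^esub> g \<otimes>\<^bsub>L\<^esub> x \<otimes>\<^bsub>L\<^esub> g"
    have y: "y \<in> carrier L" using g x by (simp add: y_def)
    have conj: "inv\<^bsub>L\<^esub> (g \<otimes>\<^bsub>L\<^esub> k) \<otimes>\<^bsub>L\<^esub> x \<otimes>\<^bsub>L\<^esub> (g \<otimes>\<^bsub>L\<^esub> k) = inv\<^bsub>L\<^esub> k \<otimes>\<^bsub>L\<^esub> y \<otimes>\<^bsub>L\<^esub> k"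
      if "k \<in> carrier K" for k
      using g x KL.H_sub[OF that] by (simp add: y_def KL.K.inv_mult_group KL.K.m_assoc)
    show ?thesis
    proof (cases "y \<in> carrier K")
      case True
      have "inv\<^bsub>K\<^esub> k \<otimes>\<^bsub>K\<^esub> y \<otimes>\<^bsub>K\<^esub> k = inv\<^bsub>L\<^esub> k \<otimes>\<^bsub>L\<^esub> y \<otimes>\<^bsub>L\<^esub> k" if "k \<in> carrier K" for k
        using True that by (simp add: KL.H_mult KL.H_inv)
      thus ?thesis unfolding y_def[symmetric] induced_fun_def using True
        by (auto simp: \<psi>_def conj intro!: sum.cong arg_cong2[where f = "(/)"])
    next
      case False
      have "\<psi> (g \<otimes>\<^bsub>L\<^esub> k) = 0" if k: "k \<in> carrier K" for k
      proof -
        have "inv\<^bsub>L\<^esub> k \<otimes>\<^bsub>L\<^esub> y \<otimes>\<^bsub>L\<^esub> k \<notin> carrier K"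
          using False KL.H_cancel_right[OF k, of "inv\<^bsub>L\<^esub> k \<otimes>\<^bsub>L\<^esub> y"]
            KL.H_cancel_left[of "inv\<^bsub>L\<^esub> k" y] k KL.H_sub[OF k] y by simp
        thus ?thesis using HK.H_sub by (auto simp: \<psi>_def conj[OF k])
      qed
      thus ?thesis unfolding y_def[symmetric] using False by simp
    qed
  qed
  have shift: "(\<Sum>g\<in>carrier L. \<psi> (g \<otimes>\<^bsub>L\<^esub> k)) = (\<Sum>g\<in>carrier L. \<psi> g)" if "k \<in> carrier K" for k
  proof -
    have k: "k \<in> carrier L" by (rule KL.H_sub[OF that])
    have "bij_betw (\<lambda>g. g \<otimes>\<^bsub>L\<^esub> k) (carrier L) (carrier L)"
      using k by (intro bij_betw_byWitness[where f' = "\<lambda>g. g \<otimes>\<^bsub>L\<^esub> inv\<^bsub>L\<^esub> k"])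
        (auto simp: KL.K.m_assoc)
    thus ?thesis by (rule sum.reindex_bij_betw)
  qed
  have "induced_fun K L (induced_fun H K \<phi>) x =
      (\<Sum>g\<in>carrier L. (\<Sum>k\<in>carrier K. \<psi> (g \<otimes>\<^bsub>L\<^esub> k)) / of_nat (card (carrier H))) /
        of_nat (card (carrier K))"
    unfolding induced_fun_def[of K L] using inner by simp
  also have "\<dots> = (\<Sum>g\<in>carrier L. \<Sum>k\<in>carrier K. \<psi> (g \<otimes>\<^bsub>L\<^esub> k)) / of_nat (card (carrier H)) /
        of_nat (card (carrier K))"
    by (simp only: sum_divide_distrib)
  also have "(\<Sum>g\<in>carrier L. \<Sum>k\<in>carrier K. \<psi> (g \<otimes>\<^bsub>L\<^esub> k)) = (\<Sum>k\<in>carrier K. \<Sum>g\<in>carrier L. \<psi> (g \<otimes>\<^bsub>L\<^esub> k))"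
    by (rule sum.swap)
  also have "\<dots> = of_nat (card (carrier K)) * (\<Sum>g\<in>carrier L. \<psi> g)" by (simp add: shift)
  finally show ?thesis using KL.card_H_pos by (simp add: induced_fun_def[of H L] \<psi>_def)
qed

section \<open>Fixed points on cosets\<close>

text \<open>The number of cosets of \<open>H\<close> in \<open>K\<close> fixed by \<open>x\<close>. The elements \<open>g\<close> with \<open>x g H = g H\<close> form a union of
  cosets, so the division is exact.\<close>

definition coset_fixpoints :: "'a monoid \<Rightarrow> 'a monoid \<Rightarrow> 'a \<Rightarrow> nat" where
  "coset_fixpoints H K x =
     card {g \<in> carrier K. inv\<^bsub>K\<^esub> g \<otimes>\<^bsub>K\<^esub> x \<otimes>\<^bsub>K\<^esub> g \<in> carrier H} div card (carrier H)"

context finite_subgroup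
begin

lemma coset_fixpoints_mult_card:
  assumes "x \<in> carrier K"
  shows "coset_fixpoints H K x * card (carrier H) =
    card {g \<in> carrier K. inv\<^bsub>K\<^esub> g \<otimes>\<^bsub>K\<^esub> x \<otimes>\<^bsub>K\<^esub> g \<in> carrier H}" (is "_ = card ?F")
proof -
  let ?P = "\<lambda>i. inv\<^bsub>K\<^esub> (coset_reps ! i) \<otimes>\<^bsub>K\<^esub> x \<otimes>\<^bsub>K\<^esub> coset_reps ! i \<in> carrier H"
  have "of_nat (card ?F) / of_nat (card (carrier H)) = induced_fun H K (\<lambda>_. 1) x"
    by (simp add: induced_fun_def sum.inter_filter[OF finite_K, symmetric])
  also have "\<dots> = (\<Sum>i<length coset_reps. if ?P i then 1 else 0)"
    by (rule induced_fun_transversal[OF assms]) simp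
  also have "\<dots> = of_nat (card {i \<in> {..<length coset_reps}. ?P i})"
    by (subst sum.inter_filter[symmetric]) simp_all
  finally have "complex_of_nat (card ?F) =
      of_nat (card {i \<in> {..<length coset_reps}. ?P i} * card (carrier H))"
    using card_H_pos by (simp add: field_simps)
  hence "card ?F = card {i \<in> {..<length coset_reps}. ?P i} * card (carrier H)"
    by (simp only: of_nat_eq_iff)
  hence "card (carrier H) dvd card ?F" by simp
  thus ?thesis by (simp add: coset_fixpoints_def)
qed

lemma induced_fun_one:
  assumes "x \<in> carrier K"
  shows "induced_fun H K (\<lambda>_. 1) x = of_nat (coset_fixpoints H K x)"
proof -
  have "induced_fun H K (\<lambda>_. 1) x =
      of_nat (card {g \<in> carrier K. inv\<^bsub>K\<^esub> g \<otimes>\<^bsub>K\<^esub> x \<otimes>\<^bsub>K\<^esub> g \<in> carrier H}) / of_nat (card (carrier H))"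
    by (simp add: induced_fun_def sum.inter_filter[OF finite_K, symmetric])
  thus ?thesis using card_H_pos
    unfolding coset_fixpoints_mult_card[OF assms, symmetric] by simp
qed

lemma coset_fixpoints_one: "coset_fixpoints H K \<one>\<^bsub>K\<^esub> * card (carrier H) = card (carrier K)"
proof -
  have "{g \<in> carrier K. inv\<^bsub>K\<^esub> g \<otimes>\<^bsub>K\<^esub> \<one>\<^bsub>K\<^esub> \<otimes>\<^bsub>K\<^esub> g \<in> carrier H} = carrier K" by auto
  thus ?thesis using coset_fixpoints_mult_card[OF K.one_closed] by simp
qed

lemma coset_fixpoints_eq_0_iff:
  assumes "x \<in> carrier K"
  shows "coset_fixpoints H K x = 0 \<longleftrightarrow> (\<forall>g \<in> carrier K. inv\<^bsub>K\<^esub> g \<otimes>\<^bsub>K\<^esub> x \<otimes>\<^bsub>K\<^esub> g \<notin> carrier H)"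
proof -
  have "coset_fixpoints H K x = 0 \<longleftrightarrow> card {g \<in> carrier K. inv\<^bsub>K\<^esub> g \<otimes>\<^bsub>K\<^esub> x \<otimes>\<^bsub>K\<^esub> g \<in> carrier H} = 0"
    using coset_fixpoints_mult_card[OF assms] card_H_pos by (metis mult_is_0 not_less_zero)
  thus ?thesis using finite_K by auto
qed

lemma coset_fixpoints_pos:
  assumes "x \<in> carrier H"
  shows "coset_fixpoints H K x \<noteq> 0"
proof -
  have "inv\<^bsub>K\<^esub> \<one>\<^bsub>K\<^esub> \<otimes>\<^bsub>K\<^esub> x \<otimes>\<^bsub>K\<^esub> \<one>\<^bsub>K\<^esub> \<in> carrier H" using assms H_sub[OF assms] by simp
  hence "\<not> (\<forall>g \<in> carrier K. inv\<^bsub>K\<^esub> g \<otimes>\<^bsub>K\<^esub> x \<otimes>\<^bsub>K\<^esub> g \<notin> carrier H)"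
    using K.one_closed by blast
  thus ?thesis unfolding coset_fixpoints_eq_0_iff[OF H_sub[OF assms]] .
qed

lemma coset_fixpoints_le: "coset_fixpoints H K x \<le> coset_fixpoints H K \<one>\<^bsub>K\<^esub>"
proof -
  have "{g \<in> carrier K. inv\<^bsub>K\<^esub> g \<otimes>\<^bsub>K\<^esub> \<one>\<^bsub>K\<^esub> \<otimes>\<^bsub>K\<^esub> g \<in> carrier H} = carrier K" by auto
  thus ?thesis unfolding coset_fixpoints_def
    using finite_K by (auto intro!: div_le_mono card_mono)
qed

text \<open>Jordan's theorem: a proper subgroup has a coset action with a derangement. On average, an
  element fixes one coset, and the identity fixes more than one.\<close>

lemma ex_coset_fixpoints_eq_0:
  assumes "carrier H \<noteq> carrier K"
  shows "\<exists>x \<in> carrier K. coset_fixpoints H K x = 0"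
proof (rule ccontr)
  assume "\<not> (\<exists>x \<in> carrier K. coset_fixpoints H K x = 0)"
  hence pos: "coset_fixpoints H K x \<ge> 1" if "x \<in> carrier K" for x
    using that by (metis One_nat_def Suc_leI gr0I)
  let ?h = "card (carrier H)"
  have less: "?h < card (carrier K)"
    using assms H_sub finite_K by (intro psubset_card_mono) auto
  have orbit: "card {x \<in> carrier K. inv\<^bsub>K\<^esub> g \<otimes>\<^bsub>K\<^esub> x \<otimes>\<^bsub>K\<^esub> g \<in> carrier H} = ?h" if g: "g \<in> carrier K" for g
  proof -
    have a: "inv\<^bsub>K\<^esub> g \<otimes>\<^bsub>K\<^esub> (g \<otimes>\<^bsub>K\<^esub> y \<otimes>\<^bsub>K\<^esub> inv\<^bsub>K\<^esub> g) \<otimes>\<^bsub>K\<^esub> g = y" if "y \<in> carrier K" for y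
    proof -
      have "inv\<^bsub>K\<^esub> g \<otimes>\<^bsub>K\<^esub> (g \<otimes>\<^bsub>K\<^esub> y \<otimes>\<^bsub>K\<^esub> inv\<^bsub>K\<^esub> g) \<otimes>\<^bsub>K\<^esub> g = (inv\<^bsub>K\<^esub> g \<otimes>\<^bsub>K\<^esub> g) \<otimes>\<^bsub>K\<^esub> y \<otimes>\<^bsub>K\<^esub> (inv\<^bsub>K\<^esub> g \<otimes>\<^bsub>K\<^esub> g)"
        using g that by (simp only: K.m_assoc K.m_closed K.inv_closed)
      thus ?thesis using g that by simp
    qed
    have b: "g \<otimes>\<^bsub>K\<^esub> (inv\<^bsub>K\<^esub> g \<otimes>\<^bsub>K\<^esub> y \<otimes>\<^bsub>K\<^esub> g) \<otimes>\<^bsub>K\<^esub> inv\<^bsub>K\<^esub> g = y" if "y \<in> carrier K" for y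
    proof -
      have "g \<otimes>\<^bsub>K\<^esub> (inv\<^bsub>K\<^esub> g \<otimes>\<^bsub>K\<^esub> y \<otimes>\<^bsub>K\<^esub> g) \<otimes>\<^bsub>K\<^esub> inv\<^bsub>K\<^esub> g = (g \<otimes>\<^bsub>K\<^esub> inv\<^bsub>K\<^esub> g) \<otimes>\<^bsub>K\<^esub> y \<otimes>\<^bsub>K\<^esub> (g \<otimes>\<^bsub>K\<^esub> inv\<^bsub>K\<^esub> g)"
        using g that by (simp only: K.m_assoc K.m_closed K.inv_closed)
      thus ?thesis using g that by simp
    qed
    have "bij_betw (\<lambda>x. inv\<^bsub>K\<^esub> g \<otimes>\<^bsub>K\<^esub> x \<otimes>\<^bsub>K\<^esub> g)
        {x \<in> carrier K. inv\<^bsub>K\<^esub> g \<otimes>\<^bsub>K\<^esub> x \<otimes>\<^bsub>K\<^esub> g \<in> carrier H} (carrier H)"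
      using a b g H_sub
      by (intro bij_betw_byWitness[where f' = "\<lambda>y. g \<otimes>\<^bsub>K\<^esub> y \<otimes>\<^bsub>K\<^esub> inv\<^bsub>K\<^esub> g"]) auto
    thus ?thesis by (rule bij_betw_same_card)
  qed
  have "(\<Sum>x\<in>carrier K. coset_fixpoints H K x) * ?h =
      (\<Sum>x\<in>carrier K. card {g \<in> carrier K. inv\<^bsub>K\<^esub> g \<otimes>\<^bsub>K\<^esub> x \<otimes>\<^bsub>K\<^esub> g \<in> carrier H})"
    by (simp add: sum_distrib_right coset_fixpoints_mult_card)
  also have "\<dots> = (\<Sum>g\<in>carrier K. card {x \<in> carrier K. inv\<^bsub>K\<^esub> g \<otimes>\<^bsub>K\<^esub> x \<otimes>\<^bsub>K\<^esub> g \<in> carrier H})"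
    by (rule sum_multicount_gen[OF finite_K finite_K]) simp
  also have "\<dots> = card (carrier K) * ?h" by (simp add: orbit)
  finally have total: "(\<Sum>x\<in>carrier K. coset_fixpoints H K x) = card (carrier K)"
    using card_H_pos by simp
  have "coset_fixpoints H K \<one>\<^bsub>K\<^esub> > 1"
    using coset_fixpoints_one less card_H_pos by (metis less_irrefl linorder_neqE_nat mult_1 less_one mult_0 not_less_zero)
  hence "(\<Sum>x\<in>carrier K. 1) < (\<Sum>x\<in>carrier K. coset_fixpoints H K x)"
    using pos K.one_closed by (intro sum_strict_mono_ex1[OF finite_K]) auto
  thus False using total by simp
qed

end

section \<open>Chains of groups\<close>

lemma chain_subgroup:
  assumes G: "group_chain G" and "m \<le> n"
  shows "finite_subgroup (G m) (G n)"
proof -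
  have grp: "group (G n)" "finite (carrier (G n))" for n using G by (auto simp: group_chain_def)
  have "(\<lambda>x. x) \<in> hom (G m) (G n)" using \<open>m \<le> n\<close>
  proof (induction n rule: dec_induct)
    case base
    show ?case by (auto simp: hom_def)
  next
    case (step k)
    have "(\<lambda>x. x) \<in> hom (G k) (G (Suc k))" using G by (auto simp: group_chain_def dest: spec[of _ "Suc k"])
    thus ?case using step.IH by (auto simp: hom_def Pi_iff)
  qed
  thus ?thesis using grp by (simp add: finite_subgroup_def finite_subgroup_axioms_def)
qed

lemma Res_pow_char:
  assumes G: "group_chain G" and "l \<le> n" and v: "v \<in> rep_space (G n)"
  shows "Res_pow G n l v \<in> rep_space (G (n - l)) \<and>
    (\<forall>x \<in> carrier (G (n - l)). virtual_char (Res_pow G n l v) x = virtual_char v x)"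
  using \<open>l \<le> n\<close>
proof (induction l)
  case (Suc l)
  interpret finite_subgroup "G (n - Suc l)" "G (n - l)" by (rule chain_subgroup[OF G]) simp
  show ?case using Suc Res_in_rep_space virtual_char_Res H_sub by simp
qed (use v in simp)

lemma Ind_pow_char:
  assumes G: "group_chain G" and "l \<le> n" and w: "w \<in> rep_space (G (n - l))"
  shows "Ind_pow G n l w \<in> rep_space (G n) \<and>
    (\<forall>x \<in> carrier (G n). virtual_char (Ind_pow G n l w) x =
       induced_fun (G (n - l)) (G n) (virtual_char w) x)"
  using assms(2,3)
proof (induction l arbitrary: w)
  case 0
  interpret finite_subgroup "G n" "G n" by (rule chain_subgroup[OF G]) simp
  have "virtual_char w x = induced_fun (G n) (G n) (virtual_char w) x" if "x \<in> carrier (G n)" for x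
  proof -
    have "induced_fun (G n) (G n) (virtual_char w) x =
        (\<Sum>g\<in>carrier (G n). virtual_char w x) / of_nat (card (carrier (G n)))"
      unfolding induced_fun_def using 0 that virtual_char_conj[OF H.group_axioms, of w x]
      by (intro arg_cong2[where f = "(/)"] sum.cong refl) auto
    thus ?thesis using card_H_pos by simp
  qed
  thus ?case using 0 by simp
next
  case (Suc l)
  interpret finite_subgroup "G (n - Suc l)" "G (n - l)" by (rule chain_subgroup[OF G]) simp
  have u: "Ind (G (n - Suc l)) (G (n - l)) w \<in> rep_space (G (n - l))"
    using Suc.prems by (intro Ind_in_rep_space) auto
  note IH = Suc.IH[OF _ u]
  have "virtual_char (Ind_pow G n l (Ind (G (n - Suc l)) (G (n - l)) w)) x =
      induced_fun (G (n - Suc l)) (G n) (virtual_char w) x" if x: "x \<in> carrier (G n)" for x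
  proof -
    have "virtual_char (Ind_pow G n l (Ind (G (n - Suc l)) (G (n - l)) w)) x =
        induced_fun (G (n - l)) (G n) (virtual_char (Ind (G (n - Suc l)) (G (n - l)) w)) x"
      using IH Suc.prems x by simp
    also have "\<dots> = induced_fun (G (n - l)) (G n)
        (induced_fun (G (n - Suc l)) (G (n - l)) (virtual_char w)) x"
      by (rule induced_fun_cong, rule virtual_char_Ind) (use Suc.prems in auto)
    also have "\<dots> = induced_fun (G (n - Suc l)) (G n) (virtual_char w) x"
      by (rule induced_fun_trans[OF finite_subgroup_axioms chain_subgroup[OF G] x]) simp
    finally show ?thesis .
  qed
  thus ?case using IH Suc.prems by simp
qed

text \<open>The polynomial identity, evaluated on the trivial representation. Its character is constantly one,
  so at \<open>x\<close> the operators become the numbers of fixed points of \<open>x\<close> on the respective coset spaces.\<close>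

lemma property_star_fixpoints:
  assumes G: "group_chain G" and star: "property_star G f" and l: "1 \<le> l" "l \<le> n"
    and x: "x \<in> carrier (G n)"
  shows "poly (f l) (of_nat (coset_fixpoints (G (n - 1)) (G n) x)) =
    of_nat (coset_fixpoints (G (n - l)) (G n) x)"
proof -
  interpret finite_subgroup "G (n - 1)" "G n" by (rule chain_subgroup[OF G]) simp
  define e where "e = trivial_vector (G n)"
  have e: "e \<in> rep_space (G n)" and e1: "virtual_char e y = 1" if "y \<in> carrier (G n)" for y
    unfolding e_def using trivial_vector[OF K.group_axioms] that by auto
  hence e: "e \<in> rep_space (G n)" using x by blast
  define T where "T = Ind (G (n - 1)) (G n) \<circ> Res (G (n - 1)) (G n)"
  let ?\<pi> = "coset_fixpoints (G (n - 1)) (G n) x"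
  have T: "(T ^^ i) e \<in> rep_space (G n) \<and> virtual_char ((T ^^ i) e) x = of_nat ?\<pi> ^ i" for i
  proof (induction i)
    case 0
    show ?case using e e1[OF x] by simp
  next
    case (Suc i)
    thus ?case using Ind_in_rep_space[OF Res_in_rep_space] virtual_char_Ind_Res[OF _ x]
      by (simp add: T_def induced_fun_one[OF x] del: One_nat_def)
  qed
  have "poly_operator (f l) T e = (\<lambda>X. \<Sum>i\<in>{..degree (f l)}. of_rat (coeff (f l) i) * (T ^^ i) e X)"
    by (simp add: poly_operator_def fun_eq_iff)
  hence "virtual_char (poly_operator (f l) T e) x =
      (\<Sum>i\<le>degree (f l). of_rat (coeff (f l) i) * of_nat ?\<pi> ^ i)"
    using rep_space_lincomb(2)[of "{..degree (f l)}" "\<lambda>i. (T ^^ i) e" "G n"] T by simp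
  also have "\<dots> = of_rat (poly (f l) (of_nat ?\<pi>))"
    by (simp add: poly_altdef of_rat_sum of_rat_mult of_rat_power)
  finally have 1: "virtual_char (poly_operator (f l) T e) x = of_rat (poly (f l) (of_nat ?\<pi>))" .
  note R = Res_pow_char[OF G l(2) e]
  interpret l: finite_subgroup "G (n - l)" "G n" by (rule chain_subgroup[OF G]) simp
  have "virtual_char (Ind_pow G n l (Res_pow G n l e)) x =
      induced_fun (G (n - l)) (G n) (virtual_char (Res_pow G n l e)) x"
    using Ind_pow_char[OF G l(2)] R x by blast
  also have "\<dots> = induced_fun (G (n - l)) (G n) (\<lambda>_. 1) x"
    by (rule induced_fun_cong) (use R e1 l.H_sub in auto)
  also have "\<dots> = of_nat (coset_fixpoints (G (n - l)) (G n) x)" by (rule l.induced_fun_one[OF x])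
  finally have 2: "virtual_char (Ind_pow G n l (Res_pow G n l e)) x =
    of_nat (coset_fixpoints (G (n - l)) (G n) x)" .
  have "Ind_pow G n l (Res_pow G n l e) = poly_operator (f l) T e"
    using star l e unfolding property_star_def T_def by blast
  hence "(of_rat (poly (f l) (of_nat ?\<pi>)) :: complex) =
      of_rat (of_nat (coset_fixpoints (G (n - l)) (G n) x))"
    using 1 2 by simp
  thus ?thesis by (simp only: of_rat_eq_iff)
qed

lemma lift_virtual_char:
  assumes G: "surjective_chain G" and "m \<le> n" and v: "v \<in> rep_space (G m)"
  shows "\<exists>w \<in> rep_space (G n). \<forall>x \<in> carrier (G m). virtual_char w x = virtual_char v x"
  using \<open>m \<le> n\<close>
proof (induction n rule: dec_induct)
  case base
  show ?case using v by blast
next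
  case (step k)
  have chain: "group_chain G" using G by (simp add: surjective_chain_def)
  interpret finite_subgroup "G k" "G (Suc k)" by (rule chain_subgroup[OF chain]) simp
  obtain w where w: "w \<in> rep_space (G k)" "\<forall>x \<in> carrier (G m). virtual_char w x = virtual_char v x"
    using step.IH by blast
  have "Res (G k) (G (Suc k)) ` rep_space (G (Suc k)) = rep_space (G k)"
    using G by (auto simp: surjective_chain_def dest!: spec[of _ "Suc k"])
  then obtain u where u: "u \<in> rep_space (G (Suc k))" "Res (G k) (G (Suc k)) u = w"
    using w(1) by (metis imageE)
  have "carrier (G m) \<subseteq> carrier (G k)"
    using finite_subgroup.H_sub[OF chain_subgroup[OF chain step.hyps(1)]] by blast
  hence "virtual_char u x = virtual_char v x" if "x \<in> carrier (G m)" for x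
    using virtual_char_Res[OF u(1)] u(2) w(2) that by (metis subsetD)
  thus ?case using u(1) by blast
qed

text \<open>Surjectivity of restriction forbids new fusion: the permutation character on
  \<^term>\<open>G (Suc m)\<close> modulo \<^term>\<open>G m\<close> separates an element without fixed coset from the elements of
  \<^term>\<open>G m\<close>, and it extends to a virtual character of every larger group of the chain.\<close>

lemma coset_fixpoints_eq_0_mono:
  assumes G: "surjective_chain G" and x: "x \<in> carrier (G (Suc m))"
    and zero: "coset_fixpoints (G m) (G (Suc m)) x = 0" and n: "Suc m \<le> n"
  shows "coset_fixpoints (G m) (G n) x = 0"
proof (rule ccontr)
  assume nz: "coset_fixpoints (G m) (G n) x \<noteq> 0"
  have chain: "group_chain G" using G by (simp add: surjective_chain_def)
  interpret finite_subgroup "G m" "G (Suc m)" by (rule chain_subgroup[OF chain]) simp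
  interpret mn: finite_subgroup "G m" "G n" by (rule chain_subgroup[OF chain]) (use n in simp)
  interpret big: finite_subgroup "G (Suc m)" "G n" by (rule chain_subgroup[OF chain n])
  have xn: "x \<in> carrier (G n)" by (rule big.H_sub[OF x])
  obtain g where g: "g \<in> carrier (G n)" and "inv\<^bsub>G n\<^esub> g \<otimes>\<^bsub>G n\<^esub> x \<otimes>\<^bsub>G n\<^esub> g \<in> carrier (G m)"
    using nz unfolding mn.coset_fixpoints_eq_0_iff[OF xn] by auto
  moreover define y where "y = inv\<^bsub>G n\<^esub> g \<otimes>\<^bsub>G n\<^esub> x \<otimes>\<^bsub>G n\<^esub> g"
  ultimately have y: "y \<in> carrier (G m)" by simp
  define v where "v = Ind (G m) (G (Suc m)) (trivial_vector (G m))"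
  note t = trivial_vector[OF H.group_axioms]
  have v: "v \<in> rep_space (G (Suc m))" unfolding v_def by (rule Ind_in_rep_space[OF t(1)])
  have vchar: "virtual_char v z = of_nat (coset_fixpoints (G m) (G (Suc m)) z)"
    if z: "z \<in> carrier (G (Suc m))" for z
  proof -
    have "virtual_char v z = induced_fun (G m) (G (Suc m)) (virtual_char (trivial_vector (G m))) z"
      unfolding v_def by (rule virtual_char_Ind[OF t(1) z])
    also have "\<dots> = induced_fun (G m) (G (Suc m)) (\<lambda>_. 1) z"
      by (rule induced_fun_cong) (rule t(2))
    finally show ?thesis by (simp add: induced_fun_one[OF z])
  qed
  obtain w where w: "w \<in> rep_space (G n)"
    "\<And>z. z \<in> carrier (G (Suc m)) \<Longrightarrow> virtual_char w z = virtual_char v z"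
    using lift_virtual_char[OF G n v] by blast
  have "of_nat (coset_fixpoints (G m) (G (Suc m)) y) = virtual_char w y"
    using w(2) vchar H_sub[OF y] by simp
  also have "\<dots> = virtual_char w x"
    unfolding y_def by (rule virtual_char_conj[OF mn.K.group_axioms w(1) xn g])
  also have "\<dots> = 0" using w(2)[OF x] vchar[OF x] zero by simp
  finally show False using coset_fixpoints_pos[OF y] by simp
qed

text \<open>The identity fixes all cosets, so this is the index of each group in the next one, as a natural
  number and as a value of the permutation character.\<close>

definition chain_index :: "(nat \<Rightarrow> 'a monoid) \<Rightarrow> nat \<Rightarrow> nat" where
  "chain_index G n = coset_fixpoints (G (n - 1)) (G n) \<one>\<^bsub>G n\<^esub>"

lemma chain_index:
  assumes G: "group_chain G"
  shows "chain_index G n * card (carrier (G (n - 1))) = card (carrier (G n))" "chain_index G n > 0"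
    "order_ratio G n = of_nat (chain_index G n)"
proof -
  interpret finite_subgroup "G (n - 1)" "G n" by (rule chain_subgroup[OF G]) simp
  show 1: "chain_index G n * card (carrier (G (n - 1))) = card (carrier (G n))"
    unfolding chain_index_def by (rule coset_fixpoints_one)
  show "chain_index G n > 0"
    unfolding chain_index_def using coset_fixpoints_pos[OF H_closed(3)] by simp
  show "order_ratio G n = of_nat (chain_index G n)"
    using card_H_pos unfolding order_ratio_def Coset.order_def 1[symmetric] by simp
qed

lemma chain_index_prod:
  assumes G: "group_chain G" and "l \<le> n"
  shows "coset_fixpoints (G (n - l)) (G n) \<one>\<^bsub>G n\<^esub> = (\<Prod>i<l. chain_index G (n - i))"
proof -
  interpret finite_subgroup "G (n - l)" "G n" by (rule chain_subgroup[OF G]) simp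
  have "(\<Prod>i<l. chain_index G (n - i)) * card (carrier (G (n - l))) = card (carrier (G n))"
    using \<open>l \<le> n\<close>
  proof (induction l)
    case (Suc l)
    have "chain_index G (n - l) * card (carrier (G (n - Suc l))) = card (carrier (G (n - l)))"
      using chain_index(1)[OF G, of "n - l"] by simp
    thus ?case using Suc by (simp add: mult.assoc)
  qed simp
  hence "(\<Prod>i<l. chain_index G (n - i)) * card (carrier (G (n - l))) =
      coset_fixpoints (G (n - l)) (G n) \<one>\<^bsub>G n\<^esub> * card (carrier (G (n - l)))"
    by (simp add: coset_fixpoints_one)
  thus ?thesis using card_H_pos by simp
qed

lemma constant_chainI:
  assumes G: "group_chain G" and eq: "\<And>n. carrier (G (Suc n)) = carrier (G n)"
  shows "constant_chain G"
  unfolding constant_chain_def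
proof (intro exI conjI allI)
  show "group (G 0)" using G by (simp add: group_chain_def)
  fix n
  show c: "carrier (G n) = carrier (G 0)" by (induction n) (simp_all add: eq)
  interpret finite_subgroup "G 0" "G n" by (rule chain_subgroup[OF G]) simp
  show "(\<lambda>x. x) \<in> hom (G n) (G 0)" using c H_mult by (auto simp: hom_def)
qed

text \<open>An element \<open>x\<close> that first appears in \<^term>\<open>G (Suc m)\<close> and fixes no coset of \<^term>\<open>G m\<close> has
  fixed point numbers \<open>c i\<close> further up the chain. By \<open>property_star_fixpoints\<close>, \<open>c i\<close> is a root of
  \<^term>\<open>f (Suc i)\<close> but no later \<open>c j\<close> is, so these natural numbers are distinct. They are bounded by
  the indices of the chain, which therefore take infinitely many values.\<close>

lemma infinite_chain_index:
  assumes G: "surjective_chain G" and nonconst: "\<not> constant_chain G" and star: "property_star G f"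
  shows "infinite (chain_index G ` {1..})"
proof
  assume fin: "finite (chain_index G ` {1..})"
  have chain: "group_chain G" using G by (simp add: surjective_chain_def)
  obtain m where m: "carrier (G (Suc m)) \<noteq> carrier (G m)"
    using nonconst constant_chainI[OF chain] by blast
  interpret finite_subgroup "G m" "G (Suc m)" by (rule chain_subgroup[OF chain]) simp
  obtain x where x: "x \<in> carrier (G (Suc m))" and x0: "coset_fixpoints (G m) (G (Suc m)) x = 0"
    using ex_coset_fixpoints_eq_0 m by auto
  have x_up: "x \<in> carrier (G n)" if "Suc m \<le> n" for n
    by (rule finite_subgroup.H_sub[OF chain_subgroup[OF chain that] x])
  define c where "c i = coset_fixpoints (G (m + i)) (G (Suc (m + i))) x" for i
  have f_c: "poly (f l) (of_nat (c i)) = of_nat (coset_fixpoints (G (Suc (m + i) - l)) (G (Suc (m + i))) x)"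
    if "1 \<le> l" "l \<le> Suc (m + i)" for i l
    using property_star_fixpoints[OF chain star that x_up] by (simp add: c_def)
  have "c i \<noteq> c j" if "i < j" for i j
  proof
    assume "c i = c j"
    have "poly (f (Suc i)) (of_nat (c i)) = 0"
      using f_c[of "Suc i" i] coset_fixpoints_eq_0_mono[OF G x x0, of "Suc (m + i)"] by simp
    moreover have "poly (f (Suc i)) (of_nat (c j)) \<noteq> 0"
    proof -
      have s: "finite_subgroup (G (Suc (m + j) - Suc i)) (G (Suc (m + j)))"
        by (rule chain_subgroup[OF chain]) simp
      have "x \<in> carrier (G (Suc (m + j) - Suc i))" by (rule x_up) (use that in simp)
      hence "coset_fixpoints (G (Suc (m + j) - Suc i)) (G (Suc (m + j))) x \<noteq> 0"
        by (rule finite_subgroup.coset_fixpoints_pos[OF s])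
      thus ?thesis using f_c[of "Suc i" j] that by simp
    qed
    ultimately show False using \<open>c i = c j\<close> by simp
  qed
  hence "inj c" by (metis injI linorder_neqE_nat)
  moreover have "finite (range c)"
  proof (rule finite_subset)
    show "range c \<subseteq> (\<Union>a \<in> chain_index G ` {1..}. {..a})"
    proof
      fix z assume "z \<in> range c"
      then obtain i where i: "z = c i" by blast
      interpret i: finite_subgroup "G (m + i)" "G (Suc (m + i))" by (rule chain_subgroup[OF chain]) simp
      have "c i \<le> chain_index G (Suc (m + i))"
        unfolding c_def chain_index_def using i.coset_fixpoints_le by simp
      thus "z \<in> (\<Union>a \<in> chain_index G ` {1..}. {..a})" using i by force
    qed
    show "finite (\<Union>a \<in> chain_index G ` {1..}. {..a})" using fin by blast
  qed
  ultimately show False using range_inj_infinite by blast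
qed

text \<open>A step of the chain that is not trivial has an element without fixed cosets; it is not conjugate
  into the group two steps below either, so the identity for \<open>l = 2\<close> reads \<open>f 2 (0) = 0\<close>
  there. Infinitely many indices guarantee such a step above \<^term>\<open>G 1\<close>.\<close>

lemma poly_star_two_zero:
  assumes G: "group_chain G" and star: "property_star G f"
    and inf: "infinite (chain_index G ` {1..})"
  shows "poly (f 2) 0 = 0"
proof -
  obtain n where n: "n \<ge> 2" "chain_index G n \<noteq> 1"
  proof (rule ccontr)
    assume "\<not> thesis"
    hence "chain_index G n = 1" if "n \<ge> 2" for n using that \<open>\<And>n. 2 \<le> n \<Longrightarrow> chain_index G n \<noteq> 1 \<Longrightarrow> thesis\<close> by blast
    hence "chain_index G n \<in> {1, chain_index G 1}" if "n \<ge> 1" for n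
      using that by (cases "n = 1") auto
    hence "chain_index G ` {1..} \<subseteq> {1, chain_index G 1}" by auto
    thus False using inf finite_subset by blast
  qed
  interpret finite_subgroup "G (n - 1)" "G n" by (rule chain_subgroup[OF G]) simp
  interpret two: finite_subgroup "G (n - 2)" "G n" by (rule chain_subgroup[OF G]) simp
  interpret low: finite_subgroup "G (n - 2)" "G (n - 1)" by (rule chain_subgroup[OF G]) simp
  have "carrier (G (n - 1)) \<noteq> carrier (G n)"
  proof
    assume "carrier (G (n - 1)) = carrier (G n)"
    hence "chain_index G n * card (carrier (G n)) = card (carrier (G n))"
      using chain_index(1)[OF G, of n] by simp
    thus False using n(2) card_H_pos \<open>carrier (G (n - 1)) = carrier (G n)\<close> by simp
  qed
  then obtain x where x: "x \<in> carrier (G n)" and x0: "coset_fixpoints (G (n - 1)) (G n) x = 0"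
    using ex_coset_fixpoints_eq_0 by blast
  have "coset_fixpoints (G (n - 2)) (G n) x = 0"
    using x0 low.H_sub
    unfolding coset_fixpoints_eq_0_iff[OF x] two.coset_fixpoints_eq_0_iff[OF x] by auto
  thus ?thesis using property_star_fixpoints[OF G star _ n(1) x] x0 by simp
qed

section \<open>The recurrence for the indices and the polynomials\<close>

lemma poly_of_rat: "poly (map_poly of_rat p) (of_rat x) = (of_rat (poly p x) :: real)"
  by (induction p) (simp_all add: map_poly_pCons of_rat_add of_rat_mult)

lemma rat_poly_eventually_pos:
  fixes p :: "rat poly"
  assumes "lead_coeff p > 0"
  shows "\<exists>T. \<forall>k::nat. T \<le> k \<longrightarrow> poly p (of_nat k) > 0"
proof -
  let ?q = "map_poly of_rat p :: real poly"
  have lc: "lead_coeff ?q > 0"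
    using assms by (simp add: coeff_map_poly degree_map_poly)
  obtain T where T: "\<And>x. T \<le> x \<Longrightarrow> lead_coeff ?q \<le> poly ?q x"
    using poly_pinfty_gt_lc[OF lc] by blast
  have "poly p (of_nat k) > 0" if k: "nat \<lceil>T\<rceil> \<le> k" for k
  proof -
    have "T \<le> of_rat (of_nat k)" using k by (simp add: nat_le_iff ceiling_le_iff)
    hence "lead_coeff ?q \<le> poly ?q (of_rat (of_nat k))" by (rule T)
    with lc have "0 < poly ?q (of_rat (of_nat k))" by (rule less_le_trans)
    thus ?thesis unfolding poly_of_rat by simp
  qed
  thus ?thesis by blast
qed

text \<open>A polynomial that maps each term of an unbounded sequence of natural numbers to the preceding
  one is linear with positive slope: otherwise the sequence would be constant, or large terms would be preceded
  by negative or by larger ones.\<close>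

lemma backward_step_linear:
  fixes a :: "nat \<Rightarrow> nat" and g :: "rat poly"
  assumes inf: "infinite (a ` {1..})"
    and step: "\<And>n. n \<ge> 2 \<Longrightarrow> poly g (of_nat (a n)) = of_nat (a (n - 1))"
  obtains b c where "g = [:c, b:]" "b > 0"
proof -
  have unbounded: "\<exists>n\<ge>2. T \<le> a n" for T
  proof (rule ccontr)
    assume "\<not> (\<exists>n\<ge>2. T \<le> a n)"
    hence "a n < T" if "n \<ge> 2" for n using that by (metis not_le)
    hence "a n \<in> insert (a 1) {..T}" if "n \<ge> 1" for n
      using that by (cases "n = 1") (auto simp: less_imp_le)
    hence "a ` {1..} \<subseteq> insert (a 1) {..T}" by auto
    thus False using inf finite_subset by blast
  qed
  have pos: "lead_coeff g > 0"
  proof (rule ccontr)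
    assume "\<not> lead_coeff g > 0"
    moreover have "g \<noteq> 0"
    proof
      assume "g = 0"
      hence "a n = 0" if "n \<ge> 1" for n using step[of "Suc n"] that by simp
      thus False using unbounded[of 1] by force
    qed
    ultimately have "lead_coeff (- g) > 0"
      by (metis degree_minus coeff_minus leading_coeff_0_iff neg_0_less_iff_less linorder_neqE_linordered_idom)
    then obtain T where T: "\<And>k. T \<le> k \<Longrightarrow> poly (- g) (of_nat k) > 0"
      using rat_poly_eventually_pos by blast
    obtain n where "n \<ge> 2" "T \<le> a n" using unbounded by blast
    thus False using T[of "a n"] step[of n] by simp
  qed
  have "degree g \<noteq> 0"
  proof
    assume "degree g = 0"
    then obtain c where c: "g = [:c:]" by (metis degree_eq_zeroE)
    have "a ` {1..} \<subseteq> {a 1}"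
    proof (rule image_subsetI)
      fix n :: nat assume "n \<in> {1..}"
      hence "(of_nat (a n) :: rat) = of_nat (a 1)" using step[of "Suc n"] step[of 2] c by simp
      thus "a n \<in> {a 1}" by (simp only: of_nat_eq_iff singleton_iff)
    qed
    thus False using inf finite_subset by blast
  qed
  moreover have "\<not> degree g \<ge> 2"
  proof
    assume deg: "degree g \<ge> 2"
    have "degree (g - [:0, 1:]) = degree g" "lead_coeff (g - [:0, 1:]) = lead_coeff g"
    proof -
      have "degree [:0, 1 :: rat:] < degree g" using deg by simp
      thus d: "degree (g - [:0, 1:]) = degree g"
        by (metis degree_add_eq_left degree_minus diff_conv_add_uminus)
      show "lead_coeff (g - [:0, 1:]) = lead_coeff g"
        unfolding d using \<open>degree [:0, 1 :: rat:] < degree g\<close> by (simp add: coeff_eq_0)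
    qed
    then obtain T where T: "\<And>k. T \<le> k \<Longrightarrow> poly (g - [:0, 1:]) (of_nat k) > 0"
      using rat_poly_eventually_pos[of "g - [:0, 1:]"] pos by auto
    have le: "a n \<le> a 1" if "n \<ge> 1" "T \<le> a n" for n
      using that
    proof (induction n rule: dec_induct)
      case (step k)
      have "poly g (of_nat (a (Suc k))) = of_nat (a k)" using assms(2)[of "Suc k"] step.hyps by simp
      hence "a (Suc k) < a k" using T[OF step.prems] by simp
      thus ?case using step.IH step.prems by simp
    qed simp
    obtain n where "n \<ge> 2" "max T (Suc (a 1)) \<le> a n" using unbounded by blast
    thus False using le[of n] by simp
  qed
  ultimately have deg: "degree g = 1" by simp
  have "g = [:coeff g 0, coeff g 1:]"
    by (rule poly_eqI) (use deg in \<open>auto simp: coeff_pCons coeff_eq_0 split: nat.split\<close>)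
  thus ?thesis using that pos deg by metis
qed

text \<open>The powers of the denominator of \<open>B\<close> all divide the fixed nonzero integer \<open>d\<close>.\<close>

lemma rat_power_mult_int_imp_int:
  fixes B :: rat and d :: int
  assumes "d \<noteq> 0" and int: "\<And>k. B ^ k * of_int d \<in> \<int>"
  shows "B \<in> \<int>"
proof -
  obtain p q where pq: "quotient_of B = (p, q)" by fastforce
  have q: "q > 0" and cop: "coprime p q" and B: "B = of_int p / of_int q"
    using quotient_of_denom_pos[OF pq] quotient_of_coprime[OF pq] quotient_of_div[OF pq] by auto
  have dvd: "q ^ k dvd d" for k
  proof -
    obtain z where "B ^ k * of_int d = of_int z" using int[of k] by (elim Ints_cases)
    hence "of_int (p ^ k * d) = (of_int (z * q ^ k) :: rat)"
      using q by (simp add: B power_divide field_simps)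
    hence "p ^ k * d = z * q ^ k" by (simp only: of_int_eq_iff)
    hence "q ^ k dvd p ^ k * d" by simp
    moreover have "coprime (q ^ k) (p ^ k)" using cop by (simp add: coprime_commute)
    ultimately show ?thesis by (simp add: coprime_dvd_mult_right_iff)
  qed
  have "q = 1"
  proof (rule ccontr)
    assume "q \<noteq> 1"
    hence q2: "q \<ge> 2" using q by simp
    have "nat \<bar>d\<bar> < 2 ^ nat \<bar>d\<bar>" by (rule less_exp)
    hence "int (nat \<bar>d\<bar>) < int (2 ^ nat \<bar>d\<bar>)" by (simp only: of_nat_less_iff)
    hence "\<bar>d\<bar> < 2 ^ nat \<bar>d\<bar>" by simp
    also have "\<dots> \<le> q ^ nat \<bar>d\<bar>" using q2 by (intro power_mono) auto
    also have "\<dots> \<le> \<bar>d\<bar>" using dvd_imp_le_int[OF assms(1) dvd] q by simp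
    finally show False by simp
  qed
  thus ?thesis by (simp add: B)
qed

text \<open>Since \<open>p\<close> vanishes at zero, \<open>p / X\<close> is a polynomial that maps each term to the preceding one, hence
  linear, and inverting it gives the recurrence with rational \<open>B\<close> and \<open>C\<close>. Consecutive differences are
  integers that get multiplied by \<open>B\<close> in each step, which forces \<open>B\<close> to be an integer.\<close>

lemma affine_recurrence_of_star:
  fixes a :: "nat \<Rightarrow> nat" and p :: "rat poly"
  assumes inf: "infinite (a ` {1..})" and pos: "\<And>n. a n > 0"
    and p: "\<And>n. n \<ge> 2 \<Longrightarrow> poly p (of_nat (a n)) = of_nat (a n) * of_nat (a (n - 1))"
    and p0: "poly p 0 = 0"
  shows "\<exists>(B::nat) (C::int). B > 0 \<and>
    (\<forall>n\<ge>2. (of_nat (a n) :: rat) = of_nat B * of_nat (a (n - 1)) + of_int C)"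
proof -
  obtain g where g: "p = [:0, 1:] * g" using p0 by (auto simp: poly_eq_0_iff_dvd elim: dvdE)
  have step: "poly g (of_nat (a n)) = of_nat (a (n - 1))" if "n \<ge> 2" for n
    using p[OF that] pos[of n] by (simp add: g)
  obtain b c where bc: "g = [:c, b:]" "b > 0" using backward_step_linear[OF inf step] by blast
  define B where "B = 1 / b"
  define C where "C = - c / b"
  have rec: "of_nat (a n) = B * of_nat (a (n - 1)) + C" if "n \<ge> 2" for n
    using step[OF that] bc by (simp add: B_def C_def field_simps)
  define d where "d = int (a 2) - int (a 1)"
  have diff: "of_nat (a (k + 2)) - of_nat (a (k + 1)) = B ^ k * of_int d" for k
  proof (induction k)
    case 0
    show ?case by (simp add: d_def numeral_2_eq_2)
  next
    case (Suc k)
    have "of_nat (a (Suc k + 2)) - of_nat (a (Suc k + 1)) =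
        B * (of_nat (a (k + 2)) - of_nat (a (k + 1)))"
      using rec[of "k + 3"] rec[of "k + 2"] by (simp add: algebra_simps numeral_eq_Suc)
    thus ?case by (simp only: Suc.IH power_Suc mult.assoc)
  qed
  have "d \<noteq> 0"
  proof
    assume "d = 0"
    hence eq: "a (k + 2) = a (k + 1)" for k using diff[of k] by simp
    have const: "a (Suc k) = a 1" for k
    proof (induction k)
      case (Suc k)
      thus ?case using eq[of k] by simp
    qed simp
    have "a ` {1..} \<subseteq> {a 1}"
    proof (rule image_subsetI)
      fix n :: nat assume "n \<in> {1..}"
      hence "Suc (n - 1) = n" by simp
      thus "a n \<in> {a 1}" using const[of "n - 1"] by (simp only: singleton_iff)
    qed
    thus False using inf finite_subset by blast
  qed
  moreover have "B ^ k * of_int d \<in> \<int>" for k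
    unfolding diff[symmetric] by (intro Ints_diff Ints_of_nat)
  ultimately have "B \<in> \<int>" by (rule rat_power_mult_int_imp_int)
  then obtain B' where B': "B = of_int B'" by (elim Ints_cases)
  have "B > 0" using bc(2) by (simp add: B_def)
  hence B'_pos: "B' > 0" by (simp add: B')
  have "C = of_int (int (a 2) - B' * int (a 1))"
    using rec[of 2] by (simp add: B' numeral_2_eq_2)
  thus ?thesis using rec B'_pos
    by (intro exI[of _ "nat B'"] exI[of _ "int (a 2) - B' * int (a 1)"]) (simp add: B')
qed

lemma prod_power_lessThan:
  fixes B :: "'b :: comm_semiring_1"
  shows "(\<Prod>i<l. B ^ i) = B ^ (l * (l - 1) div 2)"
proof -
  have "(\<Prod>i<l. B ^ i) = B ^ (\<Sum>i<l. i)" by (simp add: power_sum)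
  also have "(\<Sum>i<l. i) = l * (l - 1) div 2"
    using Sum_Ico_nat[of 0 l] by (simp add: lessThan_atLeast0)
  finally show ?thesis .
qed

text \<open>Solving the recurrence backwards expresses the product of \<open>l\<close> consecutive terms as a
  polynomial in the last one. The terms take infinitely many values, which determine the polynomial.\<close>

lemma polynomial_of_affine_recurrence:
  fixes a :: "nat \<Rightarrow> nat" and p :: "rat poly" and B :: nat and C :: int
  assumes inf: "infinite (a ` {1..})" and B: "B > 0"
    and rec: "\<And>n. n \<ge> 2 \<Longrightarrow> (of_nat (a n) :: rat) = of_nat B * of_nat (a (n - 1)) + of_int C"
    and p: "\<And>n. n \<ge> l \<Longrightarrow> poly p (of_nat (a n)) = (\<Prod>i<l. of_nat (a (n - i)))"
  shows "p = Polynomial.smult (1 / of_nat B ^ (l * (l - 1) div 2))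
    (\<Prod>j<l. [:- (of_int C * (\<Sum>i<j. of_nat B ^ i)), 1:])" (is "p = ?q")
proof -
  define S :: "nat \<Rightarrow> rat" where "S j = of_int C * (\<Sum>i<j. of_nat B ^ i)" for j
  have solved: "of_nat B ^ i * of_nat (a (n - i)) = of_nat (a n) - S i" if "i < n" for i n
    using that
  proof (induction i)
    case (Suc i)
    have "of_nat (a (n - i)) = of_nat B * of_nat (a (n - Suc i)) + (of_int C :: rat)"
      using rec[of "n - i"] Suc.prems by simp
    hence "of_nat B ^ i * (of_nat B * of_nat (a (n - Suc i)) + (of_int C :: rat)) = of_nat (a n) - S i"
      using Suc by simp
    thus ?case by (simp add: S_def algebra_simps)
  qed (simp add: S_def)
  have "poly p (of_nat (a n)) = poly ?q (of_nat (a n))" if n: "n \<ge> l" for n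
  proof -
    have "(\<Prod>i<l. of_nat B ^ i) * (\<Prod>i<l. of_nat (a (n - i))) = (\<Prod>i<l. of_nat (a n) - S i)"
      unfolding prod.distrib[symmetric] using solved n by (intro prod.cong) auto
    hence "of_nat B ^ (l * (l - 1) div 2) * poly p (of_nat (a n)) = (\<Prod>i<l. of_nat (a n) - S i)"
      using p[OF n] by (simp add: prod_power_lessThan)
    thus ?thesis using B by (simp add: poly_prod S_def field_simps)
  qed
  hence "of_nat ` a ` {l..} \<subseteq> {x. poly (p - ?q) x = 0}" by auto
  moreover have "infinite ((of_nat :: nat \<Rightarrow> rat) ` a ` {l..})"
  proof -
    have "a ` {1..} \<subseteq> a ` {..l} \<union> a ` {l..}" by force
    hence "infinite (a ` {l..})" using inf finite_subset by (metis finite_UnI finite_atMost finite_imageI)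
    moreover have "inj_on (of_nat :: nat \<Rightarrow> rat) (a ` {l..})" by (simp add: inj_on_def)
    ultimately show ?thesis using finite_imageD by blast
  qed
  ultimately have "infinite {x. poly (p - ?q) x = 0}" using finite_subset by blast
  hence "p - ?q = 0" using poly_roots_finite by blast
  thus ?thesis by simp
qed

theorem theorem1p2:
  fixes G :: "nat \<Rightarrow> 'a monoid" and f :: "nat \<Rightarrow> rat poly"
  assumes "surjective_chain G"
    and "\<not> constant_chain G"
    and "property_star G f"
  shows "infinite {order_ratio G n | n. n \<ge> 1}
    \<and> (\<exists>(B::nat) (C::int). B > 0 \<and>
         (\<forall>n\<ge>2. order_ratio G n = of_nat B * order_ratio G (n - 1) + of_int C))
    \<and> (\<forall>(B::nat) (C::int). B > 0 \<and>
         (\<forall>n\<ge>2. order_ratio G n = of_nat B * order_ratio G (n - 1) + of_int C) \<longrightarrow>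
         (\<forall>l\<ge>1. f l = Polynomial.smult (1 / of_nat B ^ (l * (l - 1) div 2))
            (\<Prod>j<l. [:- (of_int C * (\<Sum>i<j. of_nat B ^ i)), 1:])))"
proof -
  have chain: "group_chain G" using assms(1) by (simp add: surjective_chain_def)
  let ?a = "chain_index G"
  note ratio = chain_index(3)[OF chain]
  have inf: "infinite (?a ` {1..})" by (rule infinite_chain_index[OF assms])
  have star: "poly (f l) (of_nat (?a n)) = (\<Prod>i<l. of_nat (?a (n - i)))" if "1 \<le> l" "l \<le> n" for l n
  proof -
    interpret finite_subgroup "G n" "G n" by (rule chain_subgroup[OF chain]) simp
    show ?thesis
      using property_star_fixpoints[OF chain assms(3) that H.one_closed] chain_index_prod[OF chain that(2)]
      by (simp add: chain_index_def)
  qed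
  have "{order_ratio G n | n. n \<ge> 1} = of_nat ` ?a ` {1..}" by (auto simp: ratio)
  moreover have "inj_on (of_nat :: nat \<Rightarrow> rat) (?a ` {1..})" by (simp add: inj_on_def)
  ultimately have part1: "infinite {order_ratio G n | n. n \<ge> 1}" using inf finite_imageD by metis
  have "poly (f 2) (of_nat (?a n)) = of_nat (?a n) * of_nat (?a (n - 1))" if "n \<ge> 2" for n
    using star[of 2 n] that by (simp add: numeral_2_eq_2)
  hence part2: "\<exists>(B::nat) (C::int). B > 0 \<and>
      (\<forall>n\<ge>2. order_ratio G n = of_nat B * order_ratio G (n - 1) + of_int C)"
    unfolding ratio using chain_index(2)[OF chain] poly_star_two_zero[OF chain assms(3) inf]
    by (intro affine_recurrence_of_star[OF inf]) auto
  have part3: "f l = Polynomial.smult (1 / of_nat B ^ (l * (l - 1) div 2))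
      (\<Prod>j<l. [:- (of_int C * (\<Sum>i<j. of_nat B ^ i)), 1:])"
    if "B > 0" "\<forall>n\<ge>2. order_ratio G n = of_nat B * order_ratio G (n - 1) + of_int C" "l \<ge> 1"
    for B l :: nat and C :: int
    using that star by (intro polynomial_of_affine_recurrence[OF inf]) (auto simp: ratio)
  show ?thesis using part1 part2 part3 by blast
qed

end
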